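(* For a policy $g\in\mathcal{G}_{\mathrm{LPC}}$ and a threshold $\tau(g)\in[0,1/\eta]$ define $$\widehat{B}(g,\tau(g))=\frac{M^2}{N^2}\left(\Big(\sum_{s=1}^N\mathbf{1}\Big\{\tfrac{1}{e(X^s,g(X^s))}>\tau(g)\Big\}\Big)^2+\sum_{s=1}^N\frac{\mathbf{1}\{D_s=g(X^s)\}}{e(X^s,g(X^s))^2}\mathbf{1}\Big\{\tfrac{1}{e(X^s,g(X^s))}\le\tau(g)\Big\}\right),$$ $$\widetilde{B}(g,\tau(g))=\frac{M^2}{N^2}\left(\Big(\sum_{s=1}^N\mathbf{1}\Big\{\tfrac{1}{e(X^s,g(X^s))}>\tau(g)\Big\}\Big)^2+\sum_{s=1}^N\frac{1}{e(X^s,g(X^s))}\mathbf{1}\Big\{\tfrac{1}{e(X^s,g(X^s))}\le\tau(g)\Big\}\right),$$ $$\Delta(g,\tau(g))=M^2\left(\frac{\tau(g)}{N}\right)^{3/2},$$ and let $\widehat{\tau}(g)$ and $\widetilde{\tau}(g)$ denote the minimizers (over the threshold) of $\widehat{B}(g,\tau(g))$ and $\widetilde{B}(g,\tau(g))$, respectively. Let $\widehat{\Psi}$ be the OCDR estimator described in the context, let $\widehat{g}\in\arg\max_{g\in\mathcal{G}_{\mathrm{LPC}}}\widehat{\Psi}(g)$ and $g^\dagger=\arg\max_{g\in\mathcal{G}_{\mathrm{LPC}}}|\widehat{\Psi}(g)-\Psi(g)|$. Suppose $N\ge\frac{2\sigma^2}{\omega}\ln\left(\frac{2N}{\delta}\right)$,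 where $\omega>0$, $\delta\in(0,1]$, and $\sigma$ is the sub-Gaussian parameter described in the context. Then, with probability at least $1-\delta$, the suboptimality $\mathcal{L}(\widehat g,\mathcal{G}_{\mathrm{LPC}})=\Psi(g^* )-\Psi(\widehat g)$, where $g^*\in\arg\max_{g\in\mathcal{G}_{\mathrm{LPC}}}\Psi(g)$, satisfies $$\mathcal{L}(\widehat g,\mathcal{G}_{\mathrm{LPC}})\le\min\left\{2\upsilon\cdot\max\left\{\widehat{B}(g^\dagger,\widehat{\tau}(g^\dagger))^{1/2},\ \widetilde{B}(g^\dagger,\widetilde{\tau}(g^\dagger))^{1/2}+\omega^{1/2},\ \Delta(g^\dagger,\widehat{\tau}(g^\dagger))^{1/2}\right\},\ M\right\},$$ where $\upsilon\ge 12M\sqrt{2J(p+1)\log(NJ^2)+2\log(16/\delta)}$.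
   Context: Data. $[J]=\{1,\dots,J\}$ is the set of treatments. The sample consists of $N$ i.i.d. units; $X^s\in\mathcal{X}\subseteq\mathbb{R}^p$ is the covariate, $D_s\in[J]$ is the treatment with known propensity score $e(\xi,j)=\mathbb{P}(D_s=j\mid X^s=\xi)$, $\{Y_s(j)\}_{j\in[J]}$ are potential outcomes, and the observed outcome is $Y_s=Y_s(D_s)=\mu(X^s,D_s)+\epsilon_s$ with $\epsilon_s$ i.i.d. mean zero and $\mu(\xi,j)=\mathbb{E}[Y_s(j)\mid X^s=\xi]$. Assumptions: (A) $Y_s(j)$ is independent of $D_s$ given $X^s$ for every $j$; (B) $e(\xi,j)\ge\eta>0$ for all $\xi\in\mathcal{X}$, $j\in[J]$; (C) $Y_s\in[0,M]$ almost surely, with $M\ge1$. Policies. $\mathcal{G}_{\mathrm{LPC}}$ is the set of linear policies $g(\xi)=\arg\max_{j\in[J]}(\xi^\top\beta^j+b_j)$ with parameters $\beta^j\in\mathbb{R}^p$ and known base scores $b_j\in\mathbb{R}$, ties broken in favour of the smallest index. The policy value is $\Psi(g)=\mathbb{E}[Y(g(X))]=\mathbb{E}[\mu(X,g(X))]$. OCDR (optimized clipped doubly robust) estimator. Let $\widehat\mu:\mathcal{X}\times[J]\to[0,M]$ be an estimate of $\mu$ fitted on a separate independent sample, hence treated as a fixed function. For each $g$ let $\widehat\tau_{\mathrm{OCDR}}(g)$ be the minimizer over $\tau\in[0,1/\eta]$ of $$\Big(\frac1N\sum_{s=1}^N\mathbf{1}\Big\{\tfrac1{e(X^s,g(X^s))}>\tau\Big\}\Big)^2+\frac{2}{N^2}\sum_{s=1}^N\frac{\mathbf{1}\{g(X^s)=D_s\}}{e(X^s,g(X^s))^2}\mathbf{1}\Big\{\tfrac1{e(X^s,g(X^s))}\le\tau\Big\}.$$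 Then $$\widehat\Psi(g)=\frac1N\sum_{s=1}^N\left[\widehat\mu(X^s,g(X^s))+\frac{\mathbf{1}\{g(X^s)=D_s\}}{e(X^s,g(X^s))}\mathbf{1}\Big\{\tfrac1{e(X^s,g(X^s))}\le\widehat\tau_{\mathrm{OCDR}}(g)\Big\}\big(Y_s-\widehat\mu(X^s,g(X^s))\big)\right].$$ Minimizers of these piecewise constant functions of the threshold are taken among $0$ and the values $1/e(X^s,g(X^s))$. It is a standing assumption that, for each policy $g$, no nonempty subset of $\{2/e(X^s,g(X^s))^2\}_{s=1}^N$ has an integer sum. The maximizers $\widehat g,g^\dagger,g^*$ are taken to exist; $\widehat g$ is a global maximizer. The parameter $\sigma$. Let $\mathcal{T}=[0,1/\eta]$, $\widehat b(\tau)=\widehat B(g^\dagger,\tau)$, $\widetilde b(\tau)=\widetilde B(g^\dagger,\tau)$, $\widetilde\tau$ the minimizer of $\widetilde b$, and $S^\omega=\{\tau\in\mathcal{T}:\widetilde b(\tau)\le\widetilde b(\widetilde\tau)+\omega\}$. Let $u:\mathcal{T}\setminus S^\omega\to S^\omega$ be a map with $\widetilde b(u(\tau))\le\widetilde b(\tau)-\omega$ for all $\tau\in\mathcal{T}\setminus S^\omega$, and let $Z(\tau)=\widehat b(u(\tau))-\widehat b(\tau)$. Then $\sigma>0$ denotes a constant such that, for every $\tau\in\mathcal{T}\setminus S^\omega$, conditionally on $X=(X^1,\dots,X^N)$, $Z(\tau)-\mathbb{E}[Z(\tau)\mid X]$ is $\sigma$-sub-Gaussian. *)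

theory Defs
  imports "HOL-Probability.Probability"
begin

text \<open>Treatments are the naturals in \<open>{1..J}\<close>, units the naturals in \<open>{1..N}\<close>.  A realised sample
  is given by \<open>xs s\<close> (covariate), \<open>ds s\<close> (treatment) and \<open>ys s\<close> (observed outcome) for
  \<open>s \<in> {1..N}\<close>.\<close>

section \<open>Linear policies\<close>

definition linear_policy ::
  "nat \<Rightarrow> (nat \<Rightarrow> real) \<Rightarrow> (nat \<Rightarrow> real ^ 'p) \<Rightarrow> real ^ 'p \<Rightarrow> nat" where
  "linear_policy J b \<beta> \<xi> =
     (LEAST j. is_arg_max (\<lambda>k. \<xi> \<bullet> \<beta> k + b k) (\<lambda>k. k \<in> {1..J}) j)"

definition LPC :: "nat \<Rightarrow> (nat \<Rightarrow> real) \<Rightarrow> (real ^ 'p \<Rightarrow> nat) set" where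
  "LPC J b = range (linear_policy J b)"

section \<open>Bounds and estimator on a realised sample\<close>

definition B_hat ::
  "real \<Rightarrow> nat \<Rightarrow> ('x \<Rightarrow> nat \<Rightarrow> real) \<Rightarrow> (nat \<Rightarrow> 'x) \<Rightarrow> (nat \<Rightarrow> nat) \<Rightarrow> ('x \<Rightarrow> nat) \<Rightarrow> real \<Rightarrow> real" where
  "B_hat M N e xs ds g \<tau> = M\<^sup>2 / (real N)\<^sup>2 *
     ((\<Sum>s=1..N. of_bool (1 / e (xs s) (g (xs s)) > \<tau>))\<^sup>2
      + (\<Sum>s=1..N. of_bool (ds s = g (xs s)) / (e (xs s) (g (xs s)))\<^sup>2
                   * of_bool (1 / e (xs s) (g (xs s)) \<le> \<tau>)))"

definition B_tilde ::
  "real \<Rightarrow> nat \<Rightarrow> ('x \<Rightarrow> nat \<Rightarrow> real) \<Rightarrow> (nat \<Rightarrow> 'x) \<Rightarrow> ('x \<Rightarrow> nat) \<Rightarrow> real \<Rightarrow> real" where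
  "B_tilde M N e xs g \<tau> = M\<^sup>2 / (real N)\<^sup>2 *
     ((\<Sum>s=1..N. of_bool (1 / e (xs s) (g (xs s)) > \<tau>))\<^sup>2
      + (\<Sum>s=1..N. 1 / e (xs s) (g (xs s)) * of_bool (1 / e (xs s) (g (xs s)) \<le> \<tau>)))"

definition Delta :: "real \<Rightarrow> nat \<Rightarrow> real \<Rightarrow> real" where
  "Delta M N \<tau> = M\<^sup>2 * (\<tau> / real N) powr (3/2)"

definition ocdr_objective ::
  "nat \<Rightarrow> ('x \<Rightarrow> nat \<Rightarrow> real) \<Rightarrow> (nat \<Rightarrow> 'x) \<Rightarrow> (nat \<Rightarrow> nat) \<Rightarrow> ('x \<Rightarrow> nat) \<Rightarrow> real \<Rightarrow> real" where
  "ocdr_objective N e xs ds g \<tau> =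
     (1 / real N * (\<Sum>s=1..N. of_bool (1 / e (xs s) (g (xs s)) > \<tau>)))\<^sup>2
     + 2 / (real N)\<^sup>2 *
       (\<Sum>s=1..N. of_bool (g (xs s) = ds s) / (e (xs s) (g (xs s)))\<^sup>2
                  * of_bool (1 / e (xs s) (g (xs s)) \<le> \<tau>))"

definition clipped_dr_value ::
  "nat \<Rightarrow> ('x \<Rightarrow> nat \<Rightarrow> real) \<Rightarrow> ('x \<Rightarrow> nat \<Rightarrow> real) \<Rightarrow> (nat \<Rightarrow> 'x) \<Rightarrow> (nat \<Rightarrow> nat) \<Rightarrow> (nat \<Rightarrow> real)
     \<Rightarrow> ('x \<Rightarrow> nat) \<Rightarrow> real \<Rightarrow> real" where
  "clipped_dr_value N e \<mu>h xs ds ys g \<tau> =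
     1 / real N * (\<Sum>s=1..N. \<mu>h (xs s) (g (xs s))
        + of_bool (g (xs s) = ds s) / e (xs s) (g (xs s))
          * of_bool (1 / e (xs s) (g (xs s)) \<le> \<tau>) * (ys s - \<mu>h (xs s) (g (xs s))))"

text \<open>A minimizer over all thresholds in \<open>[0, 1/\<eta>]\<close>, located at one of the breakpoints of the
  piecewise constant objective \<open>F\<close>.\<close>

definition threshold_minimizer ::
  "real \<Rightarrow> nat \<Rightarrow> ('x \<Rightarrow> nat \<Rightarrow> real) \<Rightarrow> (nat \<Rightarrow> 'x) \<Rightarrow> ('x \<Rightarrow> nat) \<Rightarrow> (real \<Rightarrow> real) \<Rightarrow> real \<Rightarrow> bool" where
  "threshold_minimizer \<eta> N e xs g F \<tau> \<longleftrightarrow>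
     \<tau> \<in> insert 0 ((\<lambda>s. 1 / e (xs s) (g (xs s))) ` {1..N}) \<and>
     is_arg_min F (\<lambda>t. t \<in> {0..1/\<eta>}) \<tau>"

definition no_integer_subsum ::
  "nat \<Rightarrow> ('x \<Rightarrow> nat \<Rightarrow> real) \<Rightarrow> (nat \<Rightarrow> 'x) \<Rightarrow> ('x \<Rightarrow> nat) \<Rightarrow> bool" where
  "no_integer_subsum N e xs g \<longleftrightarrow>
     (\<forall>S. S \<subseteq> {1..N} \<and> S \<noteq> {} \<longrightarrow> (\<Sum>s\<in>S. 2 / (e (xs s) (g (xs s)))\<^sup>2) \<notin> \<int>)"

section \<open>Conditioning\<close>

definition cond_indep ::
  "'w measure \<Rightarrow> 'w measure \<Rightarrow> ('w \<Rightarrow> real) \<Rightarrow> ('w \<Rightarrow> nat) \<Rightarrow> bool" where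
  "cond_indep P F V T \<longleftrightarrow>
     (\<forall>A\<in>sets borel. \<forall>k. AE w in P.
        real_cond_exp P F (\<lambda>v. indicator A (V v) * of_bool (T v = k)) w
        = real_cond_exp P F (\<lambda>v. indicator A (V v)) w * real_cond_exp P F (\<lambda>v. of_bool (T v = k)) w)"

text \<open>Given \<open>F\<close>, the centred variable \<open>Z - E[Z | F]\<close> is sub-Gaussian with parameter \<open>\<sigma>\<close>,
  almost everywhere on \<open>E\<close>.\<close>

definition cond_sub_gaussian_on ::
  "'w measure \<Rightarrow> 'w measure \<Rightarrow> 'w set \<Rightarrow> real \<Rightarrow> ('w \<Rightarrow> real) \<Rightarrow> bool" where
  "cond_sub_gaussian_on P F E \<sigma> Z \<longleftrightarrow> integrable P Z \<and>
     (\<forall>l::real. AE w in P. w \<in> E \<longrightarrow>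
        nn_cond_exp P F (\<lambda>v. ennreal (exp (l * (Z v - real_cond_exp P F Z v)))) w
        \<le> ennreal (exp (l\<^sup>2 * \<sigma>\<^sup>2 / 2)))"

section \<open>The sampling model\<close>

text \<open>\<open>Y s j\<close> is the potential outcome of unit \<open>s\<close> under treatment \<open>j\<close>.\<close>

definition unit_space :: "nat \<Rightarrow> ((real ^ 'p) \<times> nat \<times> (nat \<Rightarrow> real)) measure" where
  "unit_space J = borel \<Otimes>\<^sub>M (count_space {1..J} \<Otimes>\<^sub>M PiM {1..J} (\<lambda>_. borel))"

definition unit_data ::
  "nat \<Rightarrow> (nat \<Rightarrow> 'w \<Rightarrow> real ^ 'p) \<Rightarrow> (nat \<Rightarrow> 'w \<Rightarrow> nat) \<Rightarrow> (nat \<Rightarrow> nat \<Rightarrow> 'w \<Rightarrow> real) \<Rightarrow> nat \<Rightarrow> 'w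
     \<Rightarrow> (real ^ 'p) \<times> nat \<times> (nat \<Rightarrow> real)" where
  "unit_data J X D Y s w = (X s w, D s w, \<lambda>j\<in>{1..J}. Y s j w)"

definition sigma_unit :: "'w measure \<Rightarrow> (nat \<Rightarrow> 'w \<Rightarrow> real ^ 'p) \<Rightarrow> nat \<Rightarrow> 'w measure" where
  "sigma_unit P X s = vimage_algebra (space P) (X s) borel"

definition sigma_covariates ::
  "'w measure \<Rightarrow> nat \<Rightarrow> (nat \<Rightarrow> 'w \<Rightarrow> real ^ 'p) \<Rightarrow> 'w measure" where
  "sigma_covariates P N X =
     vimage_algebra (space P) (\<lambda>w. \<lambda>s\<in>{1..N}. X s w) (PiM {1..N} (\<lambda>_. borel))"

text \<open>The units are identically distributed, so the population value of a policy can be read off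
  the first one.\<close>

definition policy_value ::
  "'w measure \<Rightarrow> (nat \<Rightarrow> 'w \<Rightarrow> real ^ 'p) \<Rightarrow> (nat \<Rightarrow> nat \<Rightarrow> 'w \<Rightarrow> real) \<Rightarrow> (real ^ 'p \<Rightarrow> nat) \<Rightarrow> real" where
  "policy_value P X Y g = (\<integral>w. Y 1 (g (X 1 w)) w \<partial>P)"

locale observational_study = prob_space P
  for P :: "'w measure" +
  fixes N J :: nat
    and \<X> :: "(real ^ 'p) set"
    and X :: "nat \<Rightarrow> 'w \<Rightarrow> real ^ 'p"
    and D :: "nat \<Rightarrow> 'w \<Rightarrow> nat"
    and Y :: "nat \<Rightarrow> nat \<Rightarrow> 'w \<Rightarrow> real"
    and e \<mu> :: "real ^ 'p \<Rightarrow> nat \<Rightarrow> real"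
    and \<eta> M :: real
  assumes N_pos: "N \<ge> 1"
    and J_pos: "J \<ge> 1"
    and units_indep: "indep_vars (\<lambda>_. unit_space J) (unit_data J X D Y) {1..N}"
    and units_ident: "\<And>s t. s \<in> {1..N} \<Longrightarrow> t \<in> {1..N} \<Longrightarrow>
        distr P (unit_space J) (unit_data J X D Y s) = distr P (unit_space J) (unit_data J X D Y t)"
    and X_range: "\<And>s w. s \<in> {1..N} \<Longrightarrow> w \<in> space P \<Longrightarrow> X s w \<in> \<X>"
    and e_measurable: "\<And>j. j \<in> {1..J} \<Longrightarrow> (\<lambda>\<xi>. e \<xi> j) \<in> borel_measurable (restrict_space borel \<X>)"
    and e_propensity: "\<And>s j. s \<in> {1..N} \<Longrightarrow> j \<in> {1..J} \<Longrightarrow>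
        AE w in P. e (X s w) j = real_cond_exp P (sigma_unit P X s) (\<lambda>v. of_bool (D s v = j)) w"
    and Y_integrable: "\<And>s j. s \<in> {1..N} \<Longrightarrow> j \<in> {1..J} \<Longrightarrow> integrable P (Y s j)"
    and \<mu>_measurable: "\<And>j. j \<in> {1..J} \<Longrightarrow> (\<lambda>\<xi>. \<mu> \<xi> j) \<in> borel_measurable (restrict_space borel \<X>)"
    and \<mu>_regression: "\<And>s j. s \<in> {1..N} \<Longrightarrow> j \<in> {1..J} \<Longrightarrow>
        AE w in P. \<mu> (X s w) j = real_cond_exp P (sigma_unit P X s) (Y s j) w"
    \<comment> \<open>the noise inherits independence and identical distribution from the units\<close>
    and noise_centred: "\<And>s. s \<in> {1..N} \<Longrightarrow> expectation (\<lambda>w. Y s (D s w) w - \<mu> (X s w) (D s w)) = 0"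
    and unconfounded: "\<And>s j. s \<in> {1..N} \<Longrightarrow> j \<in> {1..J} \<Longrightarrow>
        cond_indep P (sigma_unit P X s) (Y s j) (D s)"
    and \<eta>_pos: "\<eta> > 0"
    and overlap: "\<And>\<xi> j. \<xi> \<in> \<X> \<Longrightarrow> j \<in> {1..J} \<Longrightarrow> e \<xi> j \<ge> \<eta>"
    and M_ge_1: "M \<ge> 1"
    and Y_bounded: "\<And>s. s \<in> {1..N} \<Longrightarrow> AE w in P. Y s (D s w) w \<in> {0..M}"

end

theory Submission
  imports Defs
begin

text \<open>Since \<open>g_hat\<close> maximises the estimated value and \<open>g_dag\<close> has the largest estimation error, the
suboptimality is at most twice the estimation error of \<open>g_dag\<close>.  It therefore suffices to bound, on one
event of probability \<open>1 - \<delta>\<close> and for all linear policies at once, the error of the estimated value by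
\<open>12 * sqrt L\<close> times the larger of \<open>sqrt (B_hat ...)\<close> and \<open>sqrt (B_tilde ...)\<close> at their own minimizers,
where \<open>L\<close> is the logarithmic term under the root in the bound on \<open>\<upsilon>\<close> (lemma \<open>uniform_deviation\<close>).
The other bound, \<open>M\<close>, holds because the regression function, hence every policy value, lies in \<open>[0, M]\<close>.

Write \<open>A\<close> for the inverse propensity weight of a unit, that is \<open>1/e\<close> if the unit received the treatment
chosen by the policy and \<open>0\<close> otherwise.  The error of a policy splits into three parts.

\<^item> The \<^emph>\<open>sampling error\<close> of the empirical mean of the regression function along the policy.  It is of order
  \<open>M * sqrt (L / N)\<close> uniformly over policies, by symmetrization with a ghost sample
  (\<open>symmetrized_exp_sup_le\<close>) and a count of the labelings that linear policies induce on finitely many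
  points (\<open>card_linear_labelings_le\<close>).  It is covered by \<open>B_tilde\<close>, which is never below \<open>M^2 / N\<close>.

\<^item> The \<^emph>\<open>clipping bias\<close>, at most \<open>M\<close> times the fraction of clipped units.  It is covered by \<open>B_hat\<close>,
  because the objective minimised by the clipping threshold lies between \<open>B_hat / M^2\<close> and twice that.

\<^item> The \<^emph>\<open>noise\<close> of the retained weighted residuals.  A Bernstein bound would leave a term linear in the
  largest retained weight, which neither \<open>B_hat\<close> nor \<open>B_tilde\<close> controls.  Instead the residuals are normalised by
  their own squared weights: the inequality \<open>exp (x - x^2) \<le> 1 + x + min (x^2) (2 * |x|)\<close> shows that, given
  the covariates, \<open>exp (\<plusminus> l * noise - l^2 * M^2 * A^2 - min (l^2 * M^2 / e) (2 * l * M))\<close> has mean at most \<open>1\<close>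
  for every single unit (\<open>conditional_weight_le\<close>).

The minimum in the last exponent is what lets the threshold \<open>\<tau>o\<close> of the estimator be compared with the
minimizer \<open>\<tau>t\<close> of \<open>B_tilde\<close>, although neither dominates the other: retained units with \<open>1/e \<le> \<tau>t\<close> are
charged \<open>l^2 * M^2 / e\<close>, which sums to the variance part of \<open>B_tilde\<close>, while retained units beyond \<open>\<tau>t\<close> are
charged \<open>2 * l * M\<close> each, and their number is the bias part of \<open>B_tilde\<close>.  The squared weights sum to the
variance part of \<open>B_hat\<close>.  A union bound over labelings, clipping sets and a geometric grid of values of \<open>l\<close>,
followed by the choice of \<open>l\<close> that balances the terms (\<open>clipped_dr_error_le\<close>), gives the noise bound.\<close>

section \<open>Sign patterns of linear forms\<close>

text \<open>Deletion of a point merges two sets of the family exactly when they differ in that point only, which is what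
the second summand counts.\<close>

lemma card_traces_insert:
  assumes fin: "finite I" and i: "i \<notin> I" and F: "F \<subseteq> Pow (insert i I)"
  shows "card F = card ((\<lambda>S. S - {i}) ` F) + card {S. i \<notin> S \<and> S \<in> F \<and> insert i S \<in> F}"
proof -
  define A where "A = {S \<in> F. i \<notin> S}"
  define B where "B = (\<lambda>S. S - {i}) ` {S \<in> F. i \<in> S}"
  have finF: "finite F"
    using F fin by (meson finite_Pow_iff finite_insert finite_subset)
  have "card F = card A + card {S \<in> F. i \<in> S}"
  proof -
    have "F = A \<union> {S \<in> F. i \<in> S}" "A \<inter> {S \<in> F. i \<in> S} = {}" by (auto simp: A_def)
    moreover have "finite A" "finite {S \<in> F. i \<in> S}" using finF by (auto simp: A_def)
    ultimately show ?thesis using card_Un_disjoint[of A "{S \<in> F. i \<in> S}"] by metis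
  qed
  also have "card {S \<in> F. i \<in> S} = card B"
    unfolding B_def by (rule card_image[symmetric]) (auto simp: inj_on_def)
  also have "card A + card B = card (A \<union> B) + card (A \<inter> B)"
    using finF by (intro card_Un_Int) (auto simp: A_def B_def)
  also have "A \<union> B = (\<lambda>S. S - {i}) ` F"
  proof -
    have "(\<lambda>S. S - {i}) ` A = A" unfolding A_def by (auto simp: image_iff)
    moreover have "F = A \<union> {S \<in> F. i \<in> S}" unfolding A_def by auto
    ultimately show ?thesis unfolding B_def
      using image_Un[of "\<lambda>S. S - {i}" A "{S \<in> F. i \<in> S}"] by metis
  qed
  also have "A \<inter> B = {S. i \<notin> S \<and> S \<in> F \<and> insert i S \<in> F}"
  proof (rule set_eqI)
    fix S
    have "S \<in> B \<longleftrightarrow> insert i S \<in> F" if "i \<notin> S"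
    proof
      assume "S \<in> B"
      then obtain T where "S = T - {i}" "T \<in> F" "i \<in> T" unfolding B_def by blast
      then show "insert i S \<in> F" by (simp add: insert_absorb)
    next
      assume "insert i S \<in> F"
      moreover have "S = insert i S - {i}" using that by simp
      ultimately show "S \<in> B" unfolding B_def by blast
    qed
    then show "S \<in> A \<inter> B \<longleftrightarrow> S \<in> {S. i \<notin> S \<and> S \<in> F \<and> insert i S \<in> F}"
      unfolding A_def by blast
  qed
  finally show ?thesis .
qed

text \<open>The forms are homogeneous; intercepts enter as additional coordinates of the parameter \<open>\<theta>\<close>.\<close>

definition halfspace_patterns :: "'i set \<Rightarrow> 'k set \<Rightarrow> ('i \<Rightarrow> 'k \<Rightarrow> real) \<Rightarrow> 'i set set" where
  "halfspace_patterns I K a = range (\<lambda>\<theta>. {i \<in> I. (\<Sum>k\<in>K. a i k * \<theta> k) \<ge> 0})"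

lemma halfspace_patterns_subset: "halfspace_patterns I K a \<subseteq> Pow I"
  by (auto simp: halfspace_patterns_def)

lemma finite_halfspace_patterns: "finite I \<Longrightarrow> finite (halfspace_patterns I K a)"
  using halfspace_patterns_subset[of I K a] by (meson finite_Pow_iff finite_subset)

text \<open>If a pattern on \<open>I\<close> extends in both ways to a further form, the segment between two realising parameters
crosses the hyperplane where that form vanishes without changing the pattern, because both the set where a
form is nonnegative and the set where it is negative are convex.  On the hyperplane one coordinate can be
eliminated.\<close>

lemma halfspace_patterns_on_hyperplane:
  fixes a :: "'i \<Rightarrow> 'k \<Rightarrow> real"
  assumes finK: "finite K" and k0: "k0 \<in> K" and a0: "a i k0 \<noteq> 0"
    and S: "S \<in> halfspace_patterns (insert i I) K a" "i \<notin> S"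
    and S': "insert i S \<in> halfspace_patterns (insert i I) K a" and i: "i \<notin> I"
  shows "S \<in> halfspace_patterns I (K - {k0}) (\<lambda>j k. a j k - a j k0 / a i k0 * a i k)"
proof -
  define f where "f j \<theta> = (\<Sum>k\<in>K. a j k * \<theta> k)" for j and \<theta> :: "'k \<Rightarrow> real"
  obtain \<theta> \<theta>' where \<theta>: "S = {j \<in> insert i I. f j \<theta> \<ge> 0}"
    and \<theta>': "insert i S = {j \<in> insert i I. f j \<theta>' \<ge> 0}"
    using S(1) S' unfolding halfspace_patterns_def f_def by auto
  have neg: "f i \<theta> < 0" using S(2) \<theta> by auto
  have pos: "f i \<theta>' \<ge> 0" using \<theta>' by blast
  \<comment> \<open>the parameter at which the segment meets the hyperplane of the form \<open>i\<close>\<close>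
  define t where "t = f i \<theta>' / (f i \<theta>' - f i \<theta>)"
  have t: "0 \<le> t" "t < 1" using neg pos by (auto simp: t_def field_simps)
  define \<rho> where "\<rho> k = t * \<theta> k + (1 - t) * \<theta>' k" for k
  have f\<rho>: "f j \<rho> = t * f j \<theta> + (1 - t) * f j \<theta>'" for j
    by (simp add: f_def \<rho>_def sum_distrib_left sum.distrib[symmetric] algebra_simps)
  have i0: "f i \<rho> = 0"
    unfolding f\<rho> t_def using neg pos by (simp add: field_simps)
  have same: "f j \<rho> \<ge> 0 \<longleftrightarrow> j \<in> S" if j: "j \<in> I" for j
  proof -
    have e1: "j \<in> S \<longleftrightarrow> f j \<theta> \<ge> 0" using \<theta> j by auto
    have "j \<noteq> i" using i j by auto
    then have e2: "j \<in> S \<longleftrightarrow> f j \<theta>' \<ge> 0" using \<theta>' j by blast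
    show ?thesis
    proof (cases "j \<in> S")
      case True
      then show ?thesis using e1 e2 t unfolding f\<rho> by simp
    next
      case False
      then have "f j \<theta> < 0" "f j \<theta>' < 0" using e1 e2 by auto
      then have "t * f j \<theta> \<le> 0" "(1 - t) * f j \<theta>' < 0"
        using t by (auto simp: mult_nonneg_nonpos mult_pos_neg)
      then show ?thesis using False unfolding f\<rho> by simp
    qed
  qed
  have elim: "(\<Sum>k\<in>K - {k0}. (a j k - a j k0 / a i k0 * a i k) * \<rho> k) = f j \<rho>" for j
  proof -
    have "(\<Sum>k\<in>K - {k0}. (a j k - a j k0 / a i k0 * a i k) * \<rho> k)
        = (\<Sum>k\<in>K. (a j k - a j k0 / a i k0 * a i k) * \<rho> k)"
      using finK k0 a0 by (intro sum.mono_neutral_left) auto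
    also have "\<dots> = f j \<rho> - a j k0 / a i k0 * f i \<rho>"
      by (simp add: f_def sum_subtractf sum_distrib_left algebra_simps)
    finally show ?thesis using i0 by simp
  qed
  have "S \<subseteq> I" using \<theta> S(2) by auto
  then have "S = {j \<in> I. (\<Sum>k\<in>K - {k0}. (a j k - a j k0 / a i k0 * a i k) * \<rho> k) \<ge> 0}"
    unfolding elim using same by auto
  then show ?thesis unfolding halfspace_patterns_def by blast
qed

text \<open>Deletion and restriction: adding a form to \<open>m\<close> forms in dimension \<open>d\<close> creates at most as many new patterns as
there are patterns of \<open>m\<close> forms in dimension \<open>d - 1\<close>, and \<open>(m+1)^d + (m+1)^(d-1) \<le> (m+2)^d\<close>.\<close>

lemma card_halfspace_patterns:
  assumes "finite I" "finite K"
  shows "card (halfspace_patterns I K a) \<le> (card I + 1) ^ card K"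
  using assms
proof (induction I arbitrary: K a rule: finite_induct)
  case empty
  have "halfspace_patterns {} K a = {{}}" by (auto simp: halfspace_patterns_def)
  then show ?case by simp
next
  case (insert i I)
  let ?F = "halfspace_patterns (insert i I) K a"
  let ?D = "{S. i \<notin> S \<and> S \<in> ?F \<and> insert i S \<in> ?F}"
  have "(\<lambda>S. S - {i}) ` ?F = halfspace_patterns I K a"
  proof -
    have "{j \<in> insert i I. (\<Sum>k\<in>K. a j k * \<theta> k) \<ge> 0} - {i} = {j \<in> I. (\<Sum>k\<in>K. a j k * \<theta> k) \<ge> 0}" for \<theta>
      using insert.hyps by auto
    then show ?thesis unfolding halfspace_patterns_def by (simp add: image_image)
  qed
  then have card: "card ?F = card (halfspace_patterns I K a) + card ?D"
    using card_traces_insert[OF insert.hyps(1,2) halfspace_patterns_subset[of "insert i I" K a]] by simp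
  have IH: "card (halfspace_patterns I K a) \<le> (card I + 1) ^ card K"
    using insert.IH insert.prems by blast
  show ?case
  proof (cases "\<exists>k0\<in>K. a i k0 \<noteq> 0")
    case False
    then have "(\<Sum>k\<in>K. a i k * \<theta> k) = 0" for \<theta> by (intro sum.neutral) auto
    then have "i \<in> S" if "S \<in> ?F" for S
      using that unfolding halfspace_patterns_def by auto
    then have "?D = {}" by blast
    then have "card ?F \<le> (card I + 1) ^ card K" using card IH by (simp only: card.empty add_0_right)
    also have "\<dots> \<le> (card (insert i I) + 1) ^ card K"
      using insert.hyps by (intro power_mono) auto
    finally show ?thesis .
  next
    case True
    then obtain k0 where k0: "k0 \<in> K" "a i k0 \<noteq> 0" by blast
    let ?a = "\<lambda>j k. a j k - a j k0 / a i k0 * a i k"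
    have "?D \<subseteq> halfspace_patterns I (K - {k0}) ?a"
      using halfspace_patterns_on_hyperplane[of K k0 a i] insert.prems k0 insert.hyps by blast
    then have "card ?D \<le> card (halfspace_patterns I (K - {k0}) ?a)"
      by (intro card_mono finite_halfspace_patterns insert.hyps)
    also have "\<dots> \<le> (card I + 1) ^ card (K - {k0})"
      using insert.IH insert.prems by blast
    finally have D: "card ?D \<le> (card I + 1) ^ card (K - {k0})" .
    define d where "d = card (K - {k0})"
    have d: "card K = Suc d" "card (K - {k0}) = d"
      unfolding d_def by (simp_all only: card_Suc_Diff1[OF insert.prems k0(1)])
    have "card ?F \<le> (card I + 1) ^ Suc d + (card I + 1) ^ d"
      unfolding card using IH D unfolding d by (rule add_mono)
    also have "\<dots> = (card I + 2) * (card I + 1) ^ d"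
      by (simp only: power_Suc) (simp add: algebra_simps)
    also have "\<dots> \<le> (card I + 2) * (card I + 2) ^ d"
      by (intro mult_left_mono power_mono) auto
    also have "\<dots> = (card (insert i I) + 1) ^ card K"
      using insert.hyps by (simp add: d(1))
    finally show ?thesis .
  qed
qed

section \<open>Linear policies: labelings and separability\<close>

text \<open>All base scores are allowed.  A class with free intercepts is needed for a countable dense subclass, which has
to break ties by perturbing the base scores.\<close>

definition linear_policies :: "nat \<Rightarrow> (real ^ 'p \<Rightarrow> nat) set" where
  "linear_policies J = (\<Union>b. LPC J b)"

lemma linear_policies_iff: "g \<in> linear_policies J \<longleftrightarrow> (\<exists>b \<beta>. g = linear_policy J b \<beta>)"
  by (auto simp: linear_policies_def LPC_def)

lemma linear_policy_eq_iff:
  assumes J: "J \<ge> 1"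
  shows "linear_policy J b \<beta> \<xi> = j \<longleftrightarrow> j \<in> {1..J} \<and>
    (\<forall>k\<in>{1..J}. \<xi> \<bullet> \<beta> k + b k \<le> \<xi> \<bullet> \<beta> j + b j \<and>
                (k < j \<longrightarrow> \<xi> \<bullet> \<beta> k + b k < \<xi> \<bullet> \<beta> j + b j))"
    (is "?g = j \<longleftrightarrow> ?R j")
proof -
  define s where "s k = \<xi> \<bullet> \<beta> k + b k" for k
  define A where "A = is_arg_max s (\<lambda>k. k \<in> {1..J})"
  have A: "A i \<longleftrightarrow> i \<in> {1..J} \<and> (\<forall>k\<in>{1..J}. s k \<le> s i)" for i
    unfolding A_def is_arg_max_def by (auto simp: not_less)
  have g: "?g = (LEAST i. A i)"
    unfolding linear_policy_def A_def s_def ..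
  have "\<exists>i. A i"
  proof -
    have "Max (s ` {1..J}) \<in> s ` {1..J}" using J by (intro Max_in) auto
    then obtain i where "i \<in> {1..J}" "s i = Max (s ` {1..J})" by auto
    then have "A i" unfolding A by auto
    then show ?thesis ..
  qed
  then have Ag: "A ?g" unfolding g by (rule LeastI_ex)
  have least: "\<not> A k" if "k < ?g" for k
    using that not_less_Least[of k A] unfolding g by blast
  have Rg: "?R ?g"
  proof -
    have "s k < s ?g" if k: "k \<in> {1..J}" "k < ?g" for k
    proof (rule ccontr)
      assume "\<not> s k < s ?g"
      then have "A k" using Ag k unfolding A by force
      then show False using least k by blast
    qed
    then show ?thesis using Ag unfolding A s_def by blast
  qed
  have "i = ?g" if "?R i" for i
  proof (rule ccontr)
    assume "i \<noteq> ?g"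
    then consider "i < ?g" | "?g < i" by linarith
    then show False
    proof cases
      case 1
      then show False using Rg that by (meson not_le)
    next
      case 2
      then show False using Rg that by (meson not_le)
    qed
  qed
  then show ?thesis using Rg by blast
qed

lemma linear_policy_in_range: "J \<ge> 1 \<Longrightarrow> linear_policy J b \<beta> \<xi> \<in> {1..J}"
  using linear_policy_eq_iff by blast

lemma linear_policies_in_range: "J \<ge> 1 \<Longrightarrow> g \<in> linear_policies J \<Longrightarrow> g \<xi> \<in> {1..J}"
  using linear_policy_in_range by (auto simp: linear_policies_iff)

text \<open>The chosen treatment depends only on the outcome of the comparisons between pairs \<open>j < k\<close>; weak comparison in
favour of the smaller index encodes the rule for ties.\<close>

lemma linear_policy_cong:
  assumes J: "J \<ge> 1"
    and same: "\<And>j k. j \<in> {1..J} \<Longrightarrow> k \<in> {1..J} \<Longrightarrow> j < k \<Longrightarrow>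
      \<xi>' \<bullet> \<beta>' k + b' k \<le> \<xi>' \<bullet> \<beta>' j + b' j \<longleftrightarrow> \<xi> \<bullet> \<beta> k + b k \<le> \<xi> \<bullet> \<beta> j + b j"
  shows "linear_policy J b' \<beta>' \<xi>' = linear_policy J b \<beta> \<xi>"
proof -
  define j where "j = linear_policy J b \<beta> \<xi>"
  have j: "j \<in> {1..J}" and max: "\<And>k. k \<in> {1..J} \<Longrightarrow> \<xi> \<bullet> \<beta> k + b k \<le> \<xi> \<bullet> \<beta> j + b j"
    and strict: "\<And>k. k \<in> {1..J} \<Longrightarrow> k < j \<Longrightarrow> \<xi> \<bullet> \<beta> k + b k < \<xi> \<bullet> \<beta> j + b j"
    using linear_policy_eq_iff[OF J, of b \<beta> \<xi> j] j_def by auto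
  have below: "\<xi>' \<bullet> \<beta>' k + b' k < \<xi>' \<bullet> \<beta>' j + b' j" if "k \<in> {1..J}" "k < j" for k
    using same[OF that(1) j that(2)] strict[OF that] by linarith
  moreover have "\<xi>' \<bullet> \<beta>' k + b' k \<le> \<xi>' \<bullet> \<beta>' j + b' j" if k: "k \<in> {1..J}" for k
  proof (cases k j rule: linorder_cases)
    case less
    then show ?thesis using below[OF k less] by linarith
  next
    case equal
    then show ?thesis by simp
  next
    case greater
    then show ?thesis using same[OF j k greater] max[OF k] by blast
  qed
  ultimately have "linear_policy J b' \<beta>' \<xi>' = j"
    using linear_policy_eq_iff[OF J, of b' \<beta>' \<xi>' j] j by blast
  then show ?thesis unfolding j_def .
qed

lemma measurable_linear_policies:
  assumes J: "J \<ge> 1" and g: "g \<in> linear_policies J"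
  shows "g \<in> borel \<rightarrow>\<^sub>M count_space UNIV"
proof -
  obtain b \<beta> where g: "g = linear_policy J b \<beta>" using g by (auto simp: linear_policies_iff)
  have "g -` {j} \<in> sets borel" for j
  proof -
    have "g -` {j} = {\<xi>. j \<in> {1..J} \<and>
      (\<forall>k\<in>{1..J}. \<xi> \<bullet> \<beta> k + b k \<le> \<xi> \<bullet> \<beta> j + b j \<and>
                (k < j \<longrightarrow> \<xi> \<bullet> \<beta> k + b k < \<xi> \<bullet> \<beta> j + b j))}"
      unfolding g by (intro set_eqI) (simp only: vimage_singleton_eq mem_Collect_eq linear_policy_eq_iff[OF J])
    also have "\<dots> \<in> sets borel" by measurable
    finally show ?thesis .
  qed
  then show ?thesis
    by (subst measurable_count_space_eq2_countable) auto
qed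

lemma card_treatment_pairs: "2 * card (SIGMA k:{1..J}. {1..<k}) + J = J * J"
proof -
  have "card (SIGMA k:{1..J}. {1..<k}) = (\<Sum>k=1..J. k - 1)"
    by (subst card_SigmaI) auto
  moreover have "2 * (\<Sum>k=1..J. k - 1) + J = J * J"
    by (induction J) auto
  ultimately show ?thesis by simp
qed

lemma card_image_le_of_factor:
  assumes fin: "finite (h ` A)" and factor: "\<And>x y. x \<in> A \<Longrightarrow> y \<in> A \<Longrightarrow> h x = h y \<Longrightarrow> f x = f y"
  shows "finite (f ` A)" "card (f ` A) \<le> card (h ` A)"
proof -
  define r where "r y = (SOME x. x \<in> A \<and> h x = y)" for y
  have "f x = f (r (h x))" if "x \<in> A" for x
  proof -
    have "r (h x) \<in> A \<and> h (r (h x)) = h x"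
      unfolding r_def by (rule someI[of _ x]) (use that in auto)
    then show ?thesis using factor that by metis
  qed
  then have sub: "f ` A \<subseteq> (\<lambda>y. f (r y)) ` h ` A" by auto
  show "finite (f ` A)" using sub fin by (meson finite_imageI finite_subset)
  show "card (f ` A) \<le> card (h ` A)"
    using sub fin by (meson card_image_le card_mono finite_imageI le_trans)
qed

lemma sum_UNIV_option:
  fixes f :: "'p::finite option \<Rightarrow> real"
  shows "(\<Sum>q\<in>UNIV. f q) = f None + (\<Sum>i\<in>UNIV. f (Some i))"
proof -
  have "(\<Sum>q\<in>UNIV. f q) = f None + (\<Sum>q\<in>range Some. f q)"
    unfolding UNIV_option_conv by (subst sum.insert) auto
  also have "(\<Sum>q\<in>range Some. f q) = (\<Sum>i\<in>UNIV. f (Some i))"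
    by (subst sum.reindex) (auto simp: inj_on_def)
  finally show ?thesis .
qed

text \<open>A labeling of the points \<open>x s\<close> is determined by a sign pattern (\<open>linear_policy_cong\<close>).  The forms are indexed
by a point and a pair of treatments; the coordinates are the entries of the \<open>J\<close> coefficient vectors and the
\<open>J\<close> intercepts.\<close>

lemma card_linear_labelings:
  fixes x :: "'i \<Rightarrow> real ^ 'p"
  assumes J: "J \<ge> 1" and I: "finite I"
  defines "L \<equiv> (\<lambda>g. \<lambda>s\<in>I. g (x s)) ` linear_policies J"
  shows "finite L"
    and "card L \<le> (card I * card (SIGMA k:{1..J}. {1..<k}) + 1) ^ (J * (CARD('p) + 1))"
proof -
  define II where "II = I \<times> (SIGMA k:{1..J}. {1..<k})"
  define KK where "KK = {1..J} \<times> (UNIV :: 'p option set)"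
  define v where "v s q = (case q of None \<Rightarrow> 1 | Some i \<Rightarrow> x s $ i)" for s q
  define a where "a = (\<lambda>(s, k::nat, j::nat) (l::nat, q). (of_bool (l = j) - of_bool (l = k)) * v s q)"
  define \<theta> where "\<theta> b \<beta> = (\<lambda>(l, q). case q of None \<Rightarrow> b l | Some i \<Rightarrow> \<beta> l $ i)"
    for b :: "nat \<Rightarrow> real" and \<beta> :: "nat \<Rightarrow> real ^ 'p"
  define f where "f = (\<lambda>(b, \<beta>). \<lambda>s\<in>I. linear_policy J b \<beta> (x s))"
  define h where "h = (\<lambda>(b, \<beta>). {i \<in> II. (\<Sum>k\<in>KK. a i k * \<theta> b \<beta> k) \<ge> 0})"
  have finII: "finite II" and finKK: "finite KK" using I by (auto simp: II_def KK_def)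
  have L: "L = range f"
  proof -
    have "linear_policies J = range (\<lambda>(b, \<beta>). linear_policy J b \<beta> :: real ^ 'p \<Rightarrow> nat)"
      by (auto simp: linear_policies_def LPC_def)
    then show ?thesis unfolding L_def f_def by (simp add: image_image case_prod_unfold)
  qed
  have score: "(\<Sum>k\<in>KK. a (s, k', j) k * \<theta> b \<beta> k) = (x s \<bullet> \<beta> j + b j) - (x s \<bullet> \<beta> k' + b k')"
    if jk: "j \<in> {1..J}" "k' \<in> {1..J}" for s j k' b \<beta>
  proof -
    have inner: "(\<Sum>q\<in>UNIV. v s q * \<theta> b \<beta> (l, q)) = x s \<bullet> \<beta> l + b l" for l
      unfolding sum_UNIV_option v_def \<theta>_def by (simp add: inner_vec_def)
    have "(\<Sum>k\<in>KK. a (s, k', j) k * \<theta> b \<beta> k)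
        = (\<Sum>l\<in>{1..J}. \<Sum>q\<in>UNIV. a (s, k', j) (l, q) * \<theta> b \<beta> (l, q))"
      unfolding KK_def by (simp add: sum.cartesian_product)
    also have "\<dots> = (\<Sum>l\<in>{1..J}. (of_bool (l = j) - of_bool (l = k')) * (x s \<bullet> \<beta> l + b l))"
      unfolding inner[symmetric] a_def by (simp add: sum_distrib_left mult.assoc)
    also have "\<dots> = (\<Sum>l\<in>{1..J}. of_bool (l = j) * (x s \<bullet> \<beta> l + b l))
        - (\<Sum>l\<in>{1..J}. of_bool (l = k') * (x s \<bullet> \<beta> l + b l))"
      by (simp add: sum_subtractf left_diff_distrib)
    also have "\<dots> = (x s \<bullet> \<beta> j + b j) - (x s \<bullet> \<beta> k' + b k')"
      using jk by (simp add: of_bool_def if_distrib if_distribR sum.delta cong: if_cong)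
    finally show ?thesis .
  qed
  have factor: "f p = f p'" if eq: "h p = h p'" for p p'
  proof -
    obtain b \<beta> b' \<beta>' where p: "p = (b, \<beta>)" "p' = (b', \<beta>')" by (metis surj_pair)
    have "linear_policy J b \<beta> (x s) = linear_policy J b' \<beta>' (x s)" if s: "s \<in> I" for s
    proof (rule linear_policy_cong[OF J])
      fix j k assume jk: "j \<in> {1..J}" "k \<in> {1..J}" "j < k"
      have mem: "(s, k, j) \<in> II" using s jk by (auto simp: II_def)
      have "(s, k, j) \<in> h p \<longleftrightarrow> (s, k, j) \<in> h p'" using eq by simp
      then show "x s \<bullet> \<beta> k + b k \<le> x s \<bullet> \<beta> j + b j \<longleftrightarrow> x s \<bullet> \<beta>' k + b' k \<le> x s \<bullet> \<beta>' j + b' j"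
        unfolding p h_def using mem by (simp add: score[OF jk(1,2)])
    qed
    then show ?thesis unfolding f_def p by (auto simp: restrict_def)
  qed
  have sub: "range h \<subseteq> halfspace_patterns II KK a"
    unfolding h_def halfspace_patterns_def by auto
  have fin: "finite (range h)"
    using sub finite_halfspace_patterns[OF finII] finite_subset by blast
  show "finite L" unfolding L by (rule card_image_le_of_factor(1)[OF fin]) (rule factor)
  have "card L \<le> card (range h)" unfolding L by (rule card_image_le_of_factor(2)[OF fin]) (rule factor)
  also have "\<dots> \<le> card (halfspace_patterns II KK a)"
    by (rule card_mono[OF finite_halfspace_patterns[OF finII] sub])
  also have "\<dots> \<le> (card II + 1) ^ card KK"
    by (rule card_halfspace_patterns[OF finII finKK])
  also have "card II = card I * card (SIGMA k:{1..J}. {1..<k})"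
    unfolding II_def by (rule card_cartesian_product)
  also have "card KK = J * (CARD('p) + 1)"
    unfolding KK_def by (simp add: card_cartesian_product card_UNIV_option)
  finally show "card L \<le> (card I * card (SIGMA k:{1..J}. {1..<k}) + 1) ^ (J * (CARD('p) + 1))" .
qed

text \<open>The factor \<open>2\<close> leaves room for the doubled sample of the symmetrization argument; it is absorbed because there
are only \<open>J * (J - 1) / 2\<close> pairs of treatments.\<close>

lemma card_linear_labelings_le:
  fixes x :: "'i \<Rightarrow> real ^ 'p"
  assumes J: "J \<ge> 1" and N: "N \<ge> 1" and I: "finite I" "card I \<le> 2 * N"
  shows "card ((\<lambda>g. \<lambda>s\<in>I. g (x s)) ` linear_policies J) \<le> (N * J\<^sup>2) ^ (J * (CARD('p) + 1))"
proof -
  define m where "m = card (SIGMA k:{1..J}. {1..<k})"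
  have m: "2 * m + J = J * J" unfolding m_def by (rule card_treatment_pairs)
  have "card I * m + 1 \<le> 2 * N * m + N * J"
    using I N J by (intro add_mono mult_right_mono) auto
  also have "\<dots> = N * (2 * m + J)" by (simp add: algebra_simps)
  finally have "card I * m + 1 \<le> N * J\<^sup>2" unfolding m by (simp add: power2_eq_square)
  then have "(card I * m + 1) ^ (J * (CARD('p) + 1)) \<le> (N * J\<^sup>2) ^ (J * (CARD('p) + 1))"
    by (rule power_mono) simp
  then show ?thesis
    using card_linear_labelings(2)[OF J I(1), of x] unfolding m_def by (rule order_trans[rotated])
qed

text \<open>Suprema over the policies become measurable through this countable subclass.  A policy \<open>g\<close> is approximated by
moving its parameters into a countable dense set, at distance \<open>1/(n+1)^2\<close>, after lowering the \<open>k\<close>-th base score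
by \<open>k/(n+1)\<close>.  At a tie the lowering decides for the smallest index, as \<open>g\<close> does, and it dominates the
rounding error; away from ties both perturbations vanish in the limit.\<close>

lemma linear_policies_separable:
  assumes J: "J \<ge> 1"
  obtains G :: "(real ^ 'p \<Rightarrow> nat) set" where "countable G" "G \<subseteq> linear_policies J"
    and "\<And>g. g \<in> linear_policies J \<Longrightarrow>
      \<exists>h. (\<forall>n. h n \<in> G) \<and> (\<forall>\<xi>. eventually (\<lambda>n. h n \<xi> = g \<xi>) sequentially)"
proof -
  obtain E :: "((real ^ 'p) \<times> real) set" where E: "countable E"
    and dense: "\<And>U. open U \<Longrightarrow> U \<noteq> {} \<Longrightarrow> \<exists>d\<in>E. d \<in> U"
    using countable_dense_exists[where 'a = "(real ^ 'p) \<times> real"] by blast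
  define pol where "pol \<gamma> = linear_policy J (\<lambda>k. snd (\<gamma> k)) (\<lambda>k. fst (\<gamma> k))"
    for \<gamma> :: "nat \<Rightarrow> (real ^ 'p) \<times> real"
  define G where "G = pol ` PiE {1..J} (\<lambda>_. E)"
  have "countable G"
    unfolding G_def using E by (intro countable_image countable_PiE) auto
  moreover have "G \<subseteq> linear_policies J"
    unfolding G_def pol_def using linear_policies_iff by blast
  moreover have "\<exists>h. (\<forall>n. h n \<in> G) \<and> (\<forall>\<xi>. eventually (\<lambda>n. h n \<xi> = g \<xi>) sequentially)"
    if g: "g \<in> linear_policies J" for g
  proof -
    obtain b \<beta> where g: "g = linear_policy J b \<beta>" using g by (auto simp: linear_policies_iff)
    define c where "c n k = (\<beta> k, b k - real k / real (Suc n))" for n k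
    have "\<forall>n k. \<exists>d. d \<in> E \<and> dist d (c n k) < 1 / (real (Suc n))\<^sup>2"
    proof (intro allI)
      fix n k
      have "ball (c n k) (1 / (real (Suc n))\<^sup>2) \<noteq> {}" by (simp add: ball_eq_empty)
      then obtain d where "d \<in> E" "d \<in> ball (c n k) (1 / (real (Suc n))\<^sup>2)"
        using dense[OF open_ball] by blast
      then show "\<exists>d. d \<in> E \<and> dist d (c n k) < 1 / (real (Suc n))\<^sup>2"
        by (metis dist_commute mem_ball)
    qed
    then obtain d where d: "\<And>n k. d n k \<in> E" "\<And>n k. dist (d n k) (c n k) < 1 / (real (Suc n))\<^sup>2"
      by metis
    define \<gamma> where "\<gamma> n = restrict (d n) {1..J}" for n
    have "pol (\<gamma> n) \<in> G" for n
      unfolding G_def \<gamma>_def using d(1) by auto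
    moreover have "eventually (\<lambda>n. pol (\<gamma> n) \<xi> = g \<xi>) sequentially" for \<xi>
    proof -
      define s where "s k = \<xi> \<bullet> \<beta> k + b k" for k
      define t where "t n k = \<xi> \<bullet> fst (\<gamma> n k) + snd (\<gamma> n k)" for n k
      have close: "\<bar>t n k - (s k - real k / real (Suc n))\<bar> \<le> (norm \<xi> + 1) / (real (Suc n))\<^sup>2"
        if "k \<in> {1..J}" for n k
      proof -
        have g: "\<gamma> n k = d n k" unfolding \<gamma>_def using that by simp
        have 1: "norm (fst (d n k) - \<beta> k) \<le> 1 / (real (Suc n))\<^sup>2"
          using dist_fst_le[of "d n k" "c n k"] d(2)[of n k] by (simp add: c_def dist_norm)
        have 2: "\<bar>snd (d n k) - (b k - real k / real (Suc n))\<bar> \<le> 1 / (real (Suc n))\<^sup>2"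
          using dist_snd_le[of "d n k" "c n k"] d(2)[of n k] by (simp add: c_def dist_real_def)
        have "\<bar>\<xi> \<bullet> (fst (d n k) - \<beta> k)\<bar> \<le> norm \<xi> * (1 / (real (Suc n))\<^sup>2)"
          using Cauchy_Schwarz_ineq2[of \<xi> "fst (d n k) - \<beta> k"] 1
          by (meson mult_left_mono norm_ge_zero order_trans)
        moreover have "t n k - (s k - real k / real (Suc n)) = \<xi> \<bullet> (fst (d n k) - \<beta> k)
            + (snd (d n k) - (b k - real k / real (Suc n)))"
          by (simp add: t_def s_def g inner_diff_right)
        moreover have "(norm \<xi> + 1) / (real (Suc n))\<^sup>2 = norm \<xi> * (1 / (real (Suc n))\<^sup>2) + 1 / (real (Suc n))\<^sup>2"
          by (simp add: add_divide_distrib)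
        ultimately show ?thesis using 2 by linarith
      qed
      have large: "eventually (\<lambda>n. r \<le> real (Suc n)) sequentially" for r
        using eventually_ge_at_top[of "nat \<lceil>r\<rceil>"]
        by eventually_elim (simp add: nat_ceiling_le_eq)
      have pair: "eventually (\<lambda>n. t n k \<le> t n j \<longleftrightarrow> s k \<le> s j) sequentially"
        if jk: "j \<in> {1..J}" "k \<in> {1..J}" "j < k" for j k
      proof -
        have err: "eventually (\<lambda>n. 2 * ((norm \<xi> + 1) / (real (Suc n))\<^sup>2) \<le> 1 / real (Suc n)) sequentially"
          using large[of "2 * (norm \<xi> + 1)"]
        proof eventually_elim
          case (elim n)
          have "2 * ((norm \<xi> + 1) / (real (Suc n))\<^sup>2) = (2 * (norm \<xi> + 1) / real (Suc n)) / real (Suc n)"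
            by (simp only: power2_eq_square divide_divide_eq_left times_divide_eq_right)
          also have "\<dots> \<le> 1 / real (Suc n)"
            using elim by (intro divide_right_mono) (auto simp: divide_le_eq_1)
          finally show ?case .
        qed
        show ?thesis
        proof (cases "s k \<le> s j")
          case True
          show ?thesis using err
          proof eventually_elim
            case (elim n)
            have "real k / real (Suc n) - real j / real (Suc n) \<ge> 1 / real (Suc n)"
              using jk by (simp add: diff_divide_distrib[symmetric] divide_right_mono)
            then show ?case using close[OF jk(1), of n] close[OF jk(2), of n] elim True by linarith
          qed
        next
          case False
          define q where "q = s k - s j"
          have q: "q > 0" using False by (simp add: q_def)
          show ?thesis using err large[of "(real J + 2) / q"]
          proof eventually_elim
            case (elim n)
            have "(real J + 2) / real (Suc n) \<le> q"
              using elim(2) q by (simp add: field_simps)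
            moreover have "real k / real (Suc n) - real j / real (Suc n) \<le> real J / real (Suc n)"
              using jk by (simp add: diff_divide_distrib[symmetric] divide_right_mono)
            moreover have "(real J + 2) / real (Suc n) = real J / real (Suc n) + 2 * (1 / real (Suc n))"
              "1 / real (Suc n) > 0"
              by (simp_all add: add_divide_distrib)
            ultimately show ?case
              using close[OF jk(1), of n] close[OF jk(2), of n] elim(1) False unfolding q_def by linarith
          qed
        qed
      qed
      have "eventually (\<lambda>n. \<forall>k\<in>{1..J}. \<forall>j\<in>{1..J}. j < k \<longrightarrow> (t n k \<le> t n j \<longleftrightarrow> s k \<le> s j)) sequentially"
      proof (intro eventually_ball_finite ballI finite_atLeastAtMost)
        fix k j assume kj: "k \<in> {1..J}" "j \<in> {1..J}"
        show "eventually (\<lambda>n. j < k \<longrightarrow> (t n k \<le> t n j \<longleftrightarrow> s k \<le> s j)) sequentially"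
        proof (cases "j < k")
          case True
          show ?thesis using pair[OF kj(2,1) True] by (rule eventually_mono) simp
        next
          case False
          then show ?thesis by simp
        qed
      qed
      then show ?thesis
        unfolding g pol_def
        by eventually_elim (rule linear_policy_cong[OF J], auto simp: t_def s_def)
    qed
    ultimately show ?thesis by (intro exI[of _ "\<lambda>n. pol (\<gamma> n)"]) auto
  qed
  ultimately show ?thesis using that by blast
qed

section \<open>Symmetrization\<close>

text \<open>This is Hoeffding's bound on the moment generating function of a symmetric sign.\<close>

lemma exp_plus_exp_minus_le:
  fixes u :: real
  shows "exp u + exp (- u) \<le> 2 * exp (u\<^sup>2 / 2)"
proof -
  have *: "exp u + exp (- u) \<le> 2 * exp (u\<^sup>2 / 2)" if u: "u \<ge> 0" for u :: real
  proof -
    have "- (2 * u) * (1/2) + ln (1 + 1/2 * (exp (2 * u) - 1)) \<le> (2 * u)\<^sup>2 / 8"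
      by (rule Hoeffdings_lemma_aux) (use u in auto)
    then have "ln (1 + 1/2 * (exp (2 * u) - 1)) \<le> u + u\<^sup>2 / 2"
      by (simp add: power_mult_distrib)
    moreover have "1 + 1/2 * (exp (2 * u) - 1) > (0::real)"
      using exp_gt_zero[of "2 * u"] by (simp add: field_simps add_pos_pos)
    ultimately have "1 + 1/2 * (exp (2 * u) - 1) \<le> exp (u + u\<^sup>2 / 2)"
      by (metis exp_le_cancel_iff exp_ln)
    then have "1 + exp (2 * u) \<le> 2 * exp (u + u\<^sup>2 / 2)" by argo
    then have "exp (- u) * (1 + exp (2 * u)) \<le> exp (- u) * (2 * exp (u + u\<^sup>2 / 2))"
      by (intro mult_left_mono) simp_all
    also have "exp (- u) * (1 + exp (2 * u)) = exp u + exp (- u)"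
      by (simp add: distrib_left exp_add[symmetric])
    also have "exp (- u) * (2 * exp (u + u\<^sup>2 / 2)) = 2 * exp (u\<^sup>2 / 2)"
      by (simp add: exp_add[symmetric])
    finally show ?thesis .
  qed
  show ?thesis using *[of u] *[of "- u"] by (cases "u \<ge> 0") (auto simp: add.commute)
qed

text \<open>Jensen's inequality for the exponential, in the form that replaces an expectation by an independent copy.\<close>

lemma (in prob_space) exp_sub_mean_le:
  fixes f :: "'a \<Rightarrow> real"
  assumes [measurable]: "f \<in> borel_measurable M" and bnd: "\<And>z. z \<in> space M \<Longrightarrow> f z \<in> {0..B}"
  shows "ennreal (exp (l * (c - expectation f))) \<le> (\<integral>\<^sup>+ y. ennreal (exp (l * (c - f y))) \<partial>M)"
proof -
  have int: "integrable M f"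
    by (rule integrable_const_bound[where B = B]) (use bnd in force)+
  let ?m = "expectation f"
  have int_exp: "integrable M (\<lambda>y. exp (l * (c - f y)))"
  proof (rule integrable_const_bound[where B = "exp (\<bar>l\<bar> * (\<bar>c\<bar> + B))"])
    show "AE y in M. norm (exp (l * (c - f y))) \<le> exp (\<bar>l\<bar> * (\<bar>c\<bar> + B))"
    proof (rule AE_I2)
      fix y assume "y \<in> space M"
      then have "\<bar>c - f y\<bar> \<le> \<bar>c\<bar> + B" using bnd[of y] by auto
      then have "\<bar>l\<bar> * \<bar>c - f y\<bar> \<le> \<bar>l\<bar> * (\<bar>c\<bar> + B)" by (intro mult_left_mono) auto
      moreover have "l * (c - f y) \<le> \<bar>l\<bar> * \<bar>c - f y\<bar>" by (metis abs_ge_self abs_mult)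
      ultimately show "norm (exp (l * (c - f y))) \<le> exp (\<bar>l\<bar> * (\<bar>c\<bar> + B))" by simp
    qed
  qed measurable
  have "exp (l * (c - ?m)) = expectation (\<lambda>y. exp (l * (c - ?m)) * (1 + l * (?m - f y)))"
    using int by (simp add: prob_space)
  also have "ennreal \<dots> \<le> ennreal (expectation (\<lambda>y. exp (l * (c - f y))))"
  proof (intro ennreal_leI integral_mono)
    show "integrable M (\<lambda>y. exp (l * (c - ?m)) * (1 + l * (?m - f y)))" using int by simp
    show "integrable M (\<lambda>y. exp (l * (c - f y)))" by (rule int_exp)
    fix y
    have "exp (l * (c - ?m)) * (1 + l * (?m - f y)) \<le> exp (l * (c - ?m)) * exp (l * (?m - f y))"
      by (intro mult_left_mono exp_ge_add_one_self) auto
    also have "\<dots> = exp (l * (c - f y))" by (simp add: exp_add[symmetric] algebra_simps)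
    finally show "exp (l * (c - ?m)) * (1 + l * (?m - f y)) \<le> exp (l * (c - f y))" .
  qed
  also have "\<dots> = (\<integral>\<^sup>+ y. ennreal (exp (l * (c - f y))) \<partial>M)"
    by (rule nn_integral_eq_integral[OF int_exp, symmetric]) simp
  finally show ?thesis .
qed

text \<open>The sample is indexed by \<open>{1..N}\<close> and its ghost copy by \<open>{N+1..2 * N}\<close>; the permutation exchanges \<open>s\<close> with
\<open>s + N\<close> for \<open>s \<in> \<epsilon>\<close>.\<close>

definition swap_pairs :: "nat \<Rightarrow> nat set \<Rightarrow> nat \<Rightarrow> nat" where
  "swap_pairs N \<epsilon> s =
     (if s \<le> N then (if s \<in> \<epsilon> then s + N else s) else (if s - N \<in> \<epsilon> then s - N else s))"

text \<open>Averaging over all sign patterns factorises, and each factor is a hyperbolic cosine.\<close>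

lemma sum_swaps_exp_le:
  fixes d :: "nat \<Rightarrow> real"
  assumes d: "\<And>s. s \<in> {1..N} \<Longrightarrow> \<bar>d s\<bar> \<le> B"
  shows "(\<Sum>\<epsilon>\<in>Pow {1..N}. exp (\<Sum>s=1..N. if s \<in> \<epsilon> then - d s else d s)) \<le> 2 ^ N * exp (real N * B\<^sup>2 / 2)"
proof -
  have "(\<Sum>\<epsilon>\<in>Pow {1..N}. exp (\<Sum>s=1..N. if s \<in> \<epsilon> then - d s else d s))
      = (\<Sum>\<epsilon>\<in>Pow {1..N}. (\<Prod>s\<in>\<epsilon>. exp (- d s)) * (\<Prod>s\<in>{1..N} - \<epsilon>. exp (d s)))"
  proof (rule sum.cong[OF refl])
    fix \<epsilon> assume "\<epsilon> \<in> Pow {1..N}"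
    then have e: "{1..N} \<inter> \<epsilon> = \<epsilon>" "{1..N} \<inter> - \<epsilon> = {1..N} - \<epsilon>" by auto
    have "exp (\<Sum>s=1..N. if s \<in> \<epsilon> then - d s else d s) = (\<Prod>s=1..N. if s \<in> \<epsilon> then exp (- d s) else exp (d s))"
      by (subst exp_sum) (auto intro!: prod.cong)
    also have "\<dots> = (\<Prod>s\<in>\<epsilon>. exp (- d s)) * (\<Prod>s\<in>{1..N} - \<epsilon>. exp (d s))"
      using prod.If_cases[of "{1..N}" "\<lambda>s. s \<in> \<epsilon>" "\<lambda>s. exp (- d s)" "\<lambda>s. exp (d s)"] e
      by (simp add: Collect_mem_eq)
    finally show "exp (\<Sum>s=1..N. if s \<in> \<epsilon> then - d s else d s)
      = (\<Prod>s\<in>\<epsilon>. exp (- d s)) * (\<Prod>s\<in>{1..N} - \<epsilon>. exp (d s))" .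
  qed
  also have "\<dots> = (\<Prod>s=1..N. exp (- d s) + exp (d s))"
    by (rule prod_add[symmetric]) simp
  also have "\<dots> \<le> (\<Prod>s=1..N. 2 * exp (B\<^sup>2 / 2))"
  proof (rule prod_mono)
    fix s assume s: "s \<in> {1..N}"
    have "exp (- d s) + exp (d s) \<le> 2 * exp ((d s)\<^sup>2 / 2)"
      using exp_plus_exp_minus_le[of "d s"] by simp
    also have "\<dots> \<le> 2 * exp (B\<^sup>2 / 2)"
      using d[OF s] by (simp add: abs_le_square_iff[symmetric])
    finally show "0 \<le> exp (- d s) + exp (d s) \<and> exp (- d s) + exp (d s) \<le> 2 * exp (B\<^sup>2 / 2)"
      by (simp add: add_nonneg_nonneg)
  qed
  also have "\<dots> = 2 ^ N * exp (real N * B\<^sup>2 / 2)"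
    by (simp add: power_mult_distrib exp_of_nat_mult[symmetric])
  finally show ?thesis .
qed

text \<open>The mean of \<open>f\<close> is replaced by a ghost sample (Jensen), after which the joint law is invariant under
exchanging members of the two samples.  Averaged over all exchanges, the supremum is pointwise at most a sum
over the at most \<open>K\<close> value vectors of the class on the doubled sample.\<close>

lemma (in prob_space) symmetrized_exp_sup_le:
  fixes F :: "('a \<Rightarrow> real) set"
  assumes F: "countable F"
    and meas [measurable]: "\<And>f. f \<in> F \<Longrightarrow> f \<in> borel_measurable M"
    and bnd: "\<And>f z. f \<in> F \<Longrightarrow> z \<in> space M \<Longrightarrow> f z \<in> {0..B}"
    and growth: "\<And>\<omega>. \<omega> \<in> {1..2 * N} \<rightarrow> space M \<Longrightarrow>
        finite ((\<lambda>f. \<lambda>s\<in>{1..2 * N}. f (\<omega> s)) ` F) \<and> card ((\<lambda>f. \<lambda>s\<in>{1..2 * N}. f (\<omega> s)) ` F) \<le> K"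
  shows "(\<integral>\<^sup>+ x. (SUP f\<in>F. ennreal (exp (l * (\<Sum>s=1..N. f (x s) - expectation f)))) \<partial>PiM {1..N} (\<lambda>_. M))
    \<le> ennreal (real K * exp (real N * (l * B)\<^sup>2 / 2))"
proof -
  interpret product_sigma_finite "\<lambda>_ :: nat. M" by standard
  let ?I = "{1..N}" and ?I' = "{N+1..2 * N}" and ?A = "{1..2 * N}"
  have un: "?I \<union> ?I' = ?A" and dis: "?I \<inter> ?I' = {}" by auto
  define H where "H \<omega> = (SUP f\<in>F. ennreal (exp (l * (\<Sum>s=1..N. f (\<omega> s) - f (\<omega> (s + N))))))" for \<omega>
  have H[measurable]: "H \<in> borel_measurable (PiM ?A (\<lambda>_. M))"
    unfolding H_def
  proof (intro borel_measurable_SUP F)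
    fix f assume f[measurable]: "f \<in> F"
    have comp: "(\<lambda>\<omega>. f (\<omega> s)) \<in> borel_measurable (PiM ?A (\<lambda>_. M))" if "s \<in> ?A" for s
      using measurable_compose[OF measurable_component_singleton[OF that] meas[OF f]] .
    show "(\<lambda>\<omega>. ennreal (exp (l * (\<Sum>s=1..N. f (\<omega> s) - f (\<omega> (s + N)))))) \<in> borel_measurable (PiM ?A (\<lambda>_. M))"
      by (intro measurable_compose[OF _ measurable_ennreal] measurable_compose[OF _ borel_measurable_exp]
          borel_measurable_times borel_measurable_const borel_measurable_sum borel_measurable_diff comp) auto
  qed
  have jensen: "ennreal (exp (l * (\<Sum>s=1..N. f (x s) - expectation f)))
      \<le> (\<integral>\<^sup>+ y. ennreal (exp (l * (\<Sum>s=1..N. f (x s) - f (y (s + N))))) \<partial>PiM ?I' (\<lambda>_. M))"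
    if f: "f \<in> F" for f x
  proof -
    have shift: "(\<Prod>s\<in>?I'. h (s - N)) = (\<Prod>s\<in>?I. h s)" for h :: "nat \<Rightarrow> ennreal"
      by (rule prod.reindex_bij_witness[of _ "\<lambda>s. s + N" "\<lambda>s. s - N"]) auto
    have "ennreal (exp (l * (\<Sum>s=1..N. f (x s) - expectation f)))
        = (\<Prod>s\<in>?I. ennreal (exp (l * (f (x s) - expectation f))))"
      by (simp add: sum_distrib_left exp_sum prod_ennreal)
    also have "\<dots> = (\<Prod>s\<in>?I'. ennreal (exp (l * (f (x (s - N)) - expectation f))))"
      by (rule shift[symmetric])
    also have "\<dots> \<le> (\<Prod>s\<in>?I'. \<integral>\<^sup>+ y. ennreal (exp (l * (f (x (s - N)) - f y))) \<partial>M)"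
      by (intro prod_mono_ennreal exp_sub_mean_le[OF meas[OF f] bnd[OF f]])
    also have "\<dots> = (\<integral>\<^sup>+ y. (\<Prod>s\<in>?I'. ennreal (exp (l * (f (x (s - N)) - f (y s))))) \<partial>PiM ?I' (\<lambda>_. M))"
      using f by (intro product_nn_integral_prod[symmetric]) measurable
    also have "\<dots> = (\<integral>\<^sup>+ y. ennreal (exp (l * (\<Sum>s=1..N. f (x s) - f (y (s + N))))) \<partial>PiM ?I' (\<lambda>_. M))"
    proof (intro nn_integral_cong)
      fix y
      have "(\<Prod>s\<in>?I'. ennreal (exp (l * (f (x (s - N)) - f (y s)))))
          = (\<Prod>s\<in>?I'. ennreal (exp (l * (f (x (s - N)) - f (y (s - N + N))))))"
        by (intro prod.cong) auto
      also have "\<dots> = (\<Prod>s\<in>?I. ennreal (exp (l * (f (x s) - f (y (s + N))))))"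
        by (rule shift)
      also have "\<dots> = ennreal (exp (l * (\<Sum>s=1..N. f (x s) - f (y (s + N)))))"
        by (simp add: sum_distrib_left exp_sum prod_ennreal)
      finally show "(\<Prod>s\<in>?I'. ennreal (exp (l * (f (x (s - N)) - f (y s))))) = \<dots>" .
    qed
    finally show ?thesis .
  qed
  have "(\<integral>\<^sup>+ x. (SUP f\<in>F. ennreal (exp (l * (\<Sum>s=1..N. f (x s) - expectation f)))) \<partial>PiM ?I (\<lambda>_. M))
      \<le> (\<integral>\<^sup>+ x. (\<integral>\<^sup>+ y. H (merge ?I ?I' (x, y)) \<partial>PiM ?I' (\<lambda>_. M)) \<partial>PiM ?I (\<lambda>_. M))"
  proof (intro nn_integral_mono SUP_least)
    fix x f assume f: "f \<in> F"
    have "ennreal (exp (l * (\<Sum>s=1..N. f (x s) - expectation f)))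
      \<le> (\<integral>\<^sup>+ y. ennreal (exp (l * (\<Sum>s=1..N. f (x s) - f (y (s + N))))) \<partial>PiM ?I' (\<lambda>_. M))"
      by (rule jensen[OF f])
    also have "\<dots> \<le> (\<integral>\<^sup>+ y. H (merge ?I ?I' (x, y)) \<partial>PiM ?I' (\<lambda>_. M))"
    proof (intro nn_integral_mono)
      fix y
      have "(\<Sum>s=1..N. f (x s) - f (y (s + N)))
          = (\<Sum>s=1..N. f (merge ?I ?I' (x, y) s) - f (merge ?I ?I' (x, y) (s + N)))"
        by (intro sum.cong) (auto simp: merge_def)
      then show "ennreal (exp (l * (\<Sum>s=1..N. f (x s) - f (y (s + N))))) \<le> H (merge ?I ?I' (x, y))"
        unfolding H_def using f by (auto intro!: SUP_upper2[of f])
    qed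
    finally show "ennreal (exp (l * (\<Sum>s=1..N. f (x s) - expectation f)))
      \<le> (\<integral>\<^sup>+ y. H (merge ?I ?I' (x, y)) \<partial>PiM ?I' (\<lambda>_. M))" .
  qed
  also have "\<dots> = (\<integral>\<^sup>+ \<omega>. H \<omega> \<partial>PiM ?A (\<lambda>_. M))"
    using product_nn_integral_fold[OF dis _ _ H[folded un]] unfolding un by simp
  also have "\<dots> \<le> ennreal (real K * exp (real N * (l * B)\<^sup>2 / 2))"
  proof -
    let ?sw = "\<lambda>\<epsilon> \<omega>. \<lambda>n\<in>?A. \<omega> (swap_pairs N \<epsilon> n)"
    have inv: "(\<integral>\<^sup>+ \<omega>. H \<omega> \<partial>PiM ?A (\<lambda>_. M)) = (\<integral>\<^sup>+ \<omega>. H (?sw \<epsilon> \<omega>) \<partial>PiM ?A (\<lambda>_. M))"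
      and sw_meas: "?sw \<epsilon> \<in> PiM ?A (\<lambda>_. M) \<rightarrow>\<^sub>M PiM ?A (\<lambda>_. M)"
      if \<epsilon>: "\<epsilon> \<in> Pow ?I" for \<epsilon>
    proof -
      have ran: "swap_pairs N \<epsilon> \<in> ?A \<rightarrow> ?A"
        using \<epsilon> by (auto simp: swap_pairs_def)
      have inj: "inj_on (swap_pairs N \<epsilon>) ?A"
      proof (rule inj_on_inverseI[of _ "swap_pairs N \<epsilon>"])
        fix s assume "s \<in> ?A"
        then show "swap_pairs N \<epsilon> (swap_pairs N \<epsilon> s) = s"
          using \<epsilon> by (auto simp: swap_pairs_def)
      qed
      show sw: "?sw \<epsilon> \<in> PiM ?A (\<lambda>_. M) \<rightarrow>\<^sub>M PiM ?A (\<lambda>_. M)"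
        by (rule measurable_restrict) (use ran in \<open>auto intro!: measurable_component_singleton\<close>)
      have "distr (PiM ?A (\<lambda>_. M)) (PiM ?A (\<lambda>_. M)) (?sw \<epsilon>) = PiM ?A (\<lambda>_. M)"
        using distr_PiM_reindex[of ?A "\<lambda>_. M" "swap_pairs N \<epsilon>" ?A] inj ran prob_space_axioms by auto
      then show "(\<integral>\<^sup>+ \<omega>. H \<omega> \<partial>PiM ?A (\<lambda>_. M)) = (\<integral>\<^sup>+ \<omega>. H (?sw \<epsilon> \<omega>) \<partial>PiM ?A (\<lambda>_. M))"
        using nn_integral_distr[OF sw, of H] H by simp
    qed
    have pointwise: "(\<Sum>\<epsilon>\<in>Pow ?I. H (?sw \<epsilon> \<omega>)) \<le> ennreal (2 ^ N * (real K * exp (real N * (l * B)\<^sup>2 / 2)))"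
      if \<omega>: "\<omega> \<in> space (PiM ?A (\<lambda>_. M))" for \<omega>
    proof -
      define V where "V = (\<lambda>f. \<lambda>s\<in>?A. f (\<omega> s)) ` F"
      have \<omega>': "\<omega> \<in> ?A \<rightarrow> space M" using \<omega> by (auto simp: space_PiM)
      have V: "finite V" "card V \<le> K" using growth[OF \<omega>'] by (auto simp: V_def)
      define d where "d v s = l * (v s - v (s + N))" for v :: "nat \<Rightarrow> real" and s
      have bound: "H (?sw \<epsilon> \<omega>) \<le> (\<Sum>v\<in>V. ennreal (exp (\<Sum>s=1..N. if s \<in> \<epsilon> then - d v s else d v s)))"
        if \<epsilon>: "\<epsilon> \<in> Pow ?I" for \<epsilon>
        unfolding H_def
      proof (rule SUP_least)
        fix f assume f: "f \<in> F"
        let ?v = "\<lambda>s\<in>?A. f (\<omega> s)"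
        have "l * (\<Sum>s=1..N. f (?sw \<epsilon> \<omega> s) - f (?sw \<epsilon> \<omega> (s + N)))
            = (\<Sum>s=1..N. if s \<in> \<epsilon> then - d ?v s else d ?v s)"
          unfolding sum_distrib_left
          by (intro sum.cong) (auto simp: d_def swap_pairs_def algebra_simps)
        then have "ennreal (exp (l * (\<Sum>s=1..N. f (?sw \<epsilon> \<omega> s) - f (?sw \<epsilon> \<omega> (s + N)))))
            = ennreal (exp (\<Sum>s=1..N. if s \<in> \<epsilon> then - d ?v s else d ?v s))" by simp
        also have "\<dots> \<le> (\<Sum>v\<in>V. ennreal (exp (\<Sum>s=1..N. if s \<in> \<epsilon> then - d v s else d v s)))"
          by (rule member_le_sum[of ?v V]) (use f V in \<open>auto simp: V_def\<close>)
        finally show "ennreal (exp (l * (\<Sum>s=1..N. f (?sw \<epsilon> \<omega> s) - f (?sw \<epsilon> \<omega> (s + N)))))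
          \<le> (\<Sum>v\<in>V. ennreal (exp (\<Sum>s=1..N. if s \<in> \<epsilon> then - d v s else d v s)))" .
      qed
      have vbound: "(\<Sum>\<epsilon>\<in>Pow ?I. exp (\<Sum>s=1..N. if s \<in> \<epsilon> then - d v s else d v s))
          \<le> 2 ^ N * exp (real N * (l * B)\<^sup>2 / 2)" if v: "v \<in> V" for v
      proof -
        obtain f where f: "f \<in> F" "v = (\<lambda>s\<in>?A. f (\<omega> s))" using v by (auto simp: V_def)
        have "\<bar>d v s\<bar> \<le> \<bar>l * B\<bar>" if "s \<in> {1..N}" for s
        proof -
          have "\<omega> s \<in> space M" "\<omega> (s + N) \<in> space M" using \<omega>' that by auto
          then have "\<bar>f (\<omega> s) - f (\<omega> (s + N))\<bar> \<le> \<bar>B\<bar>"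
            using bnd[OF f(1), of "\<omega> s"] bnd[OF f(1), of "\<omega> (s + N)"] by auto
          moreover have "d v s = l * (f (\<omega> s) - f (\<omega> (s + N)))"
            using that by (simp add: d_def f(2))
          ultimately show ?thesis by (simp add: abs_mult mult_left_mono)
        qed
        from sum_swaps_exp_le[of N "d v", OF this] show ?thesis by simp
      qed
      have "(\<Sum>\<epsilon>\<in>Pow ?I. H (?sw \<epsilon> \<omega>))
          \<le> (\<Sum>\<epsilon>\<in>Pow ?I. \<Sum>v\<in>V. ennreal (exp (\<Sum>s=1..N. if s \<in> \<epsilon> then - d v s else d v s)))"
        by (intro sum_mono bound)
      also have "\<dots> = (\<Sum>v\<in>V. \<Sum>\<epsilon>\<in>Pow ?I. ennreal (exp (\<Sum>s=1..N. if s \<in> \<epsilon> then - d v s else d v s)))"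
        by (rule sum.swap)
      also have "\<dots> = (\<Sum>v\<in>V. ennreal (\<Sum>\<epsilon>\<in>Pow ?I. exp (\<Sum>s=1..N. if s \<in> \<epsilon> then - d v s else d v s)))"
        by (simp add: sum_ennreal)
      also have "\<dots> \<le> (\<Sum>v\<in>V. ennreal (2 ^ N * exp (real N * (l * B)\<^sup>2 / 2)))"
        by (intro sum_mono ennreal_leI vbound)
      also have "\<dots> = ennreal (real (card V) * (2 ^ N * exp (real N * (l * B)\<^sup>2 / 2)))"
        by (simp add: ennreal_mult' ennreal_of_nat_eq_real_of_nat)
      also have "\<dots> \<le> ennreal (real K * (2 ^ N * exp (real N * (l * B)\<^sup>2 / 2)))"
        using V by (intro ennreal_leI mult_right_mono) auto
      finally show ?thesis by (simp add: mult.left_commute)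
    qed
    have "2 ^ N * (\<integral>\<^sup>+ \<omega>. H \<omega> \<partial>PiM ?A (\<lambda>_. M)) = (\<Sum>\<epsilon>\<in>Pow ?I. \<integral>\<^sup>+ \<omega>. H \<omega> \<partial>PiM ?A (\<lambda>_. M))"
      by (simp add: card_Pow)
    also have "\<dots> = (\<Sum>\<epsilon>\<in>Pow ?I. \<integral>\<^sup>+ \<omega>. H (?sw \<epsilon> \<omega>) \<partial>PiM ?A (\<lambda>_. M))"
      by (intro sum.cong refl inv)
    also have "\<dots> = (\<integral>\<^sup>+ \<omega>. (\<Sum>\<epsilon>\<in>Pow ?I. H (?sw \<epsilon> \<omega>)) \<partial>PiM ?A (\<lambda>_. M))"
      by (intro nn_integral_sum[symmetric] measurable_compose[OF sw_meas H])
    also have "\<dots> \<le> (\<integral>\<^sup>+ \<omega>. ennreal (2 ^ N * (real K * exp (real N * (l * B)\<^sup>2 / 2))) \<partial>PiM ?A (\<lambda>_. M))"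
      by (intro nn_integral_mono pointwise)
    also have "\<dots> = ennreal (2 ^ N * (real K * exp (real N * (l * B)\<^sup>2 / 2)))"
    proof -
      interpret A: prob_space "PiM ?A (\<lambda>_. M)"
        by (rule prob_space_PiM) (rule prob_space_axioms)
      show ?thesis by (simp only: nn_integral_const A.emeasure_space_1 mult_1_right)
    qed
    also have "\<dots> = 2 ^ N * ennreal (real K * exp (real N * (l * B)\<^sup>2 / 2))"
      by (simp add: ennreal_mult' ennreal_power[symmetric])
    finally show ?thesis
      by (subst (asm) ennreal_mult_le_mult_iff) (auto simp: power_eq_top_ennreal)
  qed
  finally show ?thesis .
qed

section \<open>Conditional exponential bounds for weighted residuals\<close>

text \<open>If each \<open>f i\<close> has conditional expectation at most \<open>1\<close> given \<open>p\<close>, so has the product over independent copies,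
even when weighted by a function \<open>\<Phi>\<close> of all the conditioning variables together.  Integrating out one
coordinate at a time replaces \<open>\<Phi>\<close> by its average over that coordinate and the factor by \<open>1\<close>.\<close>

lemma (in prob_space) nn_integral_prod_conditional_le:
  fixes p :: "'a \<Rightarrow> 'b" and f :: "'i \<Rightarrow> 'a \<Rightarrow> ennreal"
  assumes p [measurable]: "p \<in> M \<rightarrow>\<^sub>M S"
    and I: "finite I"
    and f: "\<And>i. i \<in> I \<Longrightarrow> f i \<in> borel_measurable M"
    and cond: "\<And>i \<phi>. i \<in> I \<Longrightarrow> \<phi> \<in> borel_measurable S \<Longrightarrow>
        (\<integral>\<^sup>+ z. \<phi> (p z) * f i z \<partial>M) \<le> (\<integral>\<^sup>+ z. \<phi> (p z) \<partial>M)"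
    and \<Phi>: "\<Phi> \<in> borel_measurable (PiM I (\<lambda>_. S))"
  shows "(\<integral>\<^sup>+ \<omega>. \<Phi> (\<lambda>i\<in>I. p (\<omega> i)) * (\<Prod>i\<in>I. f i (\<omega> i)) \<partial>PiM I (\<lambda>_. M))
    \<le> (\<integral>\<^sup>+ \<omega>. \<Phi> (\<lambda>i\<in>I. p (\<omega> i)) \<partial>PiM I (\<lambda>_. M))"
  using I f cond \<Phi>
proof (induction I arbitrary: \<Phi> rule: finite_induct)
  case empty
  then show ?case by simp
next
  case (insert i I)
  interpret product_sigma_finite "\<lambda>_ :: 'i. M" by standard
  note [measurable] = insert.prems(3)
  have fi[measurable]: "f i \<in> borel_measurable M" using insert.prems(1) by simp
  have pI: "(\<lambda>\<omega>. \<lambda>j\<in>K. p (\<omega> j)) \<in> PiM K (\<lambda>_. M) \<rightarrow>\<^sub>M PiM K (\<lambda>_. S)" for K :: "'i set"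
    by (rule measurable_restrict, rule measurable_compose[OF _ p]) (rule measurable_component_singleton)
  have prodK: "(\<lambda>\<omega>. \<Prod>j\<in>K. f j (\<omega> j)) \<in> borel_measurable (PiM K (\<lambda>_. M))"
    if "K \<subseteq> insert i I" for K
    using that insert.prems(1)
    by (intro borel_measurable_prod_ennreal measurable_compose[OF measurable_component_singleton]) auto
  have upd: "(\<lambda>(v, y). v(i := p y)) \<in> PiM I (\<lambda>_. S) \<Otimes>\<^sub>M M \<rightarrow>\<^sub>M PiM (insert i I) (\<lambda>_. S)"
    using measurable_compose[OF _ measurable_add_dim, of "\<lambda>z. (fst z, p (snd z))" "PiM I (\<lambda>_. S) \<Otimes>\<^sub>M M" I "\<lambda>_. S" i]
    by (simp add: case_prod_unfold)
  define \<Psi> where "\<Psi> v = (\<integral>\<^sup>+ y. \<Phi> (v(i := p y)) \<partial>M)" for v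
  have \<Psi>[measurable]: "\<Psi> \<in> borel_measurable (PiM I (\<lambda>_. S))"
    unfolding \<Psi>_def using measurable_compose[OF upd insert.prems(3)]
    by (intro borel_measurable_nn_integral) (simp add: case_prod_unfold)
  have restr: "(\<lambda>j\<in>insert i I. p ((x(i := y)) j)) = (\<lambda>j\<in>I. p (x j))(i := p y)" for x y
    using insert.hyps by (auto simp: fun_eq_iff restrict_def)
  have fold: "(\<integral>\<^sup>+ \<omega>. \<Phi> (\<lambda>j\<in>insert i I. p (\<omega> j)) * w \<omega> \<partial>PiM (insert i I) (\<lambda>_. M))
      = (\<integral>\<^sup>+ x. (\<integral>\<^sup>+ y. \<Phi> ((\<lambda>j\<in>I. p (x j))(i := p y)) * w (x(i := y)) \<partial>M) \<partial>PiM I (\<lambda>_. M))"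
    if "w \<in> borel_measurable (PiM (insert i I) (\<lambda>_. M))" for w :: "('i \<Rightarrow> 'a) \<Rightarrow> ennreal"
    using product_nn_integral_insert[OF insert.hyps, of "\<lambda>\<omega>. \<Phi> (\<lambda>j\<in>insert i I. p (\<omega> j)) * w \<omega>"]
      measurable_compose[OF pI insert.prems(3)] that
    by (simp only: restr borel_measurable_times_ennreal)
  have "(\<integral>\<^sup>+ \<omega>. \<Phi> (\<lambda>j\<in>insert i I. p (\<omega> j)) * (\<Prod>j\<in>insert i I. f j (\<omega> j)) \<partial>PiM (insert i I) (\<lambda>_. M))
      = (\<integral>\<^sup>+ x. (\<integral>\<^sup>+ y. \<Phi> ((\<lambda>j\<in>I. p (x j))(i := p y)) * (\<Prod>j\<in>insert i I. f j ((x(i := y)) j)) \<partial>M) \<partial>PiM I (\<lambda>_. M))"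
    by (rule fold[OF prodK]) simp
  also have "\<dots> \<le> (\<integral>\<^sup>+ x. \<Psi> (\<lambda>j\<in>I. p (x j)) * (\<Prod>j\<in>I. f j (x j)) \<partial>PiM I (\<lambda>_. M))"
  proof (intro nn_integral_mono)
    fix x assume x: "x \<in> space (PiM I (\<lambda>_. M))"
    let ?v = "\<lambda>j\<in>I. p (x j)" and ?c = "\<Prod>j\<in>I. f j (x j)"
    have v: "?v \<in> space (PiM I (\<lambda>_. S))" using measurable_space[OF pI x] .
    have phi[measurable]: "(\<lambda>q. \<Phi> (?v(i := q))) \<in> borel_measurable S"
      using measurable_compose[OF measurable_component_update[OF v insert.hyps(2)] insert.prems(3)] .
    have "(\<Prod>j\<in>insert i I. f j ((x(i := y)) j)) = f i y * ?c" for y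
    proof -
      have "(\<Prod>j\<in>I. f j ((x(i := y)) j)) = ?c"
        using insert.hyps by (intro prod.cong) auto
      then show ?thesis using insert.hyps by simp
    qed
    then have "(\<integral>\<^sup>+ y. \<Phi> (?v(i := p y)) * (\<Prod>j\<in>insert i I. f j ((x(i := y)) j)) \<partial>M)
        = (\<integral>\<^sup>+ y. (\<Phi> (?v(i := p y)) * f i y) * ?c \<partial>M)"
      by (simp only: mult.assoc)
    also have "\<dots> = (\<integral>\<^sup>+ y. \<Phi> (?v(i := p y)) * f i y \<partial>M) * ?c"
      using measurable_compose[OF p phi] by (intro nn_integral_multc) measurable
    also have "\<dots> \<le> \<Psi> ?v * ?c"
      unfolding \<Psi>_def by (intro mult_right_mono insert.prems(2)[OF _ phi]) auto
    finally show "(\<integral>\<^sup>+ y. \<Phi> (?v(i := p y)) * (\<Prod>j\<in>insert i I. f j ((x(i := y)) j)) \<partial>M) \<le> \<Psi> ?v * ?c" .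
  qed
  also have "\<dots> \<le> (\<integral>\<^sup>+ x. \<Psi> (\<lambda>j\<in>I. p (x j)) \<partial>PiM I (\<lambda>_. M))"
    by (rule insert.IH) (use insert.prems in \<open>auto simp: \<Psi>\<close>)
  also have "\<dots> = (\<integral>\<^sup>+ \<omega>. \<Phi> (\<lambda>j\<in>insert i I. p (\<omega> j)) \<partial>PiM (insert i I) (\<lambda>_. M))"
    unfolding \<Psi>_def using fold[of "\<lambda>_. 1"] by simp
  finally show ?case .
qed

lemma mult_mem_Icc: "a \<in> {0..A} \<Longrightarrow> b \<in> {0..B} \<Longrightarrow> a * b \<in> {0..A * B}"
  for a b A B :: real
  by (auto intro: mult_mono)

text \<open>The quadratic bound serves units with moderate weight, the linear one units with large weight.\<close>

lemma exp_minus_square_le: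
  fixes x :: real
  shows "exp (x - x\<^sup>2) \<le> 1 + x + min (x\<^sup>2) (2 * \<bar>x\<bar>)"
proof (cases "x \<ge> 0")
  case True
  have "exp (x - x\<^sup>2) \<le> 1 + x"
  proof (cases "x \<le> 1")
    case x: True
    have "x - x\<^sup>2 \<le> ln (1 + x)"
      by (rule ln_one_plus_pos_lower_bound[OF True x])
    then show ?thesis using True
      by (metis add_nonneg_pos exp_le_cancel_iff exp_ln less_numeral_extra(1) add.commute)
  next
    case False
    then have "x - x\<^sup>2 \<le> 0" by (simp add: power2_eq_square mult_left_le)
    then have "exp (x - x\<^sup>2) \<le> 1" by simp
    then show ?thesis using True by linarith
  qed
  then show ?thesis using True by (smt (verit) abs_of_nonneg zero_le_power2)
next
  case False
  then have x: "x < 0" by simp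
  have "x - x\<^sup>2 \<le> 0" using x zero_le_power2[of x] by linarith
  then have "exp (x - x\<^sup>2) \<le> 1" by simp
  then have 1: "exp (x - x\<^sup>2) \<le> 1 + x + 2 * \<bar>x\<bar>" using x by linarith
  have "exp (x - x\<^sup>2) \<le> exp x" by simp
  also have "\<dots> \<le> 1 + x + x\<^sup>2"
  proof -
    have "1 + (- x) \<le> exp (- x)" by (rule exp_ge_add_one_self)
    then have "exp x \<le> 1 / (1 - x)"
      using x by (simp add: exp_minus field_simps)
    also have "\<dots> \<le> 1 + x + x\<^sup>2"
    proof -
      have "(1 + x + x\<^sup>2) * (1 - x) = 1 - x * x\<^sup>2" by (simp add: algebra_simps power2_eq_square)
      moreover have "x * x\<^sup>2 \<le> 0" using x by (simp add: mult_nonpos_nonneg)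
      ultimately show ?thesis using x by (simp add: pos_divide_le_eq)
    qed
    finally show ?thesis .
  qed
  finally show ?thesis using 1 by simp
qed

text \<open>\<open>Q\<close> is the law of covariate, treatment and observed outcome of one unit.  All that the concentration argument
uses of unconfoundedness are the last two assumptions, which identify the conditional means given the covariate
of the treatment indicator and of the treated outcome.\<close>

locale unit_law = prob_space Q
  for Q :: "('x \<times> nat \<times> real) measure" +
  fixes S :: "'x measure" and J :: nat and e m \<mu>h :: "'x \<Rightarrow> nat \<Rightarrow> real" and \<eta> M :: real
  assumes sets_Q [measurable_cong]: "sets Q = sets (S \<Otimes>\<^sub>M (count_space {1..J} \<Otimes>\<^sub>M borel))"
    and e_meas: "\<And>j. j \<in> {1..J} \<Longrightarrow> (\<lambda>\<xi>. e \<xi> j) \<in> borel_measurable S"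
    and m_meas: "\<And>j. j \<in> {1..J} \<Longrightarrow> (\<lambda>\<xi>. m \<xi> j) \<in> borel_measurable S"
    and \<mu>h_meas: "\<And>j. j \<in> {1..J} \<Longrightarrow> (\<lambda>\<xi>. \<mu>h \<xi> j) \<in> borel_measurable S"
    and \<eta>: "\<eta> > 0" and M: "M > 0"
    and e_ge: "\<And>\<xi> j. \<xi> \<in> space S \<Longrightarrow> j \<in> {1..J} \<Longrightarrow> e \<xi> j \<ge> \<eta>"
    and m_range: "\<And>\<xi> j. \<xi> \<in> space S \<Longrightarrow> j \<in> {1..J} \<Longrightarrow> m \<xi> j \<in> {0..M}"
    and \<mu>h_range: "\<And>\<xi> j. \<xi> \<in> space S \<Longrightarrow> j \<in> {1..J} \<Longrightarrow> \<mu>h \<xi> j \<in> {0..M}"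
    and y_range: "AE z in Q. snd (snd z) \<in> {0..M}"
    and e_le_1: "\<And>j. j \<in> {1..J} \<Longrightarrow> AE z in Q. e (fst z) j \<le> 1"
    and propensity: "\<And>j h c. j \<in> {1..J} \<Longrightarrow> h \<in> borel_measurable S \<Longrightarrow> (\<And>\<xi>. \<xi> \<in> space S \<Longrightarrow> h \<xi> \<in> {0..c}) \<Longrightarrow>
      (\<integral>z. h (fst z) * of_bool (fst (snd z) = j) \<partial>Q) = (\<integral>z. h (fst z) * e (fst z) j \<partial>Q)"
    and regression: "\<And>j h c. j \<in> {1..J} \<Longrightarrow> h \<in> borel_measurable S \<Longrightarrow> (\<And>\<xi>. \<xi> \<in> space S \<Longrightarrow> h \<xi> \<in> {0..c}) \<Longrightarrow>
      (\<integral>z. h (fst z) * of_bool (fst (snd z) = j) * snd (snd z) \<partial>Q) = (\<integral>z. h (fst z) * e (fst z) j * m (fst z) j \<partial>Q)"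
begin

lemma fst_meas [measurable]: "fst \<in> Q \<rightarrow>\<^sub>M S"
  and treatment_meas [measurable]: "(\<lambda>z. fst (snd z)) \<in> Q \<rightarrow>\<^sub>M count_space {1..J}"
  and outcome_meas [measurable]: "(\<lambda>z. snd (snd z)) \<in> borel_measurable Q"
  by measurable

lemma fst_space: "z \<in> space Q \<Longrightarrow> fst z \<in> space S"
  using measurable_space[OF fst_meas] .

text \<open>The exponent attached to one unit under treatment \<open>j\<close>: the signed and scaled residual of the weighted outcome,
minus the self-normalising square, minus the cost that makes the conditional mean of the exponential at most
\<open>1\<close>.\<close>

definition log_weight :: "real \<Rightarrow> real \<Rightarrow> nat \<Rightarrow> 'x \<times> nat \<times> real \<Rightarrow> real" where
  "log_weight \<epsilon> l j z =
     \<epsilon> * l * (of_bool (fst (snd z) = j) / e (fst z) j * (snd (snd z) - \<mu>h (fst z) j)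
              - (m (fst z) j - \<mu>h (fst z) j))
     - l\<^sup>2 * M\<^sup>2 * (of_bool (fst (snd z) = j) / (e (fst z) j)\<^sup>2)
     - min (l\<^sup>2 * M\<^sup>2 / e (fst z) j) (2 * l * M)"

lemma log_weight_meas [measurable]:
  assumes [measurable]: "j \<in> {1..J}"
  shows "log_weight \<epsilon> l j \<in> borel_measurable Q"
proof -
  note [measurable] = e_meas[OF assms] m_meas[OF assms] \<mu>h_meas[OF assms]
  have [measurable]: "(\<lambda>z. of_bool (fst (snd z) = j) :: real) \<in> borel_measurable Q"
    by (rule measurable_compose[OF treatment_meas]) simp
  show ?thesis unfolding log_weight_def[abs_def] by measurable
qed

text \<open>The right hand side is affine in the treatment indicator and in its product with the outcome, so its
conditional mean can be read off from the two identification assumptions.\<close>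

lemma exp_log_weight_le:
  assumes z: "fst z \<in> space S" "snd (snd z) \<in> {0..M}" and j: "j \<in> {1..J}"
    and l: "l > 0" and \<epsilon>: "\<epsilon> \<in> {1, -1}"
  defines "\<kappa> \<equiv> min (l\<^sup>2 * M\<^sup>2 / e (fst z) j) (2 * l * M)"
  shows "exp (log_weight \<epsilon> l j z) \<le> exp (- (\<epsilon> * l * (m (fst z) j - \<mu>h (fst z) j) + \<kappa>))
     * (1 + \<epsilon> * l * (of_bool (fst (snd z) = j) / e (fst z) j * (snd (snd z) - \<mu>h (fst z) j))
        + of_bool (fst (snd z) = j) / e (fst z) j * \<kappa>)"
proof (cases "fst (snd z) = j")
  case False
  then show ?thesis by (simp add: log_weight_def \<kappa>_def algebra_simps)
next
  case True
  define E where "E = e (fst z) j"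
  define r where "r = snd (snd z) - \<mu>h (fst z) j"
  define x where "x = \<epsilon> * l * r / E"
  have E: "E > 0" using e_ge[OF z(1) j] \<eta> by (simp add: E_def)
  have r: "\<bar>r\<bar> \<le> M" using z(2) \<mu>h_range[OF z(1) j] by (auto simp: r_def abs_if)
  have \<epsilon>2: "\<epsilon>\<^sup>2 = 1" "\<bar>\<epsilon>\<bar> = 1" using \<epsilon> by auto
  have absx: "\<bar>x\<bar> \<le> l * M / E"
    unfolding x_def using r l E \<epsilon>2 by (simp add: abs_mult abs_divide divide_right_mono)
  have x2: "x\<^sup>2 \<le> l\<^sup>2 * M\<^sup>2 / E\<^sup>2"
  proof -
    have "\<bar>x\<bar>\<^sup>2 \<le> (l * M / E)\<^sup>2" using absx by (intro power_mono) auto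
    then show ?thesis by (simp add: power_divide power_mult_distrib)
  qed
  have "min (x\<^sup>2) (2 * \<bar>x\<bar>) \<le> \<kappa> / E"
  proof -
    have "\<kappa> / E = min (l\<^sup>2 * M\<^sup>2 / E\<^sup>2) (2 * (l * M / E))"
      unfolding \<kappa>_def E_def[symmetric] using E
      by (simp add: min_def divide_le_cancel power2_eq_square field_simps)
    then show ?thesis using x2 absx by (simp add: min_def)
  qed
  then have "exp (x - x\<^sup>2) \<le> 1 + x + \<kappa> / E"
    using exp_minus_square_le[of x] by linarith
  moreover have "exp (x - l\<^sup>2 * M\<^sup>2 / E\<^sup>2) \<le> exp (x - x\<^sup>2)" using x2 by simp
  ultimately have *: "exp (x - l\<^sup>2 * M\<^sup>2 / E\<^sup>2) \<le> 1 + x + \<kappa> / E" by linarith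
  have "log_weight \<epsilon> l j z = - (\<epsilon> * l * (m (fst z) j - \<mu>h (fst z) j) + \<kappa>) + (x - l\<^sup>2 * M\<^sup>2 / E\<^sup>2)"
    using True by (simp add: log_weight_def \<kappa>_def E_def x_def r_def algebra_simps diff_divide_distrib)
  then have "exp (log_weight \<epsilon> l j z) = exp (- (\<epsilon> * l * (m (fst z) j - \<mu>h (fst z) j) + \<kappa>)) * exp (x - l\<^sup>2 * M\<^sup>2 / E\<^sup>2)"
    by (simp add: exp_add)
  also have "\<dots> \<le> exp (- (\<epsilon> * l * (m (fst z) j - \<mu>h (fst z) j) + \<kappa>)) * (1 + x + \<kappa> / E)"
    using * by (intro mult_left_mono) auto
  finally show ?thesis using True by (simp add: x_def r_def E_def)
qed

text \<open>For the indicator of a set of covariates, the bound above integrates to the mean of \<open>exp (- c) * (1 + c)\<close>,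
where \<open>c\<close> is the conditional mean of the two terms added to \<open>1\<close> there, and this is at most \<open>1\<close>.  Comparing the two measures
that the inequality for sets defines on the covariates extends it to all nonnegative functions.\<close>

lemma conditional_weight_le:
  assumes j: "j \<in> {1..J}" and l: "l > 0" and \<epsilon>: "\<epsilon> \<in> {1, -1}"
    and \<phi>: "\<phi> \<in> borel_measurable S"
  shows "(\<integral>\<^sup>+ z. \<phi> (fst z) * ennreal (exp (log_weight \<epsilon> l j z)) \<partial>Q) \<le> (\<integral>\<^sup>+ z. \<phi> (fst z) \<partial>Q)"
proof -
  note [measurable] = e_meas[OF j] m_meas[OF j] \<mu>h_meas[OF j] log_weight_meas[OF j]
  let ?W = "\<lambda>z. ennreal (exp (log_weight \<epsilon> l j z))"
  have on_sets: "(\<integral>\<^sup>+ z. ?W z * indicator B (fst z) \<partial>Q) \<le> (\<integral>\<^sup>+ z. indicator B (fst z) \<partial>Q)"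
    if B[measurable]: "B \<in> sets S" for B
  proof -
    define \<kappa> where "\<kappa> \<xi> = min (l\<^sup>2 * M\<^sup>2 / e \<xi> j) (2 * l * M)" for \<xi>
    define c where "c \<xi> = \<epsilon> * l * (m \<xi> j - \<mu>h \<xi> j) + \<kappa> \<xi>" for \<xi>
    define h where "h \<xi> = indicator B \<xi> * exp (- c \<xi>)" for \<xi>
    have \<kappa>_meas[measurable]: "\<kappa> \<in> borel_measurable S" unfolding \<kappa>_def[abs_def] by measurable
    have c_meas[measurable]: "c \<in> borel_measurable S" unfolding c_def[abs_def] by measurable
    have h_meas[measurable]: "h \<in> borel_measurable S" unfolding h_def[abs_def] by measurable
    have epos: "e \<xi> j > 0" if "\<xi> \<in> space S" for \<xi> using e_ge[OF that j] \<eta> by simp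
    have \<kappa>b: "0 \<le> \<kappa> \<xi>" "\<kappa> \<xi> \<le> 2 * l * M" if "\<xi> \<in> space S" for \<xi>
      using epos[OF that] l M by (auto simp: \<kappa>_def)
    have dm: "\<bar>m \<xi> j - \<mu>h \<xi> j\<bar> \<le> M" if "\<xi> \<in> space S" for \<xi>
      using m_range[OF that j] \<mu>h_range[OF that j] by (auto simp: abs_if)
    have el: "\<bar>\<epsilon> * l * (m \<xi> j - \<mu>h \<xi> j)\<bar> \<le> l * M" if "\<xi> \<in> space S" for \<xi>
      using dm[OF that] l \<epsilon> by (auto simp: abs_mult)
    have hb: "h \<xi> \<in> {0..exp (l * M)}" if "\<xi> \<in> space S" for \<xi>
    proof -
      have "- c \<xi> \<le> l * M" using el[OF that] \<kappa>b[OF that] unfolding c_def by linarith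
      then show ?thesis by (auto simp: h_def indicator_def)
    qed
    have inv: "1 / e \<xi> j \<in> {0..1 / \<eta>}" if "\<xi> \<in> space S" for \<xi>
      using e_ge[OF that j] \<eta> epos[OF that] by (auto intro!: divide_left_mono)
    define h1 where "h1 \<xi> = h \<xi> / e \<xi> j" for \<xi>
    define h2 where "h2 \<xi> = h \<xi> * \<mu>h \<xi> j / e \<xi> j" for \<xi>
    define h3 where "h3 \<xi> = h \<xi> * \<kappa> \<xi> / e \<xi> j" for \<xi>
    have h123[measurable]: "h1 \<in> borel_measurable S" "h2 \<in> borel_measurable S" "h3 \<in> borel_measurable S"
      unfolding h1_def[abs_def] h2_def[abs_def] h3_def[abs_def] by measurable
    have h1b: "h1 \<xi> \<in> {0..exp (l * M) * (1 / \<eta>)}" if "\<xi> \<in> space S" for \<xi>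
      using mult_mem_Icc[OF hb[OF that] inv[OF that]] by (simp add: h1_def)
    have h2b: "h2 \<xi> \<in> {0..(exp (l * M) * (1 / \<eta>)) * M}" if "\<xi> \<in> space S" for \<xi>
    proof -
      have "h2 \<xi> = h1 \<xi> * \<mu>h \<xi> j" by (simp add: h1_def h2_def)
      then show ?thesis using mult_mem_Icc[OF h1b[OF that] \<mu>h_range[OF that j]] by simp
    qed
    have h3b: "h3 \<xi> \<in> {0..(exp (l * M) * (1 / \<eta>)) * (2 * l * M)}" if "\<xi> \<in> space S" for \<xi>
    proof -
      have "h3 \<xi> = h1 \<xi> * \<kappa> \<xi>" by (simp add: h1_def h3_def)
      then show ?thesis using mult_mem_Icc[OF h1b[OF that], of "\<kappa> \<xi>" "2 * l * M"] \<kappa>b[OF that] by simp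
    qed
    let ?d = "\<lambda>z. of_bool (fst (snd z) = j) :: real"
    have d_meas[measurable]: "?d \<in> borel_measurable Q"
      by (rule measurable_compose[OF treatment_meas]) simp
    define R where "R z = h (fst z) + \<epsilon> * l * (h1 (fst z) * ?d z * snd (snd z))
        - \<epsilon> * l * (h2 (fst z) * ?d z) + h3 (fst z) * ?d z" for z
    have int_x: "integrable Q (\<lambda>z. k (fst z))"
      if [measurable]: "k \<in> borel_measurable S" and "\<And>\<xi>. \<xi> \<in> space S \<Longrightarrow> k \<xi> \<in> {0..b}" for k and b :: real
      by (rule integrable_const_bound[where B = b]) (use that(2) fst_space in force)+
    have int_d: "integrable Q (\<lambda>z. k (fst z) * ?d z)"
      if [measurable]: "k \<in> borel_measurable S" and "\<And>\<xi>. \<xi> \<in> space S \<Longrightarrow> k \<xi> \<in> {0..b}" for k and b :: real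
    proof (rule integrable_const_bound[where B = b])
      show "AE z in Q. norm (k (fst z) * ?d z) \<le> b"
        using that(2)[OF fst_space] by (intro AE_I2) force
    qed measurable
    have int_e: "integrable Q (\<lambda>z. k (fst z) * e (fst z) j)"
      if [measurable]: "k \<in> borel_measurable S" and k: "\<And>\<xi>. \<xi> \<in> space S \<Longrightarrow> k \<xi> \<in> {0..b}" for k and b :: real
    proof (rule integrable_const_bound[where B = b])
      show "AE z in Q. norm (k (fst z) * e (fst z) j) \<le> b"
        using e_le_1[OF j] AE_space
      proof eventually_elim
        case (elim z)
        have "0 \<le> k (fst z)" "k (fst z) \<le> b" using k[OF fst_space[OF elim(2)]] by auto
        moreover have "0 \<le> e (fst z) j" using epos[OF fst_space[OF elim(2)]] by simp
        ultimately show ?case using elim(1) mult_mono[of "k (fst z)" b "e (fst z) j" 1] by simp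
      qed
    qed measurable
    have int_y: "integrable Q (\<lambda>z. h1 (fst z) * ?d z * snd (snd z))"
    proof (rule integrable_const_bound[where B = "exp (l * M) * (1 / \<eta>) * M"])
      show "AE z in Q. norm (h1 (fst z) * ?d z * snd (snd z)) \<le> exp (l * M) * (1 / \<eta>) * M"
        using y_range AE_space
      proof eventually_elim
        case (elim z)
        have "?d z * snd (snd z) \<in> {0..M}" using elim(1) M by auto
        from mult_mem_Icc[OF h1b[OF fst_space[OF elim(2)]] this] show ?case by (simp add: mult.assoc)
      qed
    qed measurable
    have h1e: "h1 (fst z) * e (fst z) j = h (fst z)" "h2 (fst z) * e (fst z) j = h (fst z) * \<mu>h (fst z) j"
      "h3 (fst z) * e (fst z) j = h (fst z) * \<kappa> (fst z)" if "z \<in> space Q" for z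
      using epos[OF fst_space[OF that]] by (auto simp: h1_def h2_def h3_def)
    have intR: "integrable Q R"
      unfolding R_def using int_x[OF h_meas hb] int_y int_d[OF h123(2) h2b] int_d[OF h123(3) h3b] by auto
    have "(\<integral>z. R z \<partial>Q) = (\<integral>z. h (fst z) \<partial>Q) + \<epsilon> * l * (\<integral>z. h1 (fst z) * ?d z * snd (snd z) \<partial>Q)
        - \<epsilon> * l * (\<integral>z. h2 (fst z) * ?d z \<partial>Q) + (\<integral>z. h3 (fst z) * ?d z \<partial>Q)"
      unfolding R_def using int_x[OF h_meas hb] int_y int_d[OF h123(2) h2b] int_d[OF h123(3) h3b] by simp
    also have "(\<integral>z. h1 (fst z) * ?d z * snd (snd z) \<partial>Q) = (\<integral>z. h1 (fst z) * e (fst z) j * m (fst z) j \<partial>Q)"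
      by (rule regression[OF j _ h1b]) auto
    also have "\<dots> = (\<integral>z. h (fst z) * m (fst z) j \<partial>Q)"
      by (rule Bochner_Integration.integral_cong) (auto simp: h1e)
    also have "(\<integral>z. h2 (fst z) * ?d z \<partial>Q) = (\<integral>z. h2 (fst z) * e (fst z) j \<partial>Q)"
      by (rule propensity[OF j _ h2b]) auto
    also have "\<dots> = (\<integral>z. h (fst z) * \<mu>h (fst z) j \<partial>Q)"
      by (rule Bochner_Integration.integral_cong) (auto simp: h1e)
    also have "(\<integral>z. h3 (fst z) * ?d z \<partial>Q) = (\<integral>z. h3 (fst z) * e (fst z) j \<partial>Q)"
      by (rule propensity[OF j _ h3b]) auto
    also have "\<dots> = (\<integral>z. h (fst z) * \<kappa> (fst z) \<partial>Q)"
      by (rule Bochner_Integration.integral_cong) (auto simp: h1e)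
    also have "(\<integral>z. h (fst z) \<partial>Q) + \<epsilon> * l * (\<integral>z. h (fst z) * m (fst z) j \<partial>Q)
        - \<epsilon> * l * (\<integral>z. h (fst z) * \<mu>h (fst z) j \<partial>Q) + (\<integral>z. h (fst z) * \<kappa> (fst z) \<partial>Q)
        = (\<integral>z. h (fst z) * (1 + c (fst z)) \<partial>Q)"
    proof -
      have hk: "integrable Q (\<lambda>z. h (fst z) * k (fst z))"
        if [measurable]: "k \<in> borel_measurable S" and k: "\<And>\<xi>. \<xi> \<in> space S \<Longrightarrow> k \<xi> \<in> {0..b}" for k and b :: real
        by (rule int_x[OF _ mult_mem_Icc[OF hb k]]) measurable
      have "integrable Q (\<lambda>z. h (fst z) * m (fst z) j)" by (rule hk[OF m_meas[OF j] m_range[OF _ j]])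
      moreover have "integrable Q (\<lambda>z. h (fst z) * \<mu>h (fst z) j)" by (rule hk[OF \<mu>h_meas[OF j] \<mu>h_range[OF _ j]])
      moreover have "\<kappa> \<xi> \<in> {0..2 * l * M}" if "\<xi> \<in> space S" for \<xi> using \<kappa>b[OF that] by simp
      from hk[OF \<kappa>_meas this] have "integrable Q (\<lambda>z. h (fst z) * \<kappa> (fst z))" .
      moreover note int_x[OF h_meas hb]
      moreover have eq: "(\<lambda>z. h (fst z) * (1 + c (fst z))) = (\<lambda>z. h (fst z) + \<epsilon> * l * (h (fst z) * m (fst z) j)
        - \<epsilon> * l * (h (fst z) * \<mu>h (fst z) j) + h (fst z) * \<kappa> (fst z))"
        by (simp add: c_def algebra_simps)
      ultimately show ?thesis by (subst eq) simp
    qed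
    finally have intR_eq: "(\<integral>z. R z \<partial>Q) = (\<integral>z. h (fst z) * (1 + c (fst z)) \<partial>Q)" .
    have h1c: "h (fst z) * (1 + c (fst z)) \<le> indicator B (fst z)" for z
    proof -
      have "exp (- c (fst z)) * (1 + c (fst z)) \<le> exp (- c (fst z)) * exp (c (fst z))"
        by (intro mult_left_mono exp_ge_add_one_self) auto
      also have "\<dots> = 1" by (simp add: exp_minus)
      finally show ?thesis by (simp add: h_def indicator_def)
    qed
    have dom: "AE z in Q. exp (log_weight \<epsilon> l j z) * indicator B (fst z) \<le> R z"
      using y_range AE_space
    proof eventually_elim
      case (elim z)
      have "exp (log_weight \<epsilon> l j z) \<le> exp (- c (fst z))
         * (1 + \<epsilon> * l * (?d z / e (fst z) j * (snd (snd z) - \<mu>h (fst z) j)) + ?d z / e (fst z) j * \<kappa> (fst z))"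
        using exp_log_weight_le[OF fst_space[OF elim(2)] elim(1) j l \<epsilon>] unfolding c_def \<kappa>_def .
      then have "exp (log_weight \<epsilon> l j z) * indicator B (fst z) \<le> exp (- c (fst z))
         * (1 + \<epsilon> * l * (?d z / e (fst z) j * (snd (snd z) - \<mu>h (fst z) j)) + ?d z / e (fst z) j * \<kappa> (fst z)) * indicator B (fst z)"
        by (intro mult_right_mono) auto
      also have "\<dots> = R z"
        by (simp add: R_def h1_def h2_def h3_def h_def algebra_simps diff_divide_distrib)
      finally show ?case .
    qed
    have "(\<integral>\<^sup>+ z. ?W z * indicator B (fst z) \<partial>Q) = (\<integral>\<^sup>+ z. ennreal (exp (log_weight \<epsilon> l j z) * indicator B (fst z)) \<partial>Q)"
      by (intro nn_integral_cong) (auto simp: indicator_def)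
    also have "\<dots> \<le> (\<integral>\<^sup>+ z. ennreal (R z) \<partial>Q)"
      by (rule nn_integral_mono_AE) (use dom in eventually_elim, simp add: ennreal_leI)
    also have "\<dots> = ennreal (\<integral>z. R z \<partial>Q)"
      by (rule nn_integral_eq_integral[OF intR])
        (use dom in eventually_elim, metis (no_types) exp_ge_zero indicator_pos_le mult_nonneg_nonneg order_trans)
    also have "\<dots> \<le> ennreal (\<integral>z. indicator B (fst z) \<partial>Q)"
      unfolding intR_eq
    proof (intro ennreal_leI integral_mono' h1c)
      show "integrable Q (\<lambda>z. indicator B (fst z) :: real)"
        by (rule integrable_const_bound[where B = 1]) (auto simp: indicator_def)
    qed (auto simp: indicator_def)
    also have "\<dots> = (\<integral>\<^sup>+ z. ennreal (indicator B (fst z)) \<partial>Q)"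
      by (rule nn_integral_eq_integral[symmetric])
         (auto simp: indicator_def intro!: integrable_const_bound[where B = 1])
    also have "\<dots> = (\<integral>\<^sup>+ z. indicator B (fst z) \<partial>Q)"
      by (intro nn_integral_cong) (auto simp: indicator_def)
    finally show ?thesis .
  qed
  have W[measurable]: "?W \<in> borel_measurable Q" by measurable
  have fstd: "fst \<in> density Q ?W \<rightarrow>\<^sub>M S" by measurable
  have "distr (density Q ?W) S fst \<le> distr Q S fst"
  proof (subst le_measure, simp, intro ballI)
    fix B assume "B \<in> sets (distr (density Q ?W) S fst)"
    then have B: "B \<in> sets S" by simp
    have vB: "fst -` B \<inter> space Q \<in> sets Q" using measurable_sets[OF fst_meas B] .
    have "emeasure (distr (density Q ?W) S fst) B = (\<integral>\<^sup>+ z. ?W z * indicator (fst -` B \<inter> space Q) z \<partial>Q)"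
      using emeasure_distr[OF fstd B] emeasure_density[OF W vB] by simp
    also have "\<dots> = (\<integral>\<^sup>+ z. ?W z * indicator B (fst z) \<partial>Q)"
      by (intro nn_integral_cong) (auto simp: indicator_def)
    also have "\<dots> \<le> (\<integral>\<^sup>+ z. indicator B (fst z) \<partial>Q)" by (rule on_sets[OF B])
    also have "\<dots> = (\<integral>\<^sup>+ z. indicator (fst -` B \<inter> space Q) z \<partial>Q)"
      by (intro nn_integral_cong) (auto simp: indicator_def)
    also have "\<dots> = emeasure (distr Q S fst) B"
      using emeasure_distr[OF fst_meas B] vB by simp
    finally show "emeasure (distr (density Q ?W) S fst) B \<le> emeasure (distr Q S fst) B" .
  qed
  then have "nn_integral (distr (density Q ?W) S fst) \<phi> \<le> nn_integral (distr Q S fst) \<phi>"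
    by (rule nn_integral_mono_measure[rotated]) simp
  moreover have "nn_integral (distr (density Q ?W) S fst) \<phi> = (\<integral>\<^sup>+ z. \<phi> (fst z) * ?W z \<partial>Q)"
    using nn_integral_distr[OF fstd, of \<phi>] \<phi> measurable_compose[OF fst_meas \<phi>]
    by (simp add: nn_integral_density mult.commute)
  moreover have "nn_integral (distr Q S fst) \<phi> = (\<integral>\<^sup>+ z. \<phi> (fst z) \<partial>Q)"
    using nn_integral_distr[OF fst_meas, of \<phi>] \<phi> by simp
  ultimately show ?thesis by simp
qed

end

section \<open>Uniform events for a sample from the law of one unit\<close>

lemma (in prob_space) markov_event:
  fixes H :: "'a \<Rightarrow> ennreal"
  assumes H [measurable]: "H \<in> borel_measurable M"
    and int: "(\<integral>\<^sup>+ \<omega>. H \<omega> \<partial>M) \<le> ennreal c" and c: "c \<ge> 0"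
  shows "{\<omega> \<in> space M. H \<omega> < ennreal (exp L)} \<in> events"
    and "prob {\<omega> \<in> space M. H \<omega> < ennreal (exp L)} \<ge> 1 - c * exp (- L)"
proof -
  let ?A = "{\<omega> \<in> space M. H \<omega> < ennreal (exp L)}"
  let ?B = "{\<omega> \<in> space M. 1 \<le> ennreal (exp (- L)) * H \<omega>}"
  show A: "?A \<in> events" by measurable
  have sub: "space M - ?A \<subseteq> ?B"
  proof
    fix \<omega> assume "\<omega> \<in> space M - ?A"
    then have \<omega>: "\<omega> \<in> space M" "ennreal (exp L) \<le> H \<omega>" by (auto simp: not_less)
    have "1 = ennreal (exp (- L)) * ennreal (exp L)"
      by (simp add: ennreal_mult[symmetric] exp_minus)
    also have "\<dots> \<le> ennreal (exp (- L)) * H \<omega>" using \<omega>(2) by (rule mult_left_mono) simp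
    finally show "\<omega> \<in> ?B" using \<omega>(1) by simp
  qed
  have "emeasure M (space M - ?A) \<le> emeasure M ?B"
    by (rule emeasure_mono[OF sub]) measurable
  also have "\<dots> \<le> ennreal (exp (- L)) * (\<integral>\<^sup>+ \<omega>. H \<omega> * indicator (space M) \<omega> \<partial>M)"
    by (rule nn_integral_Markov_inequality) auto
  also have "(\<integral>\<^sup>+ \<omega>. H \<omega> * indicator (space M) \<omega> \<partial>M) = (\<integral>\<^sup>+ \<omega>. H \<omega> \<partial>M)"
    by (intro nn_integral_cong) (auto simp: indicator_def)
  also have "ennreal (exp (- L)) * (\<integral>\<^sup>+ \<omega>. H \<omega> \<partial>M) \<le> ennreal (exp (- L)) * ennreal c"
    by (rule mult_left_mono[OF int]) simp
  also have "\<dots> = ennreal (c * exp (- L))"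
    using c by (simp add: ennreal_mult[symmetric] mult.commute)
  finally have "prob (space M - ?A) \<le> c * exp (- L)"
    using c by (simp add: emeasure_eq_measure)
  then show "prob ?A \<ge> 1 - c * exp (- L)"
    using prob_compl[OF A] by linarith
qed

lemma (in prob_space) prob_Int_ge:
  assumes "A \<in> events" "B \<in> events"
  shows "prob (A \<inter> B) \<ge> prob A + prob B - 1"
proof -
  have "prob (A \<union> B) + prob (A \<inter> B) = prob A + prob B"
    using assms finite_measure_Union'[of A B] finite_measure_Diff'[of B A] by (simp add: Int_commute)
  then show ?thesis using prob_le_1[of "A \<union> B"] by linarith
qed

context unit_law
begin

lemma treatment_dependent_meas:
  assumes g: "g \<in> S \<rightarrow>\<^sub>M count_space {1..J}"
    and f: "\<And>j. j \<in> {1..J} \<Longrightarrow> (\<lambda>\<xi>. f \<xi> j) \<in> borel_measurable S"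
  shows "(\<lambda>\<xi>. f \<xi> (g \<xi>) :: real) \<in> borel_measurable S"
  using measurable_compose_countable'[of "{1..J}" "\<lambda>j \<xi>. f \<xi> j" S borel g] f g by auto

text \<open>The value \<open>l = t / (N * M^2)\<close> minimises the resulting exponential bound.\<close>

lemma sampling_event:
  fixes G :: "('x \<Rightarrow> nat) set"
  assumes G: "countable G" "\<And>g. g \<in> G \<Longrightarrow> g \<in> S \<rightarrow>\<^sub>M count_space {1..J}"
    and growth: "\<And>x. x \<in> {1..2 * N} \<rightarrow> space S \<Longrightarrow>
        finite ((\<lambda>g. \<lambda>s\<in>{1..2 * N}. g (x s)) ` G) \<and> card ((\<lambda>g. \<lambda>s\<in>{1..2 * N}. g (x s)) ` G) \<le> K"
    and N: "N \<ge> 1" and t: "t > 0"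
  shows "\<exists>A\<in>sets (PiM {1..N} (\<lambda>_. Q)).
    measure (PiM {1..N} (\<lambda>_. Q)) A \<ge> 1 - 2 * (real K * exp (- (t\<^sup>2 / (2 * real N * M\<^sup>2)))) \<and>
    (\<forall>\<omega>\<in>A. \<forall>g\<in>G. \<bar>\<Sum>s=1..N. m (fst (\<omega> s)) (g (fst (\<omega> s))) - (\<integral>z. m (fst z) (g (fst z)) \<partial>Q)\<bar> \<le> t)"
proof -
  let ?P = "PiM {1..N} (\<lambda>_. Q)"
  interpret P: prob_space ?P by (rule prob_space_PiM) (rule prob_space_axioms)
  define \<beta> where "\<beta> g z = m (fst z) (g (fst z))" for g :: "'x \<Rightarrow> nat" and z :: "'x \<times> nat \<times> real"
  define F where "F = \<beta> ` G"
  define l where "l = t / (real N * M\<^sup>2)"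
  have l: "l > 0" using t N M by (simp add: l_def)
  have F: "countable F" using G(1) by (simp add: F_def)
  have Fmeas: "f \<in> borel_measurable Q" if "f \<in> F" for f
    using that unfolding F_def \<beta>_def
    by (auto intro!: measurable_compose[OF fst_meas treatment_dependent_meas[OF G(2) m_meas]])
  have Fb: "f z \<in> {0..M}" if f: "f \<in> F" and z: "z \<in> space Q" for f z
  proof -
    obtain g where g: "g \<in> G" "f = \<beta> g" using f unfolding F_def by blast
    have "g (fst z) \<in> {1..J}"
      using measurable_space[OF G(2)[OF g(1)] fst_space[OF z]] by simp
    then show ?thesis unfolding g(2) \<beta>_def using m_range[OF fst_space[OF z]] by blast
  qed
  have Fgrowth: "finite ((\<lambda>f. \<lambda>s\<in>{1..2 * N}. f (\<omega> s)) ` F) \<and> card ((\<lambda>f. \<lambda>s\<in>{1..2 * N}. f (\<omega> s)) ` F) \<le> K"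
    if \<omega>: "\<omega> \<in> {1..2 * N} \<rightarrow> space Q" for \<omega>
  proof -
    let ?I = "{1..2 * N}" and ?x = "\<lambda>s. fst (\<omega> s)"
    have x: "?x \<in> ?I \<rightarrow> space S" by (intro Pi_I fst_space) (use \<omega> in blast)
    let ?lab = "(\<lambda>g. \<lambda>s\<in>?I. g (?x s)) ` G"
    have "(\<lambda>f. \<lambda>s\<in>?I. f (\<omega> s)) ` F = (\<lambda>lb. \<lambda>s\<in>?I. m (?x s) (lb s)) ` ?lab"
      unfolding F_def \<beta>_def image_image by (intro image_cong refl) (auto simp: restrict_def fun_eq_iff)
    moreover have "finite ?lab" "card ?lab \<le> K" using growth[OF x] by auto
    ultimately show ?thesis using card_image_le[of ?lab "\<lambda>lb. \<lambda>s\<in>?I. m (?x s) (lb s)"] by simp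
  qed
  have side: "\<exists>A\<in>sets ?P. measure ?P A \<ge> 1 - real K * exp (- (t\<^sup>2 / (2 * real N * M\<^sup>2))) \<and>
      (\<forall>\<omega>\<in>A. \<forall>f\<in>F. \<epsilon> * (\<Sum>s=1..N. f (\<omega> s) - expectation f) \<le> t)" if \<epsilon>: "\<epsilon> \<in> {1, -1}" for \<epsilon> :: real
  proof -
    define H where "H \<omega> = (SUP f\<in>F. ennreal (exp (\<epsilon> * l * (\<Sum>s=1..N. f (\<omega> s) - expectation f))))" for \<omega>
    define c where "c = real K * exp (real N * (\<epsilon> * l * M)\<^sup>2 / 2)"
    have Hm: "H \<in> borel_measurable ?P"
      unfolding H_def
    proof (intro borel_measurable_SUP F)
      fix f assume f: "f \<in> F"
      have comp: "(\<lambda>\<omega>. f (\<omega> s)) \<in> borel_measurable ?P" if "s \<in> {1..N}" for s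
        using measurable_compose[OF measurable_component_singleton[OF that] Fmeas[OF f]] .
      show "(\<lambda>\<omega>. ennreal (exp (\<epsilon> * l * (\<Sum>s=1..N. f (\<omega> s) - expectation f)))) \<in> borel_measurable ?P"
        by (intro measurable_compose[OF _ measurable_ennreal] measurable_compose[OF _ borel_measurable_exp]
          borel_measurable_times borel_measurable_const borel_measurable_sum borel_measurable_diff comp)
    qed
    have int: "(\<integral>\<^sup>+ \<omega>. H \<omega> \<partial>?P) \<le> ennreal c"
      unfolding H_def c_def 
      by (rule symmetrized_exp_sup_le[where F = F and B = M and N = N and K = K and l = "\<epsilon> * l"])
         (use F Fmeas Fb Fgrowth in blast)+
    have c: "c \<ge> 0" by (simp add: c_def)
    let ?A = "{\<omega> \<in> space ?P. H \<omega> < ennreal (exp (l * t))}"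
    have "c * exp (- (l * t)) = real K * exp (- (t\<^sup>2 / (2 * real N * M\<^sup>2)))"
    proof -
      have "real N * (\<epsilon> * l * M)\<^sup>2 / 2 - l * t = - (t\<^sup>2 / (2 * real N * M\<^sup>2))"
        using \<epsilon> N M unfolding l_def by (auto simp: field_simps power2_eq_square)
      then have "exp (real N * (\<epsilon> * l * M)\<^sup>2 / 2 + - (l * t)) = exp (- (t\<^sup>2 / (2 * real N * M\<^sup>2)))"
        by simp
      then show ?thesis by (simp only: c_def exp_add mult.assoc)
    qed
    then have "measure ?P ?A \<ge> 1 - real K * exp (- (t\<^sup>2 / (2 * real N * M\<^sup>2)))"
      using P.markov_event(2)[OF Hm int c, of "l * t"] by simp
    moreover have "\<epsilon> * (\<Sum>s=1..N. f (\<omega> s) - expectation f) \<le> t" if \<omega>: "\<omega> \<in> ?A" and f: "f \<in> F" for \<omega> f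
    proof -
      have "ennreal (exp (\<epsilon> * l * (\<Sum>s=1..N. f (\<omega> s) - expectation f))) \<le> H \<omega>"
        unfolding H_def using f by (intro SUP_upper)
      also have "\<dots> < ennreal (exp (l * t))" using \<omega> by simp
      finally have "\<epsilon> * l * (\<Sum>s=1..N. f (\<omega> s) - expectation f) < l * t"
        by (simp add: ennreal_less_iff)
      then have "l * (\<epsilon> * (\<Sum>s=1..N. f (\<omega> s) - expectation f)) < l * t" by (simp only: mult_ac)
      then show ?thesis using l by simp
    qed
    moreover note P.markov_event(1)[OF Hm int c, of "l * t"]
    ultimately show ?thesis by blast
  qed
  obtain A1 where A1: "A1 \<in> sets ?P" "measure ?P A1 \<ge> 1 - real K * exp (- (t\<^sup>2 / (2 * real N * M\<^sup>2)))"
      "\<And>\<omega> f. \<omega> \<in> A1 \<Longrightarrow> f \<in> F \<Longrightarrow> 1 * (\<Sum>s=1..N. f (\<omega> s) - expectation f) \<le> t"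
    using side[of 1] by auto
  obtain A2 where A2: "A2 \<in> sets ?P" "measure ?P A2 \<ge> 1 - real K * exp (- (t\<^sup>2 / (2 * real N * M\<^sup>2)))"
      "\<And>\<omega> f. \<omega> \<in> A2 \<Longrightarrow> f \<in> F \<Longrightarrow> -1 * (\<Sum>s=1..N. f (\<omega> s) - expectation f) \<le> t"
    using side[of "-1"] by auto
  have "measure ?P (A1 \<inter> A2) \<ge> measure ?P A1 + measure ?P A2 - 1"
    by (rule P.prob_Int_ge[OF A1(1) A2(1)])
  moreover have "\<bar>\<Sum>s=1..N. m (fst (\<omega> s)) (g (fst (\<omega> s))) - (\<integral>z. m (fst z) (g (fst z)) \<partial>Q)\<bar> \<le> t"
    if "\<omega> \<in> A1 \<inter> A2" "g \<in> G" for \<omega> g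
    using A1(3)[of \<omega> "\<beta> g"] A2(3)[of \<omega> "\<beta> g"] that by (auto simp: F_def \<beta>_def[abs_def] abs_le_iff)
  ultimately show ?thesis using A1 A2 by (intro bexI[of _ "A1 \<inter> A2"]) auto
qed

text \<open>The union bound runs over all pairs of a labeling and a clipping set.  Each pair is weighted by the indicator
that some policy of the class and some admissible threshold produce it on the observed covariates.  This
indicator depends on the covariates only, so the conditional bound applies to every pair, and the indicators
add up to at most \<open>K * (N + 1)\<close>.\<close>

lemma noise_event:
  fixes G :: "('x \<Rightarrow> nat) set"
  assumes G: "countable G" "\<And>g. g \<in> G \<Longrightarrow> g \<in> S \<rightarrow>\<^sub>M count_space {1..J}"
    and growth: "\<And>x. x \<in> {1..N} \<rightarrow> space S \<Longrightarrow>
        finite ((\<lambda>g. \<lambda>s\<in>{1..N}. g (x s)) ` G) \<and> card ((\<lambda>g. \<lambda>s\<in>{1..N}. g (x s)) ` G) \<le> K"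
    and \<Lambda>: "finite \<Lambda>" "\<And>l. l \<in> \<Lambda> \<Longrightarrow> l > 0"
  shows "\<exists>A\<in>sets (PiM {1..N} (\<lambda>_. Q)).
    measure (PiM {1..N} (\<lambda>_. Q)) A \<ge> 1 - real (2 * card \<Lambda> * (K * (N + 1))) * exp (- L) \<and>
    (\<forall>\<omega>\<in>A. \<forall>g\<in>G. \<forall>\<tau>\<in>insert 0 ((\<lambda>s. 1 / e (fst (\<omega> s)) (g (fst (\<omega> s)))) ` {1..N}). \<forall>l\<in>\<Lambda>. \<forall>\<epsilon>\<in>{1, -1}.
       (\<Sum>s | s \<in> {1..N} \<and> 1 / e (fst (\<omega> s)) (g (fst (\<omega> s))) \<le> \<tau>.
          log_weight \<epsilon> l (g (fst (\<omega> s))) (\<omega> s)) \<le> L)"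
proof -
  let ?I = "{1..N}"
  let ?P = "PiM ?I (\<lambda>_. Q)" and ?S = "PiM ?I (\<lambda>_. S)"
  interpret P: prob_space ?P by (rule prob_space_PiM) (rule prob_space_axioms)
  define inv where "inv x lb s = 1 / e (x s) (lb s)" for x :: "nat \<Rightarrow> 'x" and lb :: "nat \<Rightarrow> nat" and s
  define clip where "clip x lb \<tau> = {s \<in> ?I. inv x lb s \<le> \<tau>}" for x lb \<tau>
  define PE where "PE = PiE ?I (\<lambda>_. {1..J})"
  define \<Theta> where "\<Theta> = PE \<times> Pow ?I"
  have fin: "finite \<Theta>" unfolding \<Theta>_def PE_def by (intro finite_cartesian_product finite_PiE) auto
  \<comment> \<open>the pairs of a labeling and a clipping set that occur on the covariates \<open>x\<close>\<close>
  define cfg where "cfg x = {(lb, C) \<in> \<Theta>. (\<exists>g\<in>G. \<forall>s\<in>?I. g (x s) = lb s) \<and>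
      (\<exists>\<tau>\<in>insert 0 (inv x lb ` ?I). C = clip x lb \<tau>)}" for x
  define \<phi> :: "_ \<Rightarrow> _ \<Rightarrow> ennreal" where "\<phi> \<theta> x = indicator {x \<in> space ?S. \<theta> \<in> cfg x} x" for \<theta> x
  have \<phi>_meas: "\<phi> \<theta> \<in> borel_measurable ?S" if \<theta>: "\<theta> \<in> \<Theta>" for \<theta>
  proof -
    obtain lb C where \<theta>': "\<theta> = (lb, C)" "lb \<in> PE" "C \<subseteq> ?I" using \<theta> by (auto simp: \<Theta>_def)
    have lb: "lb s \<in> {1..J}" if "s \<in> ?I" for s using \<theta>'(2) that by (auto simp: PE_def)
    have inv_meas: "(\<lambda>x. inv x lb s) \<in> borel_measurable ?S" if "s \<in> ?I" for s
      unfolding inv_def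
      using measurable_compose[OF measurable_component_singleton[OF that] e_meas[OF lb[OF that]]]
      by (intro borel_measurable_divide borel_measurable_const)
    have g_meas: "Measurable.pred ?S (\<lambda>x. g (x s) = lb s)" if "g \<in> G" "s \<in> ?I" for g s
      using measurable_compose[OF measurable_compose[OF measurable_component_singleton[OF that(2)] G(2)[OF that(1)]],
          of "\<lambda>j. j = lb s" "count_space UNIV"] by simp
    have le_meas: "Measurable.pred ?S (\<lambda>x. f x \<le> (h x :: real))"
      if "f \<in> borel_measurable ?S" "h \<in> borel_measurable ?S" for f h
      using borel_measurable_le[OF that] by (simp add: pred_def)
    have "\<theta> \<in> cfg x \<longleftrightarrow> (\<exists>g\<in>G. \<forall>s\<in>?I. g (x s) = lb s) \<and>
      ((\<forall>s\<in>?I. (s \<in> C) = (inv x lb s \<le> 0)) \<or> (\<exists>t\<in>?I. \<forall>s\<in>?I. (s \<in> C) = (inv x lb s \<le> inv x lb t)))" for x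
    proof -
      have "C = clip x lb \<tau> \<longleftrightarrow> (\<forall>s\<in>?I. (s \<in> C) = (inv x lb s \<le> \<tau>))" for \<tau>
        using \<theta>'(3) by (auto simp: clip_def)
      then show ?thesis unfolding cfg_def using \<theta> \<theta>'(1) by auto
    qed
    moreover have "Measurable.pred ?S (\<lambda>x. (\<exists>g\<in>G. \<forall>s\<in>?I. g (x s) = lb s) \<and>
      ((\<forall>s\<in>?I. (s \<in> C) = (inv x lb s \<le> 0)) \<or> (\<exists>t\<in>?I. \<forall>s\<in>?I. (s \<in> C) = (inv x lb s \<le> inv x lb t))))"
    proof (rule pred_intros_logic(3))
      show "Measurable.pred ?S (\<lambda>x. \<exists>g\<in>G. \<forall>s\<in>?I. g (x s) = lb s)"
        unfolding pred_def
        by (intro sets.sets_Collect_countable_Ex' G(1) pred_intros_finite(3)[unfolded pred_def]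
            finite_atLeastAtMost g_meas[unfolded pred_def])
      have const: "Measurable.pred ?S (\<lambda>x. b)" for b by simp
      have iff: "Measurable.pred ?S (\<lambda>x. b = R x)" if "Measurable.pred ?S R" for b R
        using that by (cases b) simp_all
      show "Measurable.pred ?S (\<lambda>x. (\<forall>s\<in>?I. (s \<in> C) = (inv x lb s \<le> 0)) \<or>
          (\<exists>t\<in>?I. \<forall>s\<in>?I. (s \<in> C) = (inv x lb s \<le> inv x lb t)))"
        by (intro pred_intros_logic(5) pred_intros_finite(3,4) finite_atLeastAtMost iff le_meas inv_meas
            borel_measurable_const)
    qed
    ultimately have "Measurable.pred ?S (\<lambda>x. \<theta> \<in> cfg x)" by simp
    then show ?thesis unfolding \<phi>_def by (intro borel_measurable_indicator) (simp add: pred_def)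
  qed
  have card_cfg: "card (cfg x) \<le> K * (N + 1)" if x: "x \<in> ?I \<rightarrow> space S" for x
  proof -
    let ?lab = "(\<lambda>g. \<lambda>s\<in>?I. g (x s)) ` G"
    let ?T = "\<lambda>lb. clip x lb ` insert 0 (inv x lb ` ?I)"
    have lab: "finite ?lab" "card ?lab \<le> K" using growth[OF x] by auto
    have T: "card (?T lb) \<le> N + 1" "finite (?T lb)" for lb
    proof -
      have "card (?T lb) \<le> card (insert 0 (inv x lb ` ?I))" by (intro card_image_le) auto
      also have "\<dots> \<le> Suc (card (inv x lb ` ?I))" by (rule card_insert_le_m1) auto
      also have "\<dots> \<le> Suc N" using card_image_le[of ?I "inv x lb"] by auto
      finally show "card (?T lb) \<le> N + 1" by simp
    qed auto
    have "cfg x \<subseteq> Sigma ?lab ?T"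
    proof
      fix \<theta> assume "\<theta> \<in> cfg x"
      then obtain lb C g \<tau> where \<theta>: "\<theta> = (lb, C)" "lb \<in> PE" "g \<in> G" "\<forall>s\<in>?I. g (x s) = lb s"
        "\<tau> \<in> insert 0 (inv x lb ` ?I)" "C = clip x lb \<tau>"
        unfolding cfg_def \<Theta>_def by blast
      have "lb = (\<lambda>s\<in>?I. g (x s))"
      proof
        fix s
        show "lb s = (\<lambda>s\<in>?I. g (x s)) s"
        proof (cases "s \<in> ?I")
          case True
          then show ?thesis using \<theta>(4) by simp
        next
          case False
          then show ?thesis using PiE_arb[OF \<theta>(2)[unfolded PE_def] False] by (simp only: restrict_def if_False)
        qed
      qed
      then show "\<theta> \<in> Sigma ?lab ?T" using \<theta> by blast
    qed
    then have "card (cfg x) \<le> card (Sigma ?lab ?T)"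
      using lab T by (intro card_mono finite_SigmaI) auto
    also have "\<dots> = (\<Sum>lb\<in>?lab. card (?T lb))" using lab T by (intro card_SigmaI) auto
    also have "\<dots> \<le> (\<Sum>lb\<in>?lab. N + 1)" by (intro sum_mono T)
    also have "\<dots> \<le> K * (N + 1)" using lab by (simp only: sum_constant mult_le_mono1 of_nat_id)
    finally show ?thesis .
  qed
  define X where "X \<omega> = (\<lambda>s\<in>?I. fst (\<omega> s))" for \<omega> :: "nat \<Rightarrow> 'x \<times> nat \<times> real"
  have X: "X \<in> ?P \<rightarrow>\<^sub>M ?S"
    unfolding X_def by (rule measurable_restrict, rule measurable_compose[OF _ fst_meas]) (rule measurable_component_singleton)
  define w where "w \<theta> \<epsilon> l s z = (if s \<in> snd \<theta> then ennreal (exp (log_weight \<epsilon> l (fst \<theta> s) z)) else 1)"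
    for \<theta> :: "(nat \<Rightarrow> nat) \<times> nat set" and \<epsilon> l s z
  define H where "H \<omega> = (\<Sum>\<epsilon>\<in>{1, -1}. \<Sum>l\<in>\<Lambda>. \<Sum>\<theta>\<in>\<Theta>. \<phi> \<theta> (X \<omega>) * (\<Prod>s\<in>?I. w \<theta> \<epsilon> l s (\<omega> s)))" for \<omega>
  have w_meas: "w \<theta> \<epsilon> l s \<in> borel_measurable Q" if "\<theta> \<in> \<Theta>" "s \<in> ?I" for \<theta> \<epsilon> l s
  proof -
    have "fst \<theta> s \<in> {1..J}" using that by (auto simp: \<Theta>_def PE_def)
    note lw = log_weight_meas[OF this, of \<epsilon> l]
    show ?thesis unfolding w_def using lw by (cases "s \<in> snd \<theta>") auto
  qed
  have prod_meas: "(\<lambda>\<omega>. \<Prod>s\<in>?I. w \<theta> \<epsilon> l s (\<omega> s)) \<in> borel_measurable ?P" if "\<theta> \<in> \<Theta>" for \<theta> \<epsilon> l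
    by (rule borel_measurable_prod_ennreal, rule measurable_compose[OF _ w_meas[OF that]]) auto
  have term_meas: "(\<lambda>\<omega>. \<phi> \<theta> (X \<omega>) * (\<Prod>s\<in>?I. w \<theta> \<epsilon> l s (\<omega> s))) \<in> borel_measurable ?P" if "\<theta> \<in> \<Theta>" for \<theta> \<epsilon> l
    using measurable_compose[OF X \<phi>_meas[OF that]] prod_meas[OF that] by (rule borel_measurable_times_ennreal)
  have H_meas: "H \<in> borel_measurable ?P"
    unfolding H_def by (intro borel_measurable_sum term_meas)
  have cond: "(\<integral>\<^sup>+ \<omega>. \<phi> \<theta> (X \<omega>) * (\<Prod>s\<in>?I. w \<theta> \<epsilon> l s (\<omega> s)) \<partial>?P) \<le> (\<integral>\<^sup>+ \<omega>. \<phi> \<theta> (X \<omega>) \<partial>?P)"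
    if \<theta>: "\<theta> \<in> \<Theta>" and \<epsilon>: "\<epsilon> \<in> {1, -1}" and l: "l \<in> \<Lambda>" for \<theta> \<epsilon> l
    unfolding X_def
  proof (rule nn_integral_prod_conditional_le[OF fst_meas])
    fix s and \<psi> :: "'x \<Rightarrow> ennreal"
    assume s: "s \<in> ?I" and \<psi>: "\<psi> \<in> borel_measurable S"
    have "fst \<theta> s \<in> {1..J}" using \<theta> s by (auto simp: \<Theta>_def PE_def)
    from conditional_weight_le[OF this \<Lambda>(2)[OF l] \<epsilon> \<psi>]
    show "(\<integral>\<^sup>+ z. \<psi> (fst z) * w \<theta> \<epsilon> l s z \<partial>Q) \<le> (\<integral>\<^sup>+ z. \<psi> (fst z) \<partial>Q)"
      by (cases "s \<in> snd \<theta>") (simp_all add: w_def)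
  qed (use \<theta> w_meas \<phi>_meas in auto)
  have sum_\<phi>: "(\<Sum>\<theta>\<in>\<Theta>. \<phi> \<theta> (X \<omega>)) \<le> ennreal (real (K * (N + 1)))" if \<omega>: "\<omega> \<in> space ?P" for \<omega>
  proof -
    have x: "X \<omega> \<in> ?I \<rightarrow> space S" using measurable_space[OF X \<omega>] by (auto simp: space_PiM)
    have "(\<Sum>\<theta>\<in>\<Theta>. \<phi> \<theta> (X \<omega>)) \<le> (\<Sum>\<theta>\<in>\<Theta>. indicator (cfg (X \<omega>)) \<theta>)"
      unfolding \<phi>_def by (intro sum_mono) (auto simp: indicator_def)
    also have "\<dots> = of_nat (card (cfg (X \<omega>)))"
    proof -
      have eq: "\<Theta> \<inter> cfg (X \<omega>) = cfg (X \<omega>)" unfolding cfg_def by auto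
      have "(\<Sum>\<theta>\<in>\<Theta>. indicator (cfg (X \<omega>)) \<theta>) = (\<Sum>\<theta>\<in>\<Theta>. if \<theta> \<in> cfg (X \<omega>) then 1 else 0 :: ennreal)"
        by (intro sum.cong) (auto simp: indicator_def)
      also have "\<dots> = (\<Sum>\<theta>\<in>\<Theta> \<inter> cfg (X \<omega>). 1)" by (rule sum.inter_restrict[OF fin, symmetric])
      finally show ?thesis by (simp add: eq)
    qed
    also have "\<dots> \<le> of_nat (K * (N + 1))" using card_cfg[OF x] by (intro of_nat_mono)
    finally show ?thesis by (simp only: ennreal_of_nat_eq_real_of_nat)
  qed
  have int_\<phi>: "(\<Sum>\<theta>\<in>\<Theta>. \<integral>\<^sup>+ \<omega>. \<phi> \<theta> (X \<omega>) \<partial>?P) \<le> ennreal (real (K * (N + 1)))"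
  proof -
    have "(\<Sum>\<theta>\<in>\<Theta>. \<integral>\<^sup>+ \<omega>. \<phi> \<theta> (X \<omega>) \<partial>?P) = (\<integral>\<^sup>+ \<omega>. (\<Sum>\<theta>\<in>\<Theta>. \<phi> \<theta> (X \<omega>)) \<partial>?P)"
      by (rule nn_integral_sum[symmetric]) (rule measurable_compose[OF X \<phi>_meas])
    also have "\<dots> \<le> (\<integral>\<^sup>+ \<omega>. ennreal (real (K * (N + 1))) \<partial>?P)" by (intro nn_integral_mono sum_\<phi>)
    also have "\<dots> = ennreal (real (K * (N + 1)))"
      by (simp only: nn_integral_const P.emeasure_space_1 mult_1_right)
    finally show ?thesis .
  qed
  have int_H: "(\<integral>\<^sup>+ \<omega>. H \<omega> \<partial>?P) \<le> ennreal (real (2 * card \<Lambda> * (K * (N + 1))))"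
  proof -
    have "(\<integral>\<^sup>+ \<omega>. H \<omega> \<partial>?P) = (\<Sum>\<epsilon>\<in>{1, -1}. \<Sum>l\<in>\<Lambda>. \<Sum>\<theta>\<in>\<Theta>. \<integral>\<^sup>+ \<omega>. \<phi> \<theta> (X \<omega>) * (\<Prod>s\<in>?I. w \<theta> \<epsilon> l s (\<omega> s)) \<partial>?P)"
    proof -
      let ?t = "\<lambda>\<epsilon> l \<theta> \<omega>. \<phi> \<theta> (X \<omega>) * (\<Prod>s\<in>?I. w \<theta> \<epsilon> l s (\<omega> s))"
      have 1: "(\<integral>\<^sup>+ \<omega>. (\<Sum>\<theta>\<in>\<Theta>. ?t \<epsilon> l \<theta> \<omega>) \<partial>?P) = (\<Sum>\<theta>\<in>\<Theta>. \<integral>\<^sup>+ \<omega>. ?t \<epsilon> l \<theta> \<omega> \<partial>?P)" for \<epsilon> l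
        by (rule nn_integral_sum) (rule term_meas)
      have 2: "(\<integral>\<^sup>+ \<omega>. (\<Sum>l\<in>\<Lambda>. \<Sum>\<theta>\<in>\<Theta>. ?t \<epsilon> l \<theta> \<omega>) \<partial>?P) = (\<Sum>l\<in>\<Lambda>. \<integral>\<^sup>+ \<omega>. (\<Sum>\<theta>\<in>\<Theta>. ?t \<epsilon> l \<theta> \<omega>) \<partial>?P)" for \<epsilon>
        by (rule nn_integral_sum) (intro borel_measurable_sum term_meas)
      have 3: "(\<integral>\<^sup>+ \<omega>. (\<Sum>\<epsilon>\<in>{1, -1}. \<Sum>l\<in>\<Lambda>. \<Sum>\<theta>\<in>\<Theta>. ?t \<epsilon> l \<theta> \<omega>) \<partial>?P)
          = (\<Sum>\<epsilon>\<in>{1, -1}. \<integral>\<^sup>+ \<omega>. (\<Sum>l\<in>\<Lambda>. \<Sum>\<theta>\<in>\<Theta>. ?t \<epsilon> l \<theta> \<omega>) \<partial>?P)"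
        by (rule nn_integral_sum) (intro borel_measurable_sum term_meas)
      show ?thesis unfolding H_def 3 2 1 ..
    qed
    also have "\<dots> \<le> (\<Sum>\<epsilon>\<in>{1, -1 :: real}. \<Sum>l\<in>\<Lambda>. \<Sum>\<theta>\<in>\<Theta>. \<integral>\<^sup>+ \<omega>. \<phi> \<theta> (X \<omega>) \<partial>?P)"
      by (intro sum_mono cond)
    also have "\<dots> \<le> (\<Sum>\<epsilon>\<in>{1, -1 :: real}. \<Sum>l\<in>\<Lambda>. ennreal (real (K * (N + 1))))"
      by (intro sum_mono int_\<phi>)
    also have "\<dots> = ennreal (real (2 * card \<Lambda> * (K * (N + 1))))"
    proof -
      let ?c = "real (K * (N + 1))"
      have "(\<Sum>\<epsilon>\<in>{1, -1 :: real}. \<Sum>l\<in>\<Lambda>. ennreal ?c) = ennreal (\<Sum>\<epsilon>\<in>{1, -1 :: real}. \<Sum>l\<in>\<Lambda>. ?c)"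
        by (simp only: sum_ennreal of_nat_0_le_iff sum_nonneg)
      also have "(\<Sum>\<epsilon>\<in>{1, -1 :: real}. \<Sum>l\<in>\<Lambda>. ?c) = real (2 * card \<Lambda> * (K * (N + 1)))"
        by (simp add: algebra_simps)
      finally show ?thesis .
    qed
    finally show ?thesis .
  qed
  let ?A = "{\<omega> \<in> space ?P. H \<omega> < ennreal (exp L)}"
  have A: "?A \<in> sets ?P" "measure ?P ?A \<ge> 1 - real (2 * card \<Lambda> * (K * (N + 1))) * exp (- L)"
    using P.markov_event[OF H_meas int_H of_nat_0_le_iff, of L] by auto
  have "(\<Sum>s | s \<in> ?I \<and> 1 / e (fst (\<omega> s)) (g (fst (\<omega> s))) \<le> \<tau>. log_weight \<epsilon> l (g (fst (\<omega> s))) (\<omega> s)) \<le> L"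
    if \<omega>: "\<omega> \<in> ?A" and g: "g \<in> G" and \<tau>: "\<tau> \<in> insert 0 ((\<lambda>s. 1 / e (fst (\<omega> s)) (g (fst (\<omega> s)))) ` ?I)"
      and l: "l \<in> \<Lambda>" and \<epsilon>: "\<epsilon> \<in> {1, -1}" for \<omega> g \<tau> l \<epsilon>
  proof -
    have \<omega>': "\<omega> \<in> space ?P" "H \<omega> < ennreal (exp L)" using \<omega> by auto
    define lb where "lb = (\<lambda>s\<in>?I. g (fst (\<omega> s)))"
    define C where "C = {s \<in> ?I. 1 / e (fst (\<omega> s)) (g (fst (\<omega> s))) \<le> \<tau>}"
    have xs: "X \<omega> \<in> space ?S" using measurable_space[OF X \<omega>'(1)] .
    have fstS: "fst (\<omega> s) \<in> space S" if "s \<in> ?I" for s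
      by (rule fst_space) (use \<omega>'(1) that in \<open>auto simp: space_PiM\<close>)
    have lbPE: "lb \<in> PE"
      unfolding lb_def PE_def using measurable_space[OF G(2)[OF g] fstS] by auto
    have \<theta>: "(lb, C) \<in> \<Theta>" using lbPE by (auto simp: \<Theta>_def C_def)
    have inv_eq: "inv (X \<omega>) lb s = 1 / e (fst (\<omega> s)) (g (fst (\<omega> s)))" if "s \<in> ?I" for s
      using that by (simp add: inv_def X_def lb_def)
    have "(lb, C) \<in> cfg (X \<omega>)"
      unfolding cfg_def
    proof (intro CollectI, simp only: prod.case, intro conjI \<theta>)
      show "\<exists>g\<in>G. \<forall>s\<in>?I. g (X \<omega> s) = lb s"
        using g by (intro bexI[of _ g]) (auto simp: X_def lb_def)
      have "inv (X \<omega>) lb ` ?I = (\<lambda>s. 1 / e (fst (\<omega> s)) (g (fst (\<omega> s)))) ` ?I"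
        using inv_eq by (intro image_cong) auto
      moreover have "C = clip (X \<omega>) lb \<tau>"
        unfolding C_def clip_def using inv_eq by auto
      ultimately show "\<exists>\<tau>\<in>insert 0 (inv (X \<omega>) lb ` ?I). C = clip (X \<omega>) lb \<tau>"
        using \<tau> by auto
    qed
    then have \<phi>1: "\<phi> (lb, C) (X \<omega>) = 1" using xs by (simp add: \<phi>_def)
    have "(\<Prod>s\<in>?I. w (lb, C) \<epsilon> l s (\<omega> s)) = (\<Prod>s\<in>C. ennreal (exp (log_weight \<epsilon> l (g (fst (\<omega> s))) (\<omega> s))))"
    proof -
      have "(\<Prod>s\<in>?I. w (lb, C) \<epsilon> l s (\<omega> s))
          = (\<Prod>s\<in>?I. if s \<in> C then ennreal (exp (log_weight \<epsilon> l (g (fst (\<omega> s))) (\<omega> s))) else 1)"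
        by (intro prod.cong refl) (auto simp: w_def lb_def)
      also have "\<dots> = (\<Prod>s\<in>?I \<inter> C. ennreal (exp (log_weight \<epsilon> l (g (fst (\<omega> s))) (\<omega> s))))"
        by (rule prod.inter_restrict[symmetric]) simp
      also have "?I \<inter> C = C" by (auto simp: C_def)
      finally show ?thesis .
    qed
    also have "\<dots> = ennreal (exp (\<Sum>s\<in>C. log_weight \<epsilon> l (g (fst (\<omega> s))) (\<omega> s)))"
      by (simp add: prod_ennreal exp_sum C_def)
    finally have "ennreal (exp (\<Sum>s\<in>C. log_weight \<epsilon> l (g (fst (\<omega> s))) (\<omega> s)))
        = \<phi> (lb, C) (X \<omega>) * (\<Prod>s\<in>?I. w (lb, C) \<epsilon> l s (\<omega> s))" using \<phi>1 by simp
    also have "\<dots> \<le> (\<Sum>\<theta>\<in>\<Theta>. \<phi> \<theta> (X \<omega>) * (\<Prod>s\<in>?I. w \<theta> \<epsilon> l s (\<omega> s)))"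
      by (rule member_le_sum[OF \<theta> _ fin]) simp
    also have "\<dots> \<le> (\<Sum>l\<in>\<Lambda>. \<Sum>\<theta>\<in>\<Theta>. \<phi> \<theta> (X \<omega>) * (\<Prod>s\<in>?I. w \<theta> \<epsilon> l s (\<omega> s)))"
      by (rule member_le_sum[OF l _ \<Lambda>(1)]) simp
    also have "\<dots> \<le> H \<omega>"
      unfolding H_def by (rule member_le_sum[OF \<epsilon>]) simp_all
    also note \<omega>'(2)
    finally have "(\<Sum>s\<in>C. log_weight \<epsilon> l (g (fst (\<omega> s))) (\<omega> s)) < L"
      by (simp add: ennreal_less_iff)
    then show ?thesis unfolding C_def by simp
  qed
  then show ?thesis using A by (intro bexI[of _ ?A]) blast+
qed

end

section \<open>Error of the clipped estimator on a realised sample\<close>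

text \<open>The scale \<open>W\<close> of the bound is random, so the exponent parameter tuned to it is taken from a deterministic grid
that determines \<open>W\<close> up to a factor \<open>4\<close>.\<close>

lemma geometric_bracket:
  fixes W :: real
  assumes N: "N \<ge> 1" and W: "real N \<le> W" "W \<le> (real N)\<^sup>2"
  obtains k where "k \<le> N" "W \<le> real N * 4 ^ k" "real N * 4 ^ k \<le> 4 * W"
proof -
  define k where "k = (LEAST k. W \<le> real N * 4 ^ k)"
  have "real N \<le> 4 ^ N"
  proof -
    have "N < 4 ^ N" by (rule power_gt_expt) simp
    then have "real N < real (4 ^ N)" by (rule of_nat_less_iff[THEN iffD2])
    then show ?thesis by simp
  qed
  then have "(real N)\<^sup>2 \<le> real N * 4 ^ N" unfolding power2_eq_square by (intro mult_left_mono) auto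
  then have *: "W \<le> real N * 4 ^ N" using W by linarith
  have k: "W \<le> real N * 4 ^ k" unfolding k_def using * by (rule LeastI)
  have kN: "k \<le> N" unfolding k_def using * by (rule Least_le)
  have "real N * 4 ^ k \<le> 4 * W"
  proof (cases k)
    case 0
    then show ?thesis using W N by simp
  next
    case (Suc k')
    then have "\<not> W \<le> real N * 4 ^ k'" using not_less_Least[of k' "\<lambda>k. W \<le> real N * 4 ^ k"] by (simp add: k_def)
    then show ?thesis using Suc by simp
  qed
  then show ?thesis using that k kN by blast
qed

text \<open>All quantities are compared with \<open>W\<close>, the larger of the two minimal values in units of \<open>M^2 / N^2\<close>.  It lies
between \<open>N\<close>, because every unit contributes at least \<open>1\<close> to \<open>B_tilde\<close>, and \<open>N^2\<close>, the value at
threshold \<open>0\<close>, so that the grid of the previous lemma reaches it.\<close>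

lemma clipped_dr_error_le:
  fixes e m \<mu>h :: "'x \<Rightarrow> nat \<Rightarrow> real" and M \<eta> L \<Psi> :: real
  assumes N: "N \<ge> 1" and M: "M > 0" and \<eta>: "\<eta> > 0" and L: "L \<ge> 1"
    and e: "\<And>s. s \<in> {1..N} \<Longrightarrow> e (xs s) (g (xs s)) > 0 \<and> e (xs s) (g (xs s)) \<le> 1"
    and m: "\<And>s. s \<in> {1..N} \<Longrightarrow> m (xs s) (g (xs s)) \<in> {0..M}"
    and \<mu>h: "\<And>s. s \<in> {1..N} \<Longrightarrow> \<mu>h (xs s) (g (xs s)) \<in> {0..M}"
    and \<tau>o: "threshold_minimizer \<eta> N e xs g (ocdr_objective N e xs ds g) \<tau>o"
    and \<tau>h: "threshold_minimizer \<eta> N e xs g (B_hat M N e xs ds g) \<tau>h"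
    and \<tau>t: "threshold_minimizer \<eta> N e xs g (B_tilde M N e xs g) \<tau>t"
    and sampling: "\<bar>(\<Sum>s=1..N. m (xs s) (g (xs s))) - real N * \<Psi>\<bar> \<le> M * sqrt (real N * L)"
    and noise: "\<And>k \<epsilon>. k \<le> N \<Longrightarrow> \<epsilon> \<in> {1, -1} \<Longrightarrow>
      (\<Sum>s | s \<in> {1..N} \<and> 1 / e (xs s) (g (xs s)) \<le> \<tau>o.
         \<epsilon> * (sqrt (L / (2 * (real N * 4 ^ k))) / M)
           * (of_bool (ds s = g (xs s)) / e (xs s) (g (xs s)) * (ys s - \<mu>h (xs s) (g (xs s)))
              - (m (xs s) (g (xs s)) - \<mu>h (xs s) (g (xs s))))
         - (sqrt (L / (2 * (real N * 4 ^ k))) / M)\<^sup>2 * M\<^sup>2 * (of_bool (ds s = g (xs s)) / (e (xs s) (g (xs s)))\<^sup>2)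
         - min ((sqrt (L / (2 * (real N * 4 ^ k))) / M)\<^sup>2 * M\<^sup>2 / e (xs s) (g (xs s)))
               (2 * (sqrt (L / (2 * (real N * 4 ^ k))) / M) * M)) \<le> L"
  shows "\<bar>clipped_dr_value N e \<mu>h xs ds ys g \<tau>o - \<Psi>\<bar>
    \<le> 12 * sqrt L * max (sqrt (B_hat M N e xs ds g \<tau>h)) (sqrt (B_tilde M N e xs g \<tau>t))"
proof -
  define E where "E s = e (xs s) (g (xs s))" for s
  define d where "d s = (of_bool (ds s = g (xs s)) :: real)" for s
  define ms where "ms s = m (xs s) (g (xs s))" for s
  define hs where "hs s = \<mu>h (xs s) (g (xs s))" for s
  define n where "n \<tau> = (\<Sum>s=1..N. of_bool (1 / E s > \<tau>) :: real)" for \<tau>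
  define V where "V \<tau> = (\<Sum>s=1..N. d s / (E s)\<^sup>2 * of_bool (1 / E s \<le> \<tau>))" for \<tau>
  define T where "T \<tau> = (\<Sum>s=1..N. 1 / E s * of_bool (1 / E s \<le> \<tau>))" for \<tau>
  have d_swap: "(of_bool (g (xs s) = ds s) :: real) = d s" for s by (simp add: d_def eq_commute)
  have Bh: "B_hat M N e xs ds g \<tau> = (M / real N)\<^sup>2 * ((n \<tau>)\<^sup>2 + V \<tau>)" for \<tau>
    by (simp add: B_hat_def n_def V_def E_def d_def power_divide)
  have Bt: "B_tilde M N e xs g \<tau> = (M / real N)\<^sup>2 * ((n \<tau>)\<^sup>2 + T \<tau>)" for \<tau>
    by (simp add: B_tilde_def n_def T_def E_def power_divide)
  have Fo: "ocdr_objective N e xs ds g \<tau> = (1 / real N)\<^sup>2 * ((n \<tau>)\<^sup>2 + 2 * V \<tau>)" for \<tau>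
    unfolding ocdr_objective_def d_swap E_def[symmetric] n_def[symmetric] V_def[symmetric]
    by (simp add: power_divide power_mult_distrib add_divide_distrib)
  have Epos: "E s > 0" "1 \<le> 1 / E s" if "s \<in> {1..N}" for s
    using e[OF that] by (auto simp: E_def)
  have mh: "\<bar>ms s - hs s\<bar> \<le> M" if "s \<in> {1..N}" for s
    using m[OF that] \<mu>h[OF that] by (auto simp: ms_def hs_def abs_if)
  have n0: "n \<tau> \<ge> 0" and V0: "V \<tau> \<ge> 0" and T0: "T \<tau> \<ge> 0" for \<tau>
    unfolding n_def V_def T_def d_def using Epos by (auto intro!: sum_nonneg mult_nonneg_nonneg simp: less_imp_le)
  have fac: "(M / real N)\<^sup>2 > 0" "(1 / real N)\<^sup>2 > 0" using M N by auto
  have zero: "0 \<in> {0..1/\<eta>}" using \<eta> by simp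
  have in\<tau>: "\<tau>h \<in> {0..1/\<eta>}"
    using \<tau>h by (simp add: threshold_minimizer_def is_arg_min_def)
  have le_h: "(n \<tau>h)\<^sup>2 + V \<tau>h \<le> (n t)\<^sup>2 + V t" if "t \<in> {0..1/\<eta>}" for t
    using \<tau>h that fac unfolding threshold_minimizer_def is_arg_min_def Bh
    by (auto simp: not_less)
  have le_t: "(n \<tau>t)\<^sup>2 + T \<tau>t \<le> (n t)\<^sup>2 + T t" if "t \<in> {0..1/\<eta>}" for t
    using \<tau>t that fac unfolding threshold_minimizer_def is_arg_min_def Bt
    by (auto simp: not_less)
  have le_o: "(n \<tau>o)\<^sup>2 + 2 * V \<tau>o \<le> (n t)\<^sup>2 + 2 * V t" if "t \<in> {0..1/\<eta>}" for t
    using \<tau>o that fac unfolding threshold_minimizer_def is_arg_min_def Fo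
    by (auto simp: not_less)
  have at0: "n 0 = real N" "V 0 = 0" "T 0 = 0"
  proof -
    have p: "0 < 1 / E s" "\<not> 1 / E s \<le> 0" if "s \<in> {1..N}" for s
      using Epos(2)[OF that] by linarith+
    show "n 0 = real N" unfolding n_def using p by simp
    show "V 0 = 0" "T 0 = 0" unfolding V_def T_def using p by (auto intro!: sum.neutral)
  qed
  define W where "W = max ((n \<tau>h)\<^sup>2 + V \<tau>h) ((n \<tau>t)\<^sup>2 + T \<tau>t)"
  have W_le: "W \<le> (real N)\<^sup>2" using le_h[OF zero] le_t[OF zero] at0 by (simp add: W_def)
  have W_ge: "real N \<le> W"
  proof -
    have "real N = (\<Sum>s=1..N. of_bool (1 / E s > \<tau>t) + of_bool (1 / E s \<le> \<tau>t) :: real)"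
    proof -
      have "(\<Sum>s=1..N. of_bool (1 / E s > \<tau>t) + of_bool (1 / E s \<le> \<tau>t) :: real) = (\<Sum>s=1..N. 1)"
        by (intro sum.cong) auto
      then show ?thesis by simp
    qed
    also have "\<dots> \<le> (\<Sum>s=1..N. of_bool (1 / E s > \<tau>t) + 1 / E s * of_bool (1 / E s \<le> \<tau>t))"
      using Epos(2) by (intro sum_mono) (auto simp: of_bool_def)
    also have "\<dots> = n \<tau>t + T \<tau>t" by (simp add: n_def T_def sum.distrib)
    also have "n \<tau>t \<le> (n \<tau>t)\<^sup>2"
    proof -
      have "n \<tau>t = real (\<Sum>s=1..N. of_bool (1 / E s > \<tau>t) :: nat)"
        unfolding n_def of_nat_sum of_nat_of_bool ..
      then show ?thesis using of_nat_le_iff[where 'a = real] by (simp add: power2_eq_square flip: of_nat_mult)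
    qed
    finally show ?thesis by (simp add: W_def)
  qed
  define q where "q = sqrt W"
  have W0: "W > 0" using W_ge N by linarith
  have q: "q > 0" "q\<^sup>2 = W" using W0 by (auto simp: q_def)
  have RHS: "max (sqrt (B_hat M N e xs ds g \<tau>h)) (sqrt (B_tilde M N e xs g \<tau>t)) = M / real N * q"
  proof -
    have "max (sqrt (B_hat M N e xs ds g \<tau>h)) (sqrt (B_tilde M N e xs g \<tau>t))
        = max (M / real N * sqrt ((n \<tau>h)\<^sup>2 + V \<tau>h)) (M / real N * sqrt ((n \<tau>t)\<^sup>2 + T \<tau>t))"
      using M N by (simp add: Bh Bt real_sqrt_mult)
    also have "\<dots> = M / real N * max (sqrt ((n \<tau>h)\<^sup>2 + V \<tau>h)) (sqrt ((n \<tau>t)\<^sup>2 + T \<tau>t))"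
      using M N by (simp add: max_mult_distrib_left)
    also have "max (sqrt ((n \<tau>h)\<^sup>2 + V \<tau>h)) (sqrt ((n \<tau>t)\<^sup>2 + T \<tau>t)) = q"
      unfolding q_def W_def by (simp add: max_def)
    finally show ?thesis .
  qed
  \<comment> \<open>\<open>\<tau>o\<close> is compared with \<open>\<tau>h\<close>: their objectives differ by a factor of at most \<open>2\<close>\<close>
  have o_le: "(n \<tau>o)\<^sup>2 + 2 * V \<tau>o \<le> 2 * W"
  proof -
    have "(n \<tau>o)\<^sup>2 + 2 * V \<tau>o \<le> (n \<tau>h)\<^sup>2 + 2 * V \<tau>h" by (rule le_o[OF in\<tau>])
    also have "\<dots> \<le> 2 * ((n \<tau>h)\<^sup>2 + V \<tau>h)" by simp
    also have "\<dots> \<le> 2 * W" unfolding W_def by (intro mult_left_mono) auto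
    finally show ?thesis .
  qed
  have Vo: "V \<tau>o \<le> W" using o_le zero_le_power2[of "n \<tau>o"] by linarith
  have no: "n \<tau>o \<le> 2 * q"
  proof (rule power2_le_imp_le)
    show "(n \<tau>o)\<^sup>2 \<le> (2 * q)\<^sup>2" using o_le V0[of \<tau>o] W0 q by (simp add: power_mult_distrib)
  qed (use q in simp)
  have Tt: "T \<tau>t \<le> W" using zero_le_power2[of "n \<tau>t"] unfolding W_def by (simp add: le_max_iff_disj)
  have nt: "n \<tau>t \<le> q"
  proof (rule power2_le_imp_le)
    show "(n \<tau>t)\<^sup>2 \<le> q\<^sup>2" using T0[of \<tau>t] q by (simp add: W_def le_max_iff_disj)
  qed (use q in simp)
  obtain k where k: "k \<le> N" "W \<le> real N * 4 ^ k" "real N * 4 ^ k \<le> 4 * W"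
    using geometric_bracket[OF N W_ge W_le] by blast
  define a where "a = real N * 4 ^ k"
  define b where "b = sqrt L"
  define l where "l = sqrt (L / (2 * a)) / M"
  have b: "b \<ge> 1" "b\<^sup>2 = L" using L by (auto simp: b_def)
  define r where "r = sqrt (2 * a)"
  have a: "W \<le> a" "a \<le> 4 * W" using k by (auto simp: a_def)
  have r: "r > 0" "q \<le> r" "r \<le> 3 * q"
  proof -
    show "r > 0" using a W0 by (simp add: r_def)
    show "q \<le> r" unfolding q_def r_def using a W0 by simp
    show "r \<le> 3 * q"
      unfolding r_def by (rule real_le_lsqrt) (use a W0 q in \<open>auto simp: power_mult_distrib\<close>)
  qed
  have l: "l = b / (r * M)" by (simp add: l_def b_def r_def real_sqrt_divide)
  have lpos: "l > 0" using l b r M by simp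
  define C where "C = {s \<in> {1..N}. 1 / E s \<le> \<tau>o}"
  define \<zeta> where "\<zeta> s = d s / E s * (ys s - hs s) - (ms s - hs s)" for s
  have finC: "finite C" by (simp add: C_def)
  have VC: "(\<Sum>s\<in>C. d s / (E s)\<^sup>2) = V \<tau>o"
  proof -
    have "V \<tau>o = (\<Sum>s\<in>{1..N}. if 1 / E s \<le> \<tau>o then d s / (E s)\<^sup>2 else 0)"
      unfolding V_def by (intro sum.cong) auto
    then show ?thesis unfolding C_def by (simp only: sum.inter_filter[OF finite_atLeastAtMost])
  qed
  \<comment> \<open>units beyond \<open>\<tau>t\<close> are charged linearly and counted by \<open>n \<tau>t\<close>\<close>
  have clip_cost: "(\<Sum>s\<in>C. min (l\<^sup>2 * M\<^sup>2 / E s) (2 * l * M)) \<le> l\<^sup>2 * M\<^sup>2 * T \<tau>t + 2 * l * M * n \<tau>t"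
  proof -
    have "(\<Sum>s\<in>C. min (l\<^sup>2 * M\<^sup>2 / E s) (2 * l * M))
        \<le> (\<Sum>s\<in>{1..N}. min (l\<^sup>2 * M\<^sup>2 / E s) (2 * l * M))"
      using lpos M Epos by (intro sum_mono2) (auto simp: C_def less_imp_le)
    also have "\<dots> \<le> (\<Sum>s\<in>{1..N}. l\<^sup>2 * M\<^sup>2 * (1 / E s * of_bool (1 / E s \<le> \<tau>t))
          + 2 * l * M * of_bool (1 / E s > \<tau>t))"
      by (intro sum_mono) (auto simp: of_bool_def)
    also have "\<dots> = l\<^sup>2 * M\<^sup>2 * T \<tau>t + 2 * l * M * n \<tau>t"
      by (simp only: T_def n_def sum.distrib sum_distrib_left)
    finally show ?thesis .
  qed
  have signed: "\<epsilon> * l * (\<Sum>s\<in>C. \<zeta> s) \<le> L + l\<^sup>2 * M\<^sup>2 * (2 * W) + 2 * l * M * q" if \<epsilon>: "\<epsilon> \<in> {1, -1}" for \<epsilon>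
  proof -
    have "(\<Sum>s\<in>C. \<epsilon> * l * \<zeta> s - l\<^sup>2 * M\<^sup>2 * (d s / (E s)\<^sup>2) - min (l\<^sup>2 * M\<^sup>2 / E s) (2 * l * M)) \<le> L"
      using noise[OF k(1) \<epsilon>]
      unfolding a_def[symmetric] l_def[symmetric] E_def[symmetric] d_def[symmetric]
        ms_def[symmetric] hs_def[symmetric] \<zeta>_def[symmetric] C_def[symmetric] .
    then have "\<epsilon> * l * (\<Sum>s\<in>C. \<zeta> s) \<le> L + l\<^sup>2 * M\<^sup>2 * V \<tau>o
        + (\<Sum>s\<in>C. min (l\<^sup>2 * M\<^sup>2 / E s) (2 * l * M))"
      by (simp only: sum_subtractf sum_distrib_left[symmetric] VC)
    moreover have "l\<^sup>2 * M\<^sup>2 * V \<tau>o \<le> l\<^sup>2 * M\<^sup>2 * W" "l\<^sup>2 * M\<^sup>2 * T \<tau>t \<le> l\<^sup>2 * M\<^sup>2 * W"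
      using Vo Tt by (auto intro!: mult_left_mono)
    moreover have "2 * l * M * n \<tau>t \<le> 2 * l * M * q"
      using nt lpos M by (intro mult_left_mono) auto
    moreover have "l\<^sup>2 * M\<^sup>2 * (2 * W) = l\<^sup>2 * M\<^sup>2 * W + l\<^sup>2 * M\<^sup>2 * W" by simp
    ultimately show ?thesis using clip_cost by linarith
  qed
  have "l * \<bar>\<Sum>s\<in>C. \<zeta> s\<bar> \<le> L + l\<^sup>2 * M\<^sup>2 * (2 * W) + 2 * l * M * q"
    using signed[of 1] signed[of "-1"] by (cases "(\<Sum>s\<in>C. \<zeta> s) \<ge> 0") auto
  also have "\<dots> \<le> l * (M * (5 * b * q + 2 * q))"
  proof -
    have lrM: "l * M = b / r" using M by (simp add: l)
    have "L \<le> l * M * (3 * b * q)"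
    proof -
      have "L = l * M * (b * r)" using r b by (simp add: lrM power2_eq_square)
      also have "\<dots> \<le> l * M * (b * (3 * q))" using r lpos M b by (intro mult_left_mono) auto
      finally show ?thesis by (simp add: mult_ac)
    qed
    moreover have "l\<^sup>2 * M\<^sup>2 * (2 * W) \<le> l * M * (2 * b * q)"
    proof -
      have "l\<^sup>2 * M\<^sup>2 * (2 * W) = l * M * (2 * q * (b / r * q))"
        unfolding lrM[symmetric] q(2)[symmetric] by (simp add: power2_eq_square)
      also have "b / r * q \<le> b"
        using r b q by (simp add: pos_divide_le_eq mult_left_mono)
      then have "l * M * (2 * q * (b / r * q)) \<le> l * M * (2 * q * b)"
        using lpos M q by (intro mult_left_mono) auto
      finally show ?thesis by (simp add: mult_ac)
    qed
    ultimately show ?thesis by (simp add: algebra_simps)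
  qed
  finally have noise_le: "\<bar>\<Sum>s\<in>C. \<zeta> s\<bar> \<le> M * (5 * b * q + 2 * q)" using lpos by simp
  have bias_le: "\<bar>\<Sum>s=1..N. of_bool (1 / E s > \<tau>o) * (hs s - ms s)\<bar> \<le> M * (2 * q)"
  proof -
    have "\<bar>\<Sum>s=1..N. of_bool (1 / E s > \<tau>o) * (hs s - ms s)\<bar> \<le> (\<Sum>s=1..N. M * of_bool (1 / E s > \<tau>o))"
      using mh M by (intro sum_abs[THEN order_trans] sum_mono) (auto simp: of_bool_def abs_minus_commute)
    also have "\<dots> = M * n \<tau>o" by (simp add: n_def sum_distrib_left)
    also have "\<dots> \<le> M * (2 * q)" using no M by (intro mult_left_mono) auto
    finally show ?thesis .
  qed
  have sampling_le: "\<bar>(\<Sum>s=1..N. ms s) - real N * \<Psi>\<bar> \<le> M * (b * q)"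
  proof -
    have "sqrt (real N * L) = sqrt (real N) * b" by (simp add: real_sqrt_mult b_def)
    also have "\<dots> \<le> q * b" unfolding q_def using W_ge b by (intro mult_right_mono) auto
    finally have "M * sqrt (real N * L) \<le> M * (q * b)" using M by (intro mult_left_mono) auto
    then show ?thesis using sampling by (simp add: ms_def mult.commute)
  qed
  have decomp: "real N * (clipped_dr_value N e \<mu>h xs ds ys g \<tau>o - \<Psi>)
      = (\<Sum>s\<in>C. \<zeta> s) + (\<Sum>s=1..N. of_bool (1 / E s > \<tau>o) * (hs s - ms s)) + ((\<Sum>s=1..N. ms s) - real N * \<Psi>)"
  proof -
    have "real N * clipped_dr_value N e \<mu>h xs ds ys g \<tau>o
        = (\<Sum>s=1..N. hs s + d s / E s * of_bool (1 / E s \<le> \<tau>o) * (ys s - hs s))"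
      using N unfolding clipped_dr_value_def d_swap by (simp add: E_def hs_def)
    also have "\<dots> = (\<Sum>s=1..N. (if 1 / E s \<le> \<tau>o then \<zeta> s else 0)
        + of_bool (1 / E s > \<tau>o) * (hs s - ms s) + ms s)"
      by (intro sum.cong) (auto simp: \<zeta>_def of_bool_def)
    also have "\<dots> = (\<Sum>s\<in>C. \<zeta> s) + (\<Sum>s=1..N. of_bool (1 / E s > \<tau>o) * (hs s - ms s)) + (\<Sum>s=1..N. ms s)"
      unfolding C_def by (simp only: sum.distrib sum.inter_filter[OF finite_atLeastAtMost])
    finally show ?thesis by (simp add: right_diff_distrib)
  qed
  have "real N * \<bar>clipped_dr_value N e \<mu>h xs ds ys g \<tau>o - \<Psi>\<bar>
      = \<bar>real N * (clipped_dr_value N e \<mu>h xs ds ys g \<tau>o - \<Psi>)\<bar>" by (simp add: abs_mult)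
  also have "\<dots> \<le> M * (5 * b * q + 2 * q) + M * (2 * q) + M * (b * q)"
    unfolding decomp using noise_le bias_le sampling_le by linarith
  also have "\<dots> = M * q * (6 * b + 4)" by (simp add: algebra_simps)
  also have "\<dots> \<le> M * q * (12 * b)" using b q M by (intro mult_left_mono) auto
  also have "\<dots> = real N * (12 * b * (M / real N * q))" using N by simp
  finally have "\<bar>clipped_dr_value N e \<mu>h xs ds ys g \<tau>o - \<Psi>\<bar> \<le> 12 * b * (M / real N * q)"
    by (rule mult_left_le_imp_le) (use N in simp)
  then show ?thesis unfolding RHS b_def .
qed

section \<open>Law of the observed units and identification\<close>

context observational_study
begin

definition covariate_space :: "(real ^ 'p) measure" where
  "covariate_space = restrict_space borel \<X>"

definition observed :: "nat \<Rightarrow> 'w \<Rightarrow> (real ^ 'p) \<times> nat \<times> real" where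
  "observed s w = (X s w, D s w, Y s (D s w) w)"

definition observed_space :: "((real ^ 'p) \<times> nat \<times> real) measure" where
  "observed_space = covariate_space \<Otimes>\<^sub>M (count_space {1..J} \<Otimes>\<^sub>M borel)"

definition unit_distr :: "((real ^ 'p) \<times> nat \<times> real) measure" where
  "unit_distr = distr P observed_space (observed 1)"

text \<open>Clipping changes the regression function only on a null set (lemma \<open>regression_in_range\<close>) and makes its bounds
hold everywhere.\<close>

definition clipped_regression :: "real ^ 'p \<Rightarrow> nat \<Rightarrow> real" where
  "clipped_regression \<xi> j = max 0 (min M (\<mu> \<xi> j))"

lemma space_covariate: "space covariate_space = \<X>"
  by (simp add: covariate_space_def space_restrict_space)

lemma one_mem: "1 \<in> {1..N}" using N_pos by simp

lemma unit_data_rv: "s \<in> {1..N} \<Longrightarrow> unit_data J X D Y s \<in> P \<rightarrow>\<^sub>M unit_space J"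
  using units_indep by (auto simp: indep_vars_def)

lemma covariate_rv: "s \<in> {1..N} \<Longrightarrow> X s \<in> borel_measurable P"
proof -
  assume s: "s \<in> {1..N}"
  have "fst \<in> unit_space J \<rightarrow>\<^sub>M borel"
    unfolding unit_space_def by measurable
  from measurable_compose[OF unit_data_rv[OF s] this] show ?thesis by (simp add: unit_data_def)
qed

lemma treatment_rv: "s \<in> {1..N} \<Longrightarrow> D s \<in> P \<rightarrow>\<^sub>M count_space {1..J}"
proof -
  assume s: "s \<in> {1..N}"
  have "(\<lambda>z. fst (snd z)) \<in> unit_space J \<rightarrow>\<^sub>M count_space {1..J}"
    unfolding unit_space_def by measurable
  from measurable_compose[OF unit_data_rv[OF s] this] show ?thesis by (simp add: unit_data_def)
qed

lemma outcome_rv: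
  assumes s: "s \<in> {1..N}" and j: "j \<in> {1..J}"
  shows "Y s j \<in> borel_measurable P"
proof -
  have "(\<lambda>z. snd (snd z) j) \<in> borel_measurable (unit_space J)"
    unfolding unit_space_def
    by (rule measurable_compose[OF measurable_snd measurable_compose[OF measurable_snd measurable_component_singleton[OF j]]])
  from measurable_compose[OF unit_data_rv[OF s] this] show ?thesis using j by (simp add: unit_data_def)
qed

lemma covariate_rv': "s \<in> {1..N} \<Longrightarrow> X s \<in> P \<rightarrow>\<^sub>M covariate_space"
  unfolding covariate_space_def
  by (rule measurable_restrict_space2) (auto simp: covariate_rv X_range)

lemma treatment_in_range: "s \<in> {1..N} \<Longrightarrow> w \<in> space P \<Longrightarrow> D s w \<in> {1..J}"
  using measurable_space[OF treatment_rv] by auto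

definition observe :: "(real ^ 'p) \<times> nat \<times> (nat \<Rightarrow> real) \<Rightarrow> (real ^ 'p) \<times> nat \<times> real" where
  "observe z = (fst z, fst (snd z), snd (snd z) (fst (snd z)))"

lemma observe_meas: "observe \<in> unit_space J \<rightarrow>\<^sub>M (borel \<Otimes>\<^sub>M (count_space {1..J} \<Otimes>\<^sub>M borel))"
proof -
  have d: "(\<lambda>z. fst (snd z)) \<in> unit_space J \<rightarrow>\<^sub>M count_space {1..J}"
    unfolding unit_space_def by measurable
  have x: "fst \<in> unit_space J \<rightarrow>\<^sub>M borel"
    unfolding unit_space_def by measurable
  have y: "(\<lambda>z. snd (snd z) j) \<in> borel_measurable (unit_space J)" if j: "j \<in> {1..J}" for j
    unfolding unit_space_def
    by (rule measurable_compose[OF measurable_snd measurable_compose[OF measurable_snd measurable_component_singleton[OF j]]])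
  have "(\<lambda>z. snd (snd z) (fst (snd z))) \<in> borel_measurable (unit_space J)"
    by (rule measurable_compose_countable'[OF y d]) auto
  with d x show ?thesis unfolding observe_def[abs_def] by (intro measurable_Pair)
qed

lemma observe_unit_data:
  "s \<in> {1..N} \<Longrightarrow> w \<in> space P \<Longrightarrow> observe (unit_data J X D Y s w) = observed s w"
  using treatment_in_range[of s w] by (simp add: observe_def unit_data_def observed_def)

lemma observed_outcome_rv: "s \<in> {1..N} \<Longrightarrow> (\<lambda>w. Y s (D s w) w) \<in> borel_measurable P"
  by (rule measurable_compose_countable'[OF outcome_rv treatment_rv]) auto

lemma observed_rv: "s \<in> {1..N} \<Longrightarrow> observed s \<in> P \<rightarrow>\<^sub>M observed_space"
  unfolding observed_def[abs_def] observed_space_def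
  by (intro measurable_Pair covariate_rv' treatment_rv observed_outcome_rv)

text \<open>The covariates take values in \<open>\<X>\<close>, which need not be a Borel set; events of the trace on \<open>\<X>\<close> are therefore
pulled back to events of the original units, which transfers independence and identical distribution.\<close>

lemma observed_vimage:
  assumes A: "A \<in> sets observed_space"
  obtains A' where "A' \<in> sets (unit_space J)"
    and "\<And>s. s \<in> {1..N} \<Longrightarrow> observed s -` A \<inter> space P = unit_data J X D Y s -` A' \<inter> space P"
proof -
  let ?T = "borel \<Otimes>\<^sub>M (count_space {1..J} \<Otimes>\<^sub>M (borel :: real measure)) :: ((real ^ 'p) \<times> nat \<times> real) measure"
  let ?R = "restrict_space ?T (\<X> \<times> UNIV)"
  have "(\<lambda>z. z) \<in> ?R \<rightarrow>\<^sub>M observed_space"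
  proof -
    have "fst \<in> ?R \<rightarrow>\<^sub>M covariate_space"
      unfolding covariate_space_def
      by (rule measurable_restrict_space2)
         (auto simp: space_restrict_space intro: measurable_restrict_space1)
    moreover have "snd \<in> ?R \<rightarrow>\<^sub>M (count_space {1..J} \<Otimes>\<^sub>M borel)"
      by (rule measurable_restrict_space1) measurable
    ultimately have "(\<lambda>z. (fst z, snd z)) \<in> ?R \<rightarrow>\<^sub>M observed_space"
      unfolding observed_space_def by (rule measurable_Pair)
    then show ?thesis by simp
  qed
  from measurable_sets[OF this A] have "A \<inter> space ?R \<in> sets ?R" by simp
  then obtain B where B: "B \<in> sets ?T" "A \<inter> space ?R = (\<X> \<times> UNIV) \<inter> B"
    unfolding sets_restrict_space by auto
  have sp: "space ?R = (\<X> \<times> UNIV) \<inter> space ?T" by (simp add: space_restrict_space)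
  let ?A' = "observe -` B \<inter> space (unit_space J)"
  have "observed s -` A \<inter> space P = unit_data J X D Y s -` ?A' \<inter> space P" if s: "s \<in> {1..N}" for s
  proof -
    have "observed s w \<in> A \<longleftrightarrow> unit_data J X D Y s w \<in> ?A'" if w: "w \<in> space P" for w
    proof -
      have "observed s w \<in> space ?R"
        unfolding sp using X_range[OF s w] treatment_in_range[OF s w]
        by (auto simp: observed_def space_pair_measure)
      then have "observed s w \<in> A \<longleftrightarrow> observed s w \<in> B" using B(2) sp by blast
      then show ?thesis
        using observe_unit_data[OF s w] measurable_space[OF unit_data_rv[OF s] w] by auto
    qed
    then show ?thesis by (simp only: set_eq_iff Int_iff vimage_eq) blast
  qed
  moreover have "?A' \<in> sets (unit_space J)" using measurable_sets[OF observe_meas B(1)] .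
  ultimately show ?thesis using that by blast
qed

lemma observed_ident:
  assumes s: "s \<in> {1..N}"
  shows "distr P observed_space (observed s) = unit_distr"
proof (rule measure_eqI)
  fix A assume "A \<in> sets (distr P observed_space (observed s))"
  then have A: "A \<in> sets observed_space" by simp
  from observed_vimage[OF A] obtain A' where A': "A' \<in> sets (unit_space J)"
    "\<And>s. s \<in> {1..N} \<Longrightarrow> observed s -` A \<inter> space P = unit_data J X D Y s -` A' \<inter> space P" by blast
  have "emeasure (distr P observed_space (observed t)) A = emeasure (distr P (unit_space J) (unit_data J X D Y t)) A'"
    if t: "t \<in> {1..N}" for t
    using emeasure_distr[OF observed_rv[OF t] A] emeasure_distr[OF unit_data_rv[OF t] A'(1)] A'(2)[OF t] by simp
  from this[OF s] this[OF one_mem]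
  show "emeasure (distr P observed_space (observed s)) A = emeasure unit_distr A"
    unfolding unit_distr_def units_ident[OF s one_mem] by simp
qed (simp add: unit_distr_def)

lemma observed_indep: "indep_vars (\<lambda>_. observed_space) observed {1..N}"
  unfolding indep_vars_def2
proof (intro conjI ballI observed_rv)
  have "indep_sets (\<lambda>i. {unit_data J X D Y i -` A \<inter> space P | A. A \<in> sets (unit_space J)}) {1..N}"
    using units_indep unfolding indep_vars_def2 by blast
  then show "indep_sets (\<lambda>i. {observed i -` A \<inter> space P | A. A \<in> sets observed_space}) {1..N}"
  proof (rule indep_sets_mono_sets)
    fix i assume i: "i \<in> {1..N}"
    show "{observed i -` A \<inter> space P | A. A \<in> sets observed_space}
      \<subseteq> {unit_data J X D Y i -` A \<inter> space P | A. A \<in> sets (unit_space J)}"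
    proof
      fix B assume "B \<in> {observed i -` A \<inter> space P | A. A \<in> sets observed_space}"
      then obtain A where A: "A \<in> sets observed_space" "B = observed i -` A \<inter> space P" by blast
      from observed_vimage[OF A(1)] obtain A' where "A' \<in> sets (unit_space J)"
        "B = unit_data J X D Y i -` A' \<inter> space P" using A(2) i by metis
      then show "B \<in> {unit_data J X D Y i -` A \<inter> space P | A. A \<in> sets (unit_space J)}" by blast
    qed
  qed
qed

lemma sample_distr:
  "distr P (PiM {1..N} (\<lambda>_. observed_space)) (\<lambda>w. \<lambda>s\<in>{1..N}. observed s w) = PiM {1..N} (\<lambda>_. unit_distr)"
proof -
  have "distr P (PiM {1..N} (\<lambda>_. observed_space)) (\<lambda>w. \<lambda>s\<in>{1..N}. observed s w)
      = PiM {1..N} (\<lambda>s. distr P observed_space (observed s))"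
    using indep_vars_iff_distr_eq_PiM'[where I = "{1..N}" and M' = "\<lambda>_. observed_space" and X = observed] observed_indep observed_rv N_pos
    by auto
  also have "\<dots> = PiM {1..N} (\<lambda>_. unit_distr)"
    by (intro PiM_cong refl observed_ident)
  finally show ?thesis .
qed

lemma sample_event_prob:
  assumes A: "A \<in> sets (PiM {1..N} (\<lambda>_. unit_distr))"
  defines "B \<equiv> {w \<in> space P. (\<lambda>s\<in>{1..N}. observed s w) \<in> A}"
  shows "B \<in> events" and "prob B = measure (PiM {1..N} (\<lambda>_. unit_distr)) A"
proof -
  have rv: "(\<lambda>w. \<lambda>s\<in>{1..N}. observed s w) \<in> P \<rightarrow>\<^sub>M PiM {1..N} (\<lambda>_. observed_space)"
    by (intro measurable_restrict observed_rv)
  have A': "A \<in> sets (PiM {1..N} (\<lambda>_. observed_space))"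
    using A sets_PiM_cong[of "{1..N}" "{1..N}" "\<lambda>_. unit_distr" "\<lambda>_. observed_space"]
    by (simp add: unit_distr_def)
  have B: "B = (\<lambda>w. \<lambda>s\<in>{1..N}. observed s w) -` A \<inter> space P" by (auto simp: B_def)
  show "B \<in> events" unfolding B by (rule measurable_sets[OF rv A'])
  show "prob B = measure (PiM {1..N} (\<lambda>_. unit_distr)) A"
    unfolding B sample_distr[symmetric] by (rule measure_distr[OF rv A', symmetric])
qed

lemma covariate_subalgebra: "s \<in> {1..N} \<Longrightarrow> sigma_finite_subalgebra P (sigma_unit P X s)"
proof -
  assume s: "s \<in> {1..N}"
  have "subalgebra P (sigma_unit P X s)"
    unfolding subalgebra_def sigma_unit_def
    using measurable_sets[OF covariate_rv[OF s]] by (auto simp: sets_vimage_algebra2)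
  then have "finite_measure_subalgebra P (sigma_unit P X s)"
    unfolding finite_measure_subalgebra_def finite_measure_subalgebra_axioms_def
    using finite_measure_axioms by simp
  then show ?thesis by (rule finite_measure_subalgebra_is_sigma_finite)
qed

lemma covariate_function_meas:
  assumes s: "s \<in> {1..N}" and h: "h \<in> borel_measurable covariate_space"
  shows "(\<lambda>w. h (X s w)) \<in> borel_measurable (sigma_unit P X s)"
proof -
  have "X s \<in> sigma_unit P X s \<rightarrow>\<^sub>M covariate_space"
    unfolding covariate_space_def sigma_unit_def
    by (rule measurable_restrict_space2) (auto simp: X_range[OF s] intro!: measurable_vimage_algebra1)
  from measurable_compose[OF this h] show ?thesis .
qed

lemma covariate_function_rv:
  assumes s: "s \<in> {1..N}" and h: "h \<in> borel_measurable covariate_space"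
  shows "(\<lambda>w. h (X s w)) \<in> borel_measurable P"
  by (rule measurable_compose[OF covariate_rv'[OF s] h])

lemma treatment_indicator_rv: "s \<in> {1..N} \<Longrightarrow> (\<lambda>w. of_bool (D s w = j) :: real) \<in> borel_measurable P"
  by (rule measurable_compose[OF treatment_rv]) simp_all

lemma e_meas: "j \<in> {1..J} \<Longrightarrow> (\<lambda>\<xi>. e \<xi> j) \<in> borel_measurable covariate_space"
  unfolding covariate_space_def by (rule e_measurable)

lemma \<mu>_meas: "j \<in> {1..J} \<Longrightarrow> (\<lambda>\<xi>. \<mu> \<xi> j) \<in> borel_measurable covariate_space"
  unfolding covariate_space_def by (rule \<mu>_measurable)

lemma propensity_le_1:
  assumes s: "s \<in> {1..N}" and j: "j \<in> {1..J}"
  shows "AE w in P. e (X s w) j \<le> 1"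
proof -
  interpret F: sigma_finite_subalgebra P "sigma_unit P X s" by (rule covariate_subalgebra[OF s])
  have "integrable P (\<lambda>w. of_bool (D s w = j) :: real)"
    by (rule integrable_const_bound[where B = 1]) (auto simp: treatment_indicator_rv[OF s])
  then have "AE w in P. real_cond_exp P (sigma_unit P X s) (\<lambda>w. of_bool (D s w = j)) w \<le> 1"
    by (rule F.real_cond_exp_le_c) auto
  with e_propensity[OF s j] show ?thesis by eventually_elim simp
qed

lemma bounded_times_integrable:
  fixes f k :: "'w \<Rightarrow> real"
  assumes f: "f \<in> borel_measurable P" and b: "AE w in P. \<bar>f w\<bar> \<le> c" and k: "integrable P k"
  shows "integrable P (\<lambda>w. f w * k w)"
proof (rule Bochner_Integration.integrable_bound)
  show "integrable P (\<lambda>w. \<bar>c\<bar> * k w)" using k by simp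
  show "(\<lambda>w. f w * k w) \<in> borel_measurable P" using f k by (intro borel_measurable_times) auto
  show "AE w in P. norm (f w * k w) \<le> norm (\<bar>c\<bar> * k w)"
    using b by eventually_elim (auto simp: abs_mult intro!: mult_right_mono)
qed

lemma propensity_identity:
  assumes s: "s \<in> {1..N}" and j: "j \<in> {1..J}"
    and h: "h \<in> borel_measurable covariate_space" and b: "\<And>\<xi>. \<xi> \<in> \<X> \<Longrightarrow> \<bar>h \<xi>\<bar> \<le> c"
  shows "(\<integral>w. h (X s w) * of_bool (D s w = j) \<partial>P) = (\<integral>w. h (X s w) * e (X s w) j \<partial>P)"
proof -
  interpret F: sigma_finite_subalgebra P "sigma_unit P X s" by (rule covariate_subalgebra[OF s])
  have int: "integrable P (\<lambda>w. of_bool (D s w = j) :: real)"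
    by (rule integrable_const_bound[where B = 1]) (auto simp: treatment_indicator_rv[OF s])
  have "integrable P (\<lambda>w. h (X s w) * of_bool (D s w = j))"
    by (rule bounded_times_integrable[OF covariate_function_rv[OF s h] _ int, of c])
       (use b X_range[OF s] in auto)
  from F.real_cond_exp_intg(2)[OF this covariate_function_meas[OF s h] treatment_indicator_rv[OF s]]
  have "(\<integral>w. h (X s w) * of_bool (D s w = j) \<partial>P)
      = (\<integral>w. h (X s w) * real_cond_exp P (sigma_unit P X s) (\<lambda>w. of_bool (D s w = j)) w \<partial>P)" by simp
  also have "\<dots> = (\<integral>w. h (X s w) * e (X s w) j \<partial>P)"
  proof (rule integral_cong_AE)
    show "AE w in P. h (X s w) * real_cond_exp P (sigma_unit P X s) (\<lambda>w. of_bool (D s w = j)) w = h (X s w) * e (X s w) j"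
      using e_propensity[OF s j] by eventually_elim simp
  qed (intro borel_measurable_times covariate_function_rv[OF s h] covariate_function_rv[OF s e_meas[OF j]]
        borel_measurable_cond_exp2)+
  finally show ?thesis .
qed

text \<open>Conditional independence speaks of indicators of events of the potential outcome.  It says that two measures,
the laws of \<open>Y s j\<close> under the densities on the two sides, agree; hence so do their means.\<close>

lemma unconfounded_identity:
  assumes s: "s \<in> {1..N}" and j: "j \<in> {1..J}"
    and h: "h \<in> borel_measurable covariate_space" and b: "\<And>\<xi>. \<xi> \<in> \<X> \<Longrightarrow> 0 \<le> h \<xi> \<and> h \<xi> \<le> c"
  shows "(\<integral>w. h (X s w) * of_bool (D s w = j) * Y s j w \<partial>P) = (\<integral>w. h (X s w) * e (X s w) j * Y s j w \<partial>P)"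
proof -
  interpret F: sigma_finite_subalgebra P "sigma_unit P X s" by (rule covariate_subalgebra[OF s])
  note Yrv = outcome_rv[OF s j]
  have hrv: "(\<lambda>w. h (X s w)) \<in> borel_measurable P" by (rule covariate_function_rv[OF s h])
  have erv: "(\<lambda>w. e (X s w) j) \<in> borel_measurable P" by (rule covariate_function_rv[OF s e_meas[OF j]])
  have drv: "(\<lambda>w. of_bool (D s w = j) :: real) \<in> borel_measurable P" by (rule treatment_indicator_rv[OF s])
  have e0: "e (X s w) j \<ge> 0" if "w \<in> space P" for w
    using overlap[OF X_range[OF s that] j] \<eta>_pos by simp
  have h0: "0 \<le> h (X s w)" "h (X s w) \<le> c" if "w \<in> space P" for w
    using b[OF X_range[OF s that]] by auto
  define p where "p w = h (X s w) * of_bool (D s w = j)" for w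
  define q where "q w = h (X s w) * e (X s w) j" for w
  have prv: "p \<in> borel_measurable P" and qrv: "q \<in> borel_measurable P"
    unfolding p_def[abs_def] q_def[abs_def] using hrv erv drv by (auto intro!: borel_measurable_times)
  have p0: "0 \<le> p w" and q0: "0 \<le> q w" if "w \<in> space P" for w
    using h0[OF that] e0[OF that] by (auto simp: p_def q_def)
  have qF: "q \<in> borel_measurable (sigma_unit P X s)"
    unfolding q_def[abs_def]
    by (intro borel_measurable_times covariate_function_meas[OF s h] covariate_function_meas[OF s e_meas[OF j]])
  have q_le: "AE w in P. \<bar>q w\<bar> \<le> c"
    using propensity_le_1[OF s j] AE_space
  proof eventually_elim
    case (elim w)
    then have "q w \<le> c * 1"
      unfolding q_def using h0[OF elim(2)] e0[OF elim(2)] by (intro mult_mono) auto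
    then show ?case using q0[OF elim(2)] by simp
  qed
  have p_le: "AE w in P. \<bar>p w\<bar> \<le> c"
    by (rule AE_I2) (use h0 in \<open>auto simp: p_def of_bool_def intro: order_trans\<close>)
  have eq: "(\<integral>w. p w * indicator A (Y s j w) \<partial>P) = (\<integral>w. q w * indicator A (Y s j w) \<partial>P)"
    if A: "A \<in> sets borel" for A
  proof -
    have Arv: "(\<lambda>w. indicator A (Y s j w) :: real) \<in> borel_measurable P"
      by (rule measurable_compose[OF Yrv]) (use A in simp)
    have intA: "integrable P (\<lambda>w. indicator A (Y s j w) :: real)"
      by (rule integrable_const_bound[where B = 1]) (use Arv in \<open>auto simp: indicator_def\<close>)
    have intAD: "integrable P (\<lambda>w. indicator A (Y s j w) * of_bool (D s w = j) :: real)"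
      by (rule integrable_const_bound[where B = 1])
         (use Arv drv in \<open>auto simp: indicator_def intro!: borel_measurable_times\<close>)
    have hb: "AE w in P. \<bar>h (X s w)\<bar> \<le> c" by (rule AE_I2) (use h0 in auto)
    have "(\<integral>w. p w * indicator A (Y s j w) \<partial>P)
        = (\<integral>w. h (X s w) * (indicator A (Y s j w) * of_bool (D s w = j)) \<partial>P)"
      by (simp add: p_def mult_ac)
    also have "\<dots> = (\<integral>w. h (X s w) * real_cond_exp P (sigma_unit P X s)
          (\<lambda>w. indicator A (Y s j w) * of_bool (D s w = j)) w \<partial>P)"
      by (rule F.real_cond_exp_intg(2)[symmetric])
         (use bounded_times_integrable[OF hrv hb intAD] covariate_function_meas[OF s h] intAD in auto)
    also have "\<dots> = (\<integral>w. q w * real_cond_exp P (sigma_unit P X s) (\<lambda>w. indicator A (Y s j w)) w \<partial>P)"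
    proof (rule integral_cong_AE)
      have "AE w in P. real_cond_exp P (sigma_unit P X s) (\<lambda>v. indicator A (Y s j v) * of_bool (D s v = j)) w
          = real_cond_exp P (sigma_unit P X s) (\<lambda>v. indicator A (Y s j v)) w
            * real_cond_exp P (sigma_unit P X s) (\<lambda>v. of_bool (D s v = j)) w"
        using unconfounded[OF s j] A unfolding cond_indep_def by blast
      with e_propensity[OF s j]
      show "AE w in P. h (X s w) * real_cond_exp P (sigma_unit P X s) (\<lambda>w. indicator A (Y s j w) * of_bool (D s w = j)) w
          = q w * real_cond_exp P (sigma_unit P X s) (\<lambda>w. indicator A (Y s j w)) w"
        by eventually_elim (simp add: q_def mult_ac)
    qed (intro borel_measurable_times hrv qrv borel_measurable_cond_exp2)+
    also have "\<dots> = (\<integral>w. q w * indicator A (Y s j w) \<partial>P)"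
      by (rule F.real_cond_exp_intg(2)) (use bounded_times_integrable[OF qrv q_le intA] qF Arv in auto)
    finally show ?thesis .
  qed
  let ?\<nu> = "\<lambda>f. distr (density P (\<lambda>w. ennreal (f w))) borel (Y s j)"
  have nu: "integral\<^sup>L (?\<nu> f) (\<lambda>y. y) = (\<integral>w. f w * Y s j w \<partial>P)"
    if "f \<in> borel_measurable P" "\<And>w. w \<in> space P \<Longrightarrow> 0 \<le> f w" for f
  proof -
    have "integral\<^sup>L (?\<nu> f) (\<lambda>y. y) = (\<integral>w. Y s j w \<partial>density P (\<lambda>w. ennreal (f w)))"
      by (rule integral_distr) (use Yrv in simp_all)
    also have "\<dots> = (\<integral>w. f w * Y s j w \<partial>P)"
      by (subst integral_density) (use that Yrv in auto)
    finally show ?thesis .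
  qed
  have nuA: "emeasure (?\<nu> f) A = ennreal (\<integral>w. f w * indicator A (Y s j w) \<partial>P)"
    if f: "f \<in> borel_measurable P" "\<And>w. w \<in> space P \<Longrightarrow> 0 \<le> f w" "AE w in P. \<bar>f w\<bar> \<le> c" and A: "A \<in> sets borel" for f A
  proof -
    have Arv: "(\<lambda>w. indicator A (Y s j w) :: real) \<in> borel_measurable P"
      by (rule measurable_compose[OF Yrv]) (use A in simp)
    have intA: "integrable P (\<lambda>w. indicator A (Y s j w) :: real)"
      by (rule integrable_const_bound[where B = 1]) (use Arv in \<open>auto simp: indicator_def\<close>)
    have v: "Y s j -` A \<inter> space P \<in> sets P" using measurable_sets[OF Yrv A] .
    have "emeasure (?\<nu> f) A = emeasure (density P (\<lambda>w. ennreal (f w))) (Y s j -` A \<inter> space P)"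
      using Yrv A by (subst emeasure_distr) auto
    also have "\<dots> = (\<integral>\<^sup>+ w. ennreal (f w) * indicator (Y s j -` A \<inter> space P) w \<partial>P)"
      by (rule emeasure_density) (use f v in auto)
    also have "\<dots> = (\<integral>\<^sup>+ w. ennreal (f w * indicator A (Y s j w)) \<partial>P)"
      by (intro nn_integral_cong) (auto simp: indicator_def)
    also have "\<dots> = ennreal (\<integral>w. f w * indicator A (Y s j w) \<partial>P)"
      by (rule nn_integral_eq_integral[OF bounded_times_integrable[OF f(1,3) intA]])
         (rule AE_I2, use f(2) in \<open>auto simp: indicator_def\<close>)
    finally show ?thesis .
  qed
  have "?\<nu> p = ?\<nu> q"
  proof (rule measure_eqI)
    fix A assume "A \<in> sets (?\<nu> p)"
    then have A: "A \<in> sets borel" by simp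
    show "emeasure (?\<nu> p) A = emeasure (?\<nu> q) A"
      using nuA[OF prv p0 p_le A] nuA[OF qrv q0 q_le A] eq[OF A] by simp
  qed simp
  then have "(\<integral>w. p w * Y s j w \<partial>P) = (\<integral>w. q w * Y s j w \<partial>P)"
    using nu[OF prv p0] nu[OF qrv q0] by simp
  then show ?thesis by (simp add: p_def q_def)
qed

lemma regression_identity:
  assumes s: "s \<in> {1..N}" and j: "j \<in> {1..J}"
    and h: "h \<in> borel_measurable covariate_space"
    and b: "AE w in P. \<bar>h (X s w)\<bar> \<le> c"
  shows "integrable P (\<lambda>w. h (X s w) * \<mu> (X s w) j)"
    and "(\<integral>w. h (X s w) * Y s j w \<partial>P) = (\<integral>w. h (X s w) * \<mu> (X s w) j \<partial>P)"
proof -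
  interpret F: sigma_finite_subalgebra P "sigma_unit P X s" by (rule covariate_subalgebra[OF s])
  have hrv: "(\<lambda>w. h (X s w)) \<in> borel_measurable P" by (rule covariate_function_rv[OF s h])
  have \<mu>rv: "(\<lambda>w. \<mu> (X s w) j) \<in> borel_measurable P" by (rule covariate_function_rv[OF s \<mu>_meas[OF j]])
  have int: "integrable P (\<lambda>w. h (X s w) * Y s j w)"
    by (rule bounded_times_integrable[OF hrv b Y_integrable[OF s j]])
  note ce = F.real_cond_exp_intg[OF int covariate_function_meas[OF s h] outcome_rv[OF s j]]
  have ae: "AE w in P. h (X s w) * real_cond_exp P (sigma_unit P X s) (Y s j) w = h (X s w) * \<mu> (X s w) j"
    using \<mu>_regression[OF s j] by eventually_elim simp
  have m1: "(\<lambda>w. h (X s w) * real_cond_exp P (sigma_unit P X s) (Y s j) w) \<in> borel_measurable P"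
    by (intro borel_measurable_times hrv borel_measurable_cond_exp2)
  have m2: "(\<lambda>w. h (X s w) * \<mu> (X s w) j) \<in> borel_measurable P"
    by (intro borel_measurable_times hrv \<mu>rv)
  show "integrable P (\<lambda>w. h (X s w) * \<mu> (X s w) j)"
    using ce(1) integrable_cong_AE[OF m1 m2 ae] by simp
  show "(\<integral>w. h (X s w) * Y s j w \<partial>P) = (\<integral>w. h (X s w) * \<mu> (X s w) j \<partial>P)"
    using ce(2) integral_cong_AE[OF m1 m2 ae] by simp
qed

lemma treated_outcome_identity:
  assumes s: "s \<in> {1..N}" and j: "j \<in> {1..J}"
    and h: "h \<in> borel_measurable covariate_space" and b: "\<And>\<xi>. \<xi> \<in> \<X> \<Longrightarrow> 0 \<le> h \<xi> \<and> h \<xi> \<le> c"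
  shows "integrable P (\<lambda>w. h (X s w) * e (X s w) j * \<mu> (X s w) j)"
    and "(\<integral>w. h (X s w) * of_bool (D s w = j) * Y s (D s w) w \<partial>P) = (\<integral>w. h (X s w) * e (X s w) j * \<mu> (X s w) j \<partial>P)"
proof -
  have he: "(\<lambda>\<xi>. h \<xi> * e \<xi> j) \<in> borel_measurable covariate_space"
    by (intro borel_measurable_times h e_meas[OF j])
  have "AE w in P. \<bar>h (X s w) * e (X s w) j\<bar> \<le> c"
    using propensity_le_1[OF s j] AE_space
  proof eventually_elim
    case (elim w)
    have "0 \<le> h (X s w)" "h (X s w) \<le> c" "0 \<le> e (X s w) j"
      using b[OF X_range[OF s elim(2)]] overlap[OF X_range[OF s elim(2)] j] \<eta>_pos by auto
    then show ?case using mult_mono[of "h (X s w)" c "e (X s w) j" 1] elim(1) by simp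
  qed
  note r = regression_identity[OF s j he this]
  show "integrable P (\<lambda>w. h (X s w) * e (X s w) j * \<mu> (X s w) j)" by (rule r(1))
  have "(\<integral>w. h (X s w) * of_bool (D s w = j) * Y s (D s w) w \<partial>P)
      = (\<integral>w. h (X s w) * of_bool (D s w = j) * Y s j w \<partial>P)"
    by (rule Bochner_Integration.integral_cong) auto
  also have "\<dots> = (\<integral>w. h (X s w) * e (X s w) j * Y s j w \<partial>P)"
    by (rule unconfounded_identity[OF s j h b])
  also have "\<dots> = (\<integral>w. h (X s w) * e (X s w) j * \<mu> (X s w) j \<partial>P)" by (rule r(2))
  finally show "(\<integral>w. h (X s w) * of_bool (D s w = j) * Y s (D s w) w \<partial>P)
      = (\<integral>w. h (X s w) * e (X s w) j * \<mu> (X s w) j \<partial>P)" .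
qed

text \<open>Only the observed outcome is assumed to lie in \<open>[0, M]\<close>.  By identification, the mean of
\<open>e * (\<mu> - k)\<close> over a set of covariates is the mean over its treated units of outcome minus \<open>k\<close>, which has a
sign for \<open>k = 0\<close> and \<open>k = M\<close>; as \<open>e\<close> is positive, \<open>\<mu>\<close> cannot violate the bounds on a set of positive
probability.\<close>

lemma regression_in_range:
  assumes s: "s \<in> {1..N}" and j: "j \<in> {1..J}"
  shows "AE w in P. \<mu> (X s w) j \<in> {0..M}"
proof -
  have epos: "e (X s w) j > 0" if "w \<in> space P" for w
    using overlap[OF X_range[OF s that] j] \<eta>_pos by simp
  have \<mu>_cov: "(\<lambda>\<xi>. \<mu> \<xi> j) \<in> borel_measurable covariate_space" by (rule \<mu>_meas[OF j])
  \<comment> \<open>\<open>h\<close> is the indicator of the set of covariates where the bound \<open>k\<close> is violated;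
      the sign \<open>\<epsilon>\<close> selects the lower or the upper bound\<close>
  have sgn_test: "AE w in P. \<not> (h (X s w) = 1 \<and> \<epsilon> * (\<mu> (X s w) j - k) < 0)"
    if h: "h \<in> borel_measurable covariate_space" "\<And>\<xi>. h \<xi> \<in> {0, 1}"
      and hk: "\<And>\<xi>. h \<xi> = 1 \<Longrightarrow> \<epsilon> * (\<mu> \<xi> j - k) \<le> 0"
      and Yk: "AE w in P. \<epsilon> * (Y s (D s w) w - k) \<ge> 0"
    for h :: "real ^ 'p \<Rightarrow> real" and \<epsilon> k :: real
  proof -
    have hb: "0 \<le> h \<xi> \<and> h \<xi> \<le> 1" for \<xi> using h(2)[of \<xi>] by auto
    have hrv: "(\<lambda>w. h (X s w)) \<in> borel_measurable P" by (rule covariate_function_rv[OF s h(1)])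
    note t = treated_outcome_identity[OF s j h(1), of 1, OF hb]
    have babs: "\<bar>h \<xi>\<bar> \<le> 1" for \<xi> using hb[of \<xi>] by simp
    note pr = propensity_identity[OF s j h(1) babs]
    have int_he: "integrable P (\<lambda>w. h (X s w) * e (X s w) j)"
    proof (rule integrable_const_bound[where B = 1])
      show "AE w in P. norm (h (X s w) * e (X s w) j) \<le> 1"
        using propensity_le_1[OF s j] AE_space
      proof eventually_elim
        case (elim w)
        then show ?case using hb[of "X s w"] epos[OF elim(2)] mult_mono[of "h (X s w)" 1 "e (X s w) j" 1] by simp
      qed
    qed (intro borel_measurable_times hrv covariate_function_rv[OF s e_meas[OF j]])
    have hd_le: "\<bar>h \<xi> * of_bool b\<bar> \<le> 1" for \<xi> b using hb[of \<xi>] by (cases b) auto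
    have hd_rv: "(\<lambda>w. h (X s w) * of_bool (D s w = j)) \<in> borel_measurable P"
      by (intro borel_measurable_times hrv treatment_indicator_rv[OF s])
    have int_hd: "integrable P (\<lambda>w. h (X s w) * of_bool (D s w = j))"
      by (rule integrable_const_bound[where B = 1, OF AE_I2 hd_rv]) (simp only: real_norm_def hd_le)
    have int_hdy: "integrable P (\<lambda>w. h (X s w) * of_bool (D s w = j) * Y s (D s w) w)"
    proof -
      have "integrable P (\<lambda>w. (h (X s w) * of_bool (D s w = j)) * Y s j w)"
        by (rule bounded_times_integrable[where c = 1, OF hd_rv AE_I2 Y_integrable[OF s j]]) (rule hd_le)
      moreover have "(\<lambda>w. (h (X s w) * of_bool (D s w = j)) * Y s j w) = (\<lambda>w. h (X s w) * of_bool (D s w = j) * Y s (D s w) w)"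
        by (auto simp: of_bool_def)
      ultimately show ?thesis by simp
    qed
    have "0 \<le> (\<integral>w. \<epsilon> * (h (X s w) * of_bool (D s w = j) * Y s (D s w) w - k * (h (X s w) * of_bool (D s w = j))) \<partial>P)"
    proof (rule integral_nonneg_AE)
      show "AE w in P. 0 \<le> \<epsilon> * (h (X s w) * of_bool (D s w = j) * Y s (D s w) w - k * (h (X s w) * of_bool (D s w = j)))"
        using Yk
      proof eventually_elim
        case (elim w)
        have "0 \<le> h (X s w) * of_bool (D s w = j)" using hb[of "X s w"] by simp
        from mult_nonneg_nonneg[OF this elim]
        have "0 \<le> (h (X s w) * of_bool (D s w = j)) * (\<epsilon> * (Y s (D s w) w - k))" .
        then show ?case by (simp add: algebra_simps)
      qed
    qed
    also have "\<dots> = \<epsilon> * ((\<integral>w. h (X s w) * e (X s w) j * \<mu> (X s w) j \<partial>P) - k * (\<integral>w. h (X s w) * e (X s w) j \<partial>P))"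
      using int_hd int_hdy t(2) pr by simp
    also have "\<dots> = - (\<integral>w. - (\<epsilon> * (h (X s w) * e (X s w) j * \<mu> (X s w) j - k * (h (X s w) * e (X s w) j))) \<partial>P)"
      using t(1) int_he by simp
    finally have le0: "(\<integral>w. - (\<epsilon> * (h (X s w) * e (X s w) j * \<mu> (X s w) j - k * (h (X s w) * e (X s w) j))) \<partial>P) \<le> 0"
      by simp
    let ?f = "\<lambda>w. - (\<epsilon> * (h (X s w) * e (X s w) j * \<mu> (X s w) j - k * (h (X s w) * e (X s w) j)))"
    have f_eq: "?f w = (h (X s w) * e (X s w) j) * (- (\<epsilon> * (\<mu> (X s w) j - k)))" for w
      by (simp add: algebra_simps)
    have f0: "0 \<le> ?f w" if w: "w \<in> space P" for w
    proof (cases "h (X s w) = 1")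
      case True
      show ?thesis unfolding f_eq using hk[OF True] True epos[OF w] by (intro mult_nonneg_nonneg) auto
    next
      case False
      then have "h (X s w) = 0" using h(2)[of "X s w"] by auto
      then show ?thesis by simp
    qed
    have AE0: "AE w in P. 0 \<le> ?f w" using f0 by (rule AE_I2)
    have intf: "integrable P ?f" using t(1) int_he by simp
    have "integral\<^sup>L P ?f = 0" using le0 integral_nonneg_AE[OF AE0] by linarith
    then have "AE w in P. ?f w = 0" using integral_nonneg_eq_0_iff_AE[OF intf AE0] by simp
    then show ?thesis using AE_space
    proof eventually_elim
      case (elim w)
      have "(h (X s w) * e (X s w) j) * (- (\<epsilon> * (\<mu> (X s w) j - k))) = 0"
        using elim(1) unfolding f_eq .
      then show ?case using epos[OF elim(2)] by auto
    qed
  qed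
  have low: "AE w in P. \<not> ((of_bool (\<mu> (X s w) j < 0) :: real) = 1 \<and> 1 * (\<mu> (X s w) j - 0) < 0)"
  proof (rule sgn_test)
    show "(\<lambda>\<xi>. of_bool (\<mu> \<xi> j < 0) :: real) \<in> borel_measurable covariate_space"
      using \<mu>_cov by measurable
    show "AE w in P. 1 * (Y s (D s w) w - 0) \<ge> 0" using Y_bounded[OF s] by eventually_elim simp
  qed (auto simp: of_bool_def split: if_splits)
  have high: "AE w in P. \<not> ((of_bool (\<mu> (X s w) j > M) :: real) = 1 \<and> -1 * (\<mu> (X s w) j - M) < 0)"
  proof (rule sgn_test)
    show "(\<lambda>\<xi>. of_bool (\<mu> \<xi> j > M) :: real) \<in> borel_measurable covariate_space"
      using \<mu>_cov by measurable
    show "AE w in P. -1 * (Y s (D s w) w - M) \<ge> 0" using Y_bounded[OF s] by eventually_elim simp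
  qed (auto simp: of_bool_def split: if_splits)
  show ?thesis using low high by eventually_elim (auto simp: of_bool_def split: if_splits)
qed

end

section \<open>Uniform deviation of the estimated policy values\<close>

context observational_study
begin

lemma clipped_regression_meas: "j \<in> {1..J} \<Longrightarrow> (\<lambda>\<xi>. clipped_regression \<xi> j) \<in> borel_measurable covariate_space"
  unfolding clipped_regression_def by (intro borel_measurable_max borel_measurable_min borel_measurable_const \<mu>_meas)

lemma clipped_regression_range: "clipped_regression \<xi> j \<in> {0..M}"
  using M_ge_1 by (auto simp: clipped_regression_def)

lemma clipped_regression_eq:
  assumes s: "s \<in> {1..N}" and j: "j \<in> {1..J}"
  shows "AE w in P. clipped_regression (X s w) j = \<mu> (X s w) j"
  using regression_in_range[OF s j] by eventually_elim (simp add: clipped_regression_def)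

lemma observed_simps [simp]:
  "fst (observed s w) = X s w" "fst (snd (observed s w)) = D s w" "snd (snd (observed s w)) = Y s (D s w) w"
  by (simp_all add: observed_def)

lemma integral_unit_distr:
  fixes f :: "(real ^ 'p) \<times> nat \<times> real \<Rightarrow> real"
  assumes "f \<in> borel_measurable observed_space"
  shows "(\<integral>z. f z \<partial>unit_distr) = (\<integral>w. f (observed 1 w) \<partial>P)"
  unfolding unit_distr_def by (rule integral_distr[OF observed_rv[OF one_mem] assms])

lemma unit_law_unit_distr:
  assumes \<mu>h_meas: "\<And>j. j \<in> {1..J} \<Longrightarrow> (\<lambda>\<xi>. \<mu>h \<xi> j) \<in> borel_measurable (restrict_space borel \<X>)"
    and \<mu>h_range: "\<And>\<xi> j. \<xi> \<in> \<X> \<Longrightarrow> j \<in> {1..J} \<Longrightarrow> \<mu>h \<xi> j \<in> {0..M}"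
  shows "unit_law unit_distr covariate_space J e clipped_regression \<mu>h \<eta> M"
proof -
  interpret Q: prob_space unit_distr
    unfolding unit_distr_def by (rule prob_space_distr[OF observed_rv[OF one_mem]])
  have rv: "observed 1 \<in> P \<rightarrow>\<^sub>M observed_space" by (rule observed_rv[OF one_mem])
  have x: "fst \<in> observed_space \<rightarrow>\<^sub>M covariate_space" unfolding observed_space_def by measurable
  have d: "(\<lambda>z. of_bool (fst (snd z) = j) :: real) \<in> borel_measurable observed_space" for j
  proof -
    have "(\<lambda>z. fst (snd z)) \<in> observed_space \<rightarrow>\<^sub>M count_space {1..J}" unfolding observed_space_def by measurable
    from measurable_compose[OF this, of "\<lambda>i. of_bool (i = j) :: real" borel] show ?thesis by simp
  qed
  have y: "(\<lambda>z. snd (snd z)) \<in> borel_measurable observed_space" unfolding observed_space_def by measurable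
  show ?thesis
  proof unfold_locales
    show "sets unit_distr = sets (covariate_space \<Otimes>\<^sub>M (count_space {1..J} \<Otimes>\<^sub>M borel))"
      by (simp only: unit_distr_def observed_space_def sets_distr)
    show "(\<lambda>\<xi>. e \<xi> j) \<in> borel_measurable covariate_space" if "j \<in> {1..J}" for j by (rule e_meas[OF that])
    show "(\<lambda>\<xi>. clipped_regression \<xi> j) \<in> borel_measurable covariate_space" if "j \<in> {1..J}" for j
      by (rule clipped_regression_meas[OF that])
    show "(\<lambda>\<xi>. \<mu>h \<xi> j) \<in> borel_measurable covariate_space" if "j \<in> {1..J}" for j
      unfolding covariate_space_def by (rule \<mu>h_meas[OF that])
    show "0 < \<eta>" by (rule \<eta>_pos)
    show "0 < M" using M_ge_1 by simp
    show "\<eta> \<le> e \<xi> j" if "\<xi> \<in> space covariate_space" "j \<in> {1..J}" for \<xi> j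
      using overlap that by (simp add: space_covariate)
    show "clipped_regression \<xi> j \<in> {0..M}" for \<xi> j by (rule clipped_regression_range)
    show "\<mu>h \<xi> j \<in> {0..M}" if "\<xi> \<in> space covariate_space" "j \<in> {1..J}" for \<xi> j
      using \<mu>h_range that by (simp add: space_covariate)
    have "{z \<in> space observed_space. snd (snd z) \<in> {0..M}} \<in> sets observed_space"
      using measurable_sets[OF y, of "{0..M}"] by (simp add: vimage_def Int_def conj_commute)
    then show "AE z in unit_distr. snd (snd z) \<in> {0..M}"
      unfolding unit_distr_def using Y_bounded[OF one_mem] by (subst AE_distr_iff[OF rv]) auto
    show "AE z in unit_distr. e (fst z) j \<le> 1" if j: "j \<in> {1..J}" for j
    proof -
      have "(\<lambda>z. e (fst z) j) \<in> borel_measurable observed_space" by (rule measurable_compose[OF x e_meas[OF j]])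
      then have "{z \<in> space observed_space. e (fst z) j \<le> 1} \<in> sets observed_space" by measurable
      then show ?thesis
        unfolding unit_distr_def using propensity_le_1[OF one_mem j] by (subst AE_distr_iff[OF rv]) auto
    qed
    fix j h c
    assume j: "j \<in> {1..J}" and h: "h \<in> borel_measurable covariate_space"
      and hc: "\<And>\<xi>. \<xi> \<in> space covariate_space \<Longrightarrow> h \<xi> \<in> {0..c :: real}"
    have hX: "(\<lambda>z. h (fst z)) \<in> borel_measurable observed_space" by (rule measurable_compose[OF x h])
    have eX: "(\<lambda>z. e (fst z) j) \<in> borel_measurable observed_space" by (rule measurable_compose[OF x e_meas[OF j]])
    have mX: "(\<lambda>z. clipped_regression (fst z) j) \<in> borel_measurable observed_space"
      by (rule measurable_compose[OF x clipped_regression_meas[OF j]])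
    have hb: "0 \<le> h \<xi> \<and> h \<xi> \<le> c" if "\<xi> \<in> \<X>" for \<xi> using hc that by (auto simp: space_covariate)
    have habs: "\<bar>h \<xi>\<bar> \<le> c" if "\<xi> \<in> \<X>" for \<xi> using hb[OF that] by simp
    show "(\<integral>z. h (fst z) * of_bool (fst (snd z) = j) \<partial>unit_distr) = (\<integral>z. h (fst z) * e (fst z) j \<partial>unit_distr)"
      using propensity_identity[OF one_mem j h habs]
      by (simp add: integral_unit_distr borel_measurable_times hX d eX)
    have "(\<integral>w. h (X 1 w) * e (X 1 w) j * \<mu> (X 1 w) j \<partial>P) = (\<integral>w. h (X 1 w) * e (X 1 w) j * clipped_regression (X 1 w) j \<partial>P)"
    proof (rule integral_cong_AE)
      show "AE w in P. h (X 1 w) * e (X 1 w) j * \<mu> (X 1 w) j = h (X 1 w) * e (X 1 w) j * clipped_regression (X 1 w) j"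
        using clipped_regression_eq[OF one_mem j] by eventually_elim simp
    qed (intro borel_measurable_times covariate_function_rv[OF one_mem h] covariate_function_rv[OF one_mem e_meas[OF j]]
        covariate_function_rv[OF one_mem \<mu>_meas[OF j]] covariate_function_rv[OF one_mem clipped_regression_meas[OF j]])+
    then show "(\<integral>z. h (fst z) * of_bool (fst (snd z) = j) * snd (snd z) \<partial>unit_distr)
        = (\<integral>z. h (fst z) * e (fst z) j * clipped_regression (fst z) j \<partial>unit_distr)"
      using treated_outcome_identity(2)[OF one_mem j h hb]
      by (simp add: integral_unit_distr borel_measurable_times hX d eX y mX)
  qed
qed

lemma linear_policy_meas:
  assumes "g \<in> linear_policies J"
  shows "g \<in> covariate_space \<rightarrow>\<^sub>M count_space {1..J}"
proof -
  have "g -` {j} \<inter> space covariate_space \<in> sets covariate_space" for j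
    using measurable_sets[OF measurable_restrict_space1[OF measurable_linear_policies[OF J_pos assms], of \<X>], of "{j}"]
    by (simp add: covariate_space_def)
  then show ?thesis
    using linear_policies_in_range[OF J_pos assms] by (subst measurable_count_space_eq2) auto
qed

text \<open>This connects the potential outcomes in the definition of the value with the law of the observed units.\<close>

lemma policy_value_eq:
  assumes g: "g \<in> linear_policies J"
  shows "policy_value P X Y g = (\<integral>z. clipped_regression (fst z) (g (fst z)) \<partial>unit_distr)"
proof -
  have gm: "g \<in> covariate_space \<rightarrow>\<^sub>M count_space {1..J}" by (rule linear_policy_meas[OF g])
  have ind: "(\<lambda>\<xi>. of_bool (g \<xi> = j) :: real) \<in> borel_measurable covariate_space" for j
    by (rule measurable_compose[OF gm]) simp
  have split: "f (g \<xi>) = (\<Sum>j\<in>{1..J}. of_bool (g \<xi> = j) * f j)" for f :: "nat \<Rightarrow> real" and \<xi>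
  proof -
    have "(\<Sum>j\<in>{1..J}. of_bool (g \<xi> = j) * f j) = (\<Sum>j\<in>{1..J}. if j = g \<xi> then f j else 0)"
      by (intro sum.cong) auto
    then show ?thesis using linear_policies_in_range[OF J_pos g, of \<xi>] by simp
  qed
  have ib: "AE w in P. \<bar>of_bool (g (X 1 w) = j) :: real\<bar> \<le> 1" for j by simp
  have intY: "integrable P (\<lambda>w. of_bool (g (X 1 w) = j) * Y 1 j w)" if "j \<in> {1..J}" for j
    by (rule bounded_times_integrable[OF covariate_function_rv[OF one_mem ind] ib Y_integrable[OF one_mem that]])
  have cm: "(\<lambda>w. of_bool (g (X 1 w) = j) * clipped_regression (X 1 w) j) \<in> borel_measurable P" if "j \<in> {1..J}" for j
    by (intro borel_measurable_times covariate_function_rv[OF one_mem ind]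
        covariate_function_rv[OF one_mem clipped_regression_meas[OF that]])
  have intm: "integrable P (\<lambda>w. of_bool (g (X 1 w) = j) * clipped_regression (X 1 w) j)" if "j \<in> {1..J}" for j
    by (rule integrable_const_bound[where B = M, OF AE_I2 cm[OF that]])
       (use clipped_regression_range M_ge_1 in \<open>auto simp: of_bool_def\<close>)
  have "policy_value P X Y g = (\<integral>w. (\<Sum>j\<in>{1..J}. of_bool (g (X 1 w) = j) * Y 1 j w) \<partial>P)"
    unfolding policy_value_def
    by (rule Bochner_Integration.integral_cong[OF refl]) (rule split)
  also have "\<dots> = (\<Sum>j\<in>{1..J}. \<integral>w. of_bool (g (X 1 w) = j) * Y 1 j w \<partial>P)"
    by (rule Bochner_Integration.integral_sum) (rule intY)
  also have "\<dots> = (\<Sum>j\<in>{1..J}. \<integral>w. of_bool (g (X 1 w) = j) * clipped_regression (X 1 w) j \<partial>P)"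
  proof (rule sum.cong[OF refl])
    fix j assume j: "j \<in> {1..J}"
    have "(\<integral>w. of_bool (g (X 1 w) = j) * Y 1 j w \<partial>P) = (\<integral>w. of_bool (g (X 1 w) = j) * \<mu> (X 1 w) j \<partial>P)"
      by (rule regression_identity(2)[OF one_mem j ind ib])
    also have "\<dots> = (\<integral>w. of_bool (g (X 1 w) = j) * clipped_regression (X 1 w) j \<partial>P)"
    proof (rule integral_cong_AE)
      show "AE w in P. of_bool (g (X 1 w) = j) * \<mu> (X 1 w) j = of_bool (g (X 1 w) = j) * clipped_regression (X 1 w) j"
        using clipped_regression_eq[OF one_mem j] by eventually_elim simp
    qed (intro cm[OF j] borel_measurable_times covariate_function_rv[OF one_mem ind]
        covariate_function_rv[OF one_mem \<mu>_meas[OF j]])+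
    finally show "(\<integral>w. of_bool (g (X 1 w) = j) * Y 1 j w \<partial>P)
      = (\<integral>w. of_bool (g (X 1 w) = j) * clipped_regression (X 1 w) j \<partial>P)" .
  qed
  also have "\<dots> = (\<integral>w. (\<Sum>j\<in>{1..J}. of_bool (g (X 1 w) = j) * clipped_regression (X 1 w) j) \<partial>P)"
    by (rule Bochner_Integration.integral_sum[symmetric]) (rule intm)
  also have "\<dots> = (\<integral>w. clipped_regression (X 1 w) (g (X 1 w)) \<partial>P)"
    by (rule Bochner_Integration.integral_cong[OF refl]) (rule split[symmetric])
  also have "\<dots> = (\<integral>z. clipped_regression (fst z) (g (fst z)) \<partial>unit_distr)"
  proof (subst integral_unit_distr)
    have "fst \<in> observed_space \<rightarrow>\<^sub>M covariate_space" unfolding observed_space_def by measurable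
    from measurable_compose[OF this measurable_compose_countable'[OF clipped_regression_meas gm]]
    show "(\<lambda>z. clipped_regression (fst z) (g (fst z))) \<in> borel_measurable observed_space" by simp
  qed simp
  finally show ?thesis .
qed

lemma policy_value_range:
  assumes g: "g \<in> linear_policies J"
  shows "policy_value P X Y g \<in> {0..M}"
proof -
  interpret Q: prob_space unit_distr
    unfolding unit_distr_def by (rule prob_space_distr[OF observed_rv[OF one_mem]])
  have b: "0 \<le> clipped_regression (fst z) (g (fst z))" "clipped_regression (fst z) (g (fst z)) \<le> M" for z
    using clipped_regression_range by auto
  have "(\<integral>z. clipped_regression (fst z) (g (fst z)) \<partial>unit_distr) \<le> (\<integral>z. M \<partial>unit_distr)"
    by (rule integral_mono') (use b M_ge_1 in auto)
  then show ?thesis unfolding policy_value_eq[OF g] using b by (auto simp: Q.prob_space)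
qed

text \<open>With \<open>K = (N * J^2) ^ (J * (p + 1))\<close> labelings, \<open>exp (- L / 2) = \<delta> / (16 * K)\<close>.  Hence the sampling event fails
with probability at most \<open>2 * K * exp (- L / 2) = \<delta> / 8\<close>.  The noise event fails with probability at most
\<open>2 * (N + 1)^2 * K * exp (- L)\<close>, which is at most \<open>\<delta> / 32\<close> because \<open>N^2 \<le> K\<close>.\<close>

lemma uniform_deviation:
  fixes \<mu>h :: "real ^ 'p \<Rightarrow> nat \<Rightarrow> real"
  assumes \<mu>h_meas: "\<And>j. j \<in> {1..J} \<Longrightarrow> (\<lambda>\<xi>. \<mu>h \<xi> j) \<in> borel_measurable (restrict_space borel \<X>)"
    and \<mu>h_range: "\<And>\<xi> j. \<xi> \<in> \<X> \<Longrightarrow> j \<in> {1..J} \<Longrightarrow> \<mu>h \<xi> j \<in> {0..M}"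
    and \<delta>: "0 < \<delta>" "\<delta> \<le> 1"
  defines "L \<equiv> 2 * real J * (real CARD('p) + 1) * ln (real N * (real J)\<^sup>2) + 2 * ln (16 / \<delta>)"
  shows "\<exists>A\<in>events. prob A \<ge> 1 - \<delta> \<and> (\<forall>w\<in>A. \<forall>g\<in>linear_policies J. \<forall>\<tau>o \<tau>h \<tau>t.
    threshold_minimizer \<eta> N e (\<lambda>s. X s w) g (ocdr_objective N e (\<lambda>s. X s w) (\<lambda>s. D s w) g) \<tau>o \<longrightarrow>
    threshold_minimizer \<eta> N e (\<lambda>s. X s w) g (B_hat M N e (\<lambda>s. X s w) (\<lambda>s. D s w) g) \<tau>h \<longrightarrow>
    threshold_minimizer \<eta> N e (\<lambda>s. X s w) g (B_tilde M N e (\<lambda>s. X s w) g) \<tau>t \<longrightarrow>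
    \<bar>clipped_dr_value N e \<mu>h (\<lambda>s. X s w) (\<lambda>s. D s w) (\<lambda>s. Y s (D s w) w) g \<tau>o - policy_value P X Y g\<bar>
    \<le> 12 * sqrt L * max (sqrt (B_hat M N e (\<lambda>s. X s w) (\<lambda>s. D s w) g \<tau>h))
                        (sqrt (B_tilde M N e (\<lambda>s. X s w) g \<tau>t)))"
proof -
  interpret U: unit_law unit_distr covariate_space J e clipped_regression \<mu>h \<eta> M
    by (rule unit_law_unit_distr[OF \<mu>h_meas \<mu>h_range])
  have M: "M > 0" using M_ge_1 by simp
  obtain G :: "(real ^ 'p \<Rightarrow> nat) set" where G: "countable G" "G \<subseteq> linear_policies J"
    and sep: "\<And>g. g \<in> linear_policies J \<Longrightarrow>
      \<exists>h. (\<forall>n. h n \<in> G) \<and> (\<forall>\<xi>. eventually (\<lambda>n. h n \<xi> = g \<xi>) sequentially)"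
    using linear_policies_separable[OF J_pos] by blast
  have Gm: "g \<in> covariate_space \<rightarrow>\<^sub>M count_space {1..J}" if "g \<in> G" for g
    using linear_policy_meas that G(2) by blast
  define dim where "dim = J * (CARD('p) + 1)"
  define K where "K = (N * J\<^sup>2) ^ dim"
  have growth: "finite ((\<lambda>g. \<lambda>s\<in>I. g (x s)) ` G) \<and> card ((\<lambda>g. \<lambda>s\<in>I. g (x s)) ` G) \<le> K"
    if I: "finite I" "card I \<le> 2 * N" for I :: "nat set" and x
  proof -
    have fin: "finite ((\<lambda>g. \<lambda>s\<in>I. g (x s)) ` linear_policies J)" by (rule card_linear_labelings(1)[OF J_pos I(1)])
    have sub: "(\<lambda>g. \<lambda>s\<in>I. g (x s)) ` G \<subseteq> (\<lambda>g. \<lambda>s\<in>I. g (x s)) ` linear_policies J" using G(2) by (rule image_mono)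
    show ?thesis
      using finite_subset[OF sub fin] card_mono[OF fin sub] card_linear_labelings_le[OF J_pos N_pos I, of x]
      unfolding K_def dim_def by linarith
  qed
  have NJ: "real N * (real J)\<^sup>2 \<ge> 1"
  proof -
    have "1 \<le> N * J\<^sup>2" using N_pos J_pos by (simp add: Suc_le_eq)
    then have "real 1 \<le> real (N * J\<^sup>2)" by (rule of_nat_mono)
    then show ?thesis by simp
  qed
  have K_real: "real K = (real N * (real J)\<^sup>2) ^ dim" by (simp add: K_def)
  have K1: "real K \<ge> 1" unfolding K_real using NJ by (rule one_le_power)
  have NK: "(real N)\<^sup>2 \<le> real K"
  proof -
    have J1: "1 \<le> (real J)\<^sup>2" using J_pos by (intro one_le_power) simp
    have "real N * 1 \<le> real N * (real J)\<^sup>2" using J1 by (intro mult_left_mono) auto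
    then have "(real N)\<^sup>2 \<le> (real N * (real J)\<^sup>2)\<^sup>2" by (intro power_mono) auto
    also have "\<dots> \<le> (real N * (real J)\<^sup>2) ^ dim"
    proof (rule power_increasing[OF _ NJ])
      have "1 * 2 \<le> J * (CARD('p) + 1)" using J_pos by (intro mult_mono) (auto simp: Suc_le_eq)
      then show "2 \<le> dim" by (simp add: dim_def)
    qed
    finally show ?thesis unfolding K_real .
  qed
  have lnK: "ln (real K) \<ge> 0" using K1 by simp
  have L_eq: "L = 2 * (ln (real K) + ln (16 / \<delta>))"
  proof -
    have "ln (real K) = real dim * ln (real N * (real J)\<^sup>2)"
      unfolding K_real by (rule ln_realpow)
    then show ?thesis by (simp add: L_def dim_def algebra_simps)
  qed
  have expL2: "exp (- (L / 2)) = \<delta> / (16 * real K)"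
  proof -
    have "exp (ln (real K) + ln (16 / \<delta>)) = real K * (16 / \<delta>)"
      using K1 \<delta> by (simp only: exp_add exp_ln) simp
    moreover have "- (L / 2) = - (ln (real K) + ln (16 / \<delta>))" unfolding L_eq by (simp add: field_simps)
    ultimately show ?thesis by (simp only: exp_minus) (simp add: field_simps)
  qed
  have expL: "exp (- L) = (\<delta> / (16 * real K))\<^sup>2"
  proof -
    have "exp (- L) = exp (- (L / 2)) * exp (- (L / 2))" by (simp add: exp_add[symmetric])
    then show ?thesis unfolding expL2 by (simp add: power2_eq_square)
  qed
  have L1: "L \<ge> 1"
  proof -
    have "exp 1 \<le> 16 / \<delta>"
    proof -
      have "exp 1 \<le> (3::real)" by (rule exp_le)
      also have "\<dots> \<le> 16 / \<delta>" using \<delta> by (simp add: field_simps)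
      finally show ?thesis .
    qed
    then have "1 \<le> ln (16 / \<delta>)" using \<delta> by (simp add: ln_ge_iff)
    then have "2 * 1 \<le> 2 * (ln (real K) + ln (16 / \<delta>))"
      by (intro mult_left_mono add_increasing lnK) auto
    then show ?thesis unfolding L_eq by simp
  qed
  define t where "t = M * sqrt (real N * L)"
  have t: "t > 0" using M N_pos L1 by (simp add: t_def)
  have t_exp: "t\<^sup>2 / (2 * real N * M\<^sup>2) = L / 2"
    using M N_pos L1 by (simp add: t_def power_mult_distrib)
  define l where "l k = sqrt (L / (2 * (real N * 4 ^ k))) / M" for k
  have l: "l k > 0" for k unfolding l_def using L1 M N_pos by simp
  let ?P = "PiM {1..N} (\<lambda>_. unit_distr)"
  obtain A1 where A1: "A1 \<in> sets ?P" "measure ?P A1 \<ge> 1 - 2 * (real K * exp (- (L / 2)))"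
    and sampling: "\<And>\<omega> g. \<omega> \<in> A1 \<Longrightarrow> g \<in> G \<Longrightarrow> \<bar>\<Sum>s=1..N. clipped_regression (fst (\<omega> s)) (g (fst (\<omega> s)))
        - (\<integral>z. clipped_regression (fst z) (g (fst z)) \<partial>unit_distr)\<bar> \<le> t"
    using U.sampling_event[OF G(1) Gm growth N_pos t] unfolding t_exp by auto
  obtain A2 where A2: "A2 \<in> sets ?P"
      "measure ?P A2 \<ge> 1 - real (2 * card (l ` {..N}) * (K * (N + 1))) * exp (- L)"
    and noise: "\<And>\<omega> g \<tau> k \<epsilon>. \<omega> \<in> A2 \<Longrightarrow> g \<in> G \<Longrightarrow>
      \<tau> \<in> insert 0 ((\<lambda>s. 1 / e (fst (\<omega> s)) (g (fst (\<omega> s)))) ` {1..N}) \<Longrightarrow> k \<le> N \<Longrightarrow> \<epsilon> \<in> {1, -1} \<Longrightarrow>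
      (\<Sum>s | s \<in> {1..N} \<and> 1 / e (fst (\<omega> s)) (g (fst (\<omega> s))) \<le> \<tau>.
          U.log_weight \<epsilon> (l k) (g (fst (\<omega> s))) (\<omega> s)) \<le> L"
  proof -
    have \<Lambda>: "finite (l ` {..N})" "\<And>r. r \<in> l ` {..N} \<Longrightarrow> r > 0" using l by auto
    have gN: "finite ((\<lambda>g. \<lambda>s\<in>{1..N}. g (x s)) ` G) \<and> card ((\<lambda>g. \<lambda>s\<in>{1..N}. g (x s)) ` G) \<le> K" for x
      by (rule growth) auto
    from U.noise_event[OF G(1) Gm gN \<Lambda>, of L] show ?thesis using that by fastforce
  qed
  define B1 where "B1 = {w \<in> space P. (\<lambda>s\<in>{1..N}. observed s w) \<in> A1}"
  define B2 where "B2 = {w \<in> space P. (\<lambda>s\<in>{1..N}. observed s w) \<in> A2}"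
  define B3 where "B3 = {w \<in> space P. \<forall>s\<in>{1..N}. \<forall>j\<in>{1..J}. e (X s w) j \<le> 1}"
  have B1: "B1 \<in> events" "prob B1 \<ge> 1 - \<delta> / 2"
  proof -
    have "2 * (real K * exp (- (L / 2))) = \<delta> / 8" unfolding expL2 using K1 by simp
    then show "B1 \<in> events" "prob B1 \<ge> 1 - \<delta> / 2"
      using sample_event_prob[OF A1(1)] A1(2) \<delta> by (auto simp: B1_def)
  qed
  have B2: "B2 \<in> events" "prob B2 \<ge> 1 - \<delta> / 2"
  proof -
    have c: "real (card (l ` {..N})) \<le> real N + 1"
      using card_image_le[of "{..N}" l] by simp
    have N2: "real N + 1 \<le> 2 * real N" using N_pos by simp
    have "real (2 * card (l ` {..N}) * (K * (N + 1))) = 2 * (real (card (l ` {..N})) * (real N + 1)) * real K"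
      by (simp add: algebra_simps)
    also have "\<dots> \<le> 2 * ((2 * real N) * (2 * real N)) * real K"
      using c N2 by (intro mult_right_mono mult_left_mono mult_mono) auto
    also have "\<dots> = 8 * (real N)\<^sup>2 * real K" by (simp add: power2_eq_square)
    also have "\<dots> \<le> 8 * real K * real K" using NK by (intro mult_right_mono mult_left_mono) auto
    finally have "real (2 * card (l ` {..N}) * (K * (N + 1))) * exp (- L) \<le> 8 * real K * real K * exp (- L)"
      by (intro mult_right_mono) auto
    also have "\<dots> = \<delta>\<^sup>2 / 32" unfolding expL using K1 by (simp add: power2_eq_square)
    also have "\<dots> \<le> \<delta> / 2" using \<delta> by (simp add: power2_eq_square mult_left_le)
    finally show "B2 \<in> events" "prob B2 \<ge> 1 - \<delta> / 2"
      using sample_event_prob[OF A2(1)] A2(2) by (auto simp: B2_def)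
  qed
  have B3: "B3 \<in> events" "prob B3 = 1"
  proof -
    have le: "{w \<in> space P. e (X s w) j \<le> 1} \<in> events" if "s \<in> {1..N}" "j \<in> {1..J}" for s j
      by (rule borel_measurable_le[OF covariate_function_rv[OF that(1) e_meas[OF that(2)]]]) simp
    show ev: "B3 \<in> events" unfolding B3_def
      by (intro sets.sets_Collect_finite_All' sets.sets_Collect_finite_All le) auto
    have "AE w in P. \<forall>s\<in>{1..N}. \<forall>j\<in>{1..J}. e (X s w) j \<le> 1"
      by (intro AE_finite_allI finite_atLeastAtMost propensity_le_1)
    then have "AE w in P. w \<in> B3" using AE_space by eventually_elim (auto simp: B3_def)
    then show "prob B3 = 1" using prob_eq_1[OF ev] by simp
  qed
  have B: "B1 \<inter> B2 \<inter> B3 \<in> events" "prob (B1 \<inter> B2 \<inter> B3) \<ge> 1 - \<delta>"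
    using B1 B2 B3 prob_Int_ge[of B1 B2] prob_Int_ge[of "B1 \<inter> B2" B3] by auto
  have "\<bar>clipped_dr_value N e \<mu>h (\<lambda>s. X s w) (\<lambda>s. D s w) (\<lambda>s. Y s (D s w) w) g \<tau>o - policy_value P X Y g\<bar>
    \<le> 12 * sqrt L * max (sqrt (B_hat M N e (\<lambda>s. X s w) (\<lambda>s. D s w) g \<tau>h))
                        (sqrt (B_tilde M N e (\<lambda>s. X s w) g \<tau>t))"
    if w: "w \<in> B1 \<inter> B2 \<inter> B3" and g: "g \<in> linear_policies J"
      and \<tau>o: "threshold_minimizer \<eta> N e (\<lambda>s. X s w) g (ocdr_objective N e (\<lambda>s. X s w) (\<lambda>s. D s w) g) \<tau>o"
      and \<tau>h: "threshold_minimizer \<eta> N e (\<lambda>s. X s w) g (B_hat M N e (\<lambda>s. X s w) (\<lambda>s. D s w) g) \<tau>h"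
      and \<tau>t: "threshold_minimizer \<eta> N e (\<lambda>s. X s w) g (B_tilde M N e (\<lambda>s. X s w) g) \<tau>t"
    for w g \<tau>o \<tau>h \<tau>t
  proof (rule clipped_dr_error_le[OF N_pos M \<eta>_pos L1 _ _ _ \<tau>o \<tau>h \<tau>t])
    have wP: "w \<in> space P" using w by (simp add: B1_def)
    let ?\<omega> = "\<lambda>s\<in>{1..N}. observed s w"
    have \<omega>: "?\<omega> \<in> A1" "?\<omega> \<in> A2" using w by (auto simp: B1_def B2_def)
    have gX: "g (X s w) \<in> {1..J}" for s by (rule linear_policies_in_range[OF J_pos g])
    show "e (X s w) (g (X s w)) > 0 \<and> e (X s w) (g (X s w)) \<le> 1" if "s \<in> {1..N}" for s
    proof -
      have "e (X s w) (g (X s w)) \<ge> \<eta>" by (rule overlap[OF X_range[OF that wP] gX])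
      moreover have "e (X s w) (g (X s w)) \<le> 1" using w that gX[of s] unfolding B3_def by blast
      ultimately show ?thesis using \<eta>_pos by linarith
    qed
    show "clipped_regression (X s w) (g (X s w)) \<in> {0..M}" for s by (rule clipped_regression_range)
    show "\<mu>h (X s w) (g (X s w)) \<in> {0..M}" if "s \<in> {1..N}" for s
      by (rule \<mu>h_range[OF X_range[OF that wP] gX])
    from sep[OF g] obtain h where hG: "\<And>n. h n \<in> G"
      and h: "\<And>\<xi>. eventually (\<lambda>n. h n \<xi> = g \<xi>) sequentially" by blast
    \<comment> \<open>finitely many sample points: one member of the countable class labels them all like \<open>g\<close>\<close>
    have agree: "eventually (\<lambda>n. \<forall>s\<in>{1..N}. h n (X s w) = g (X s w)) sequentially"
      by (intro eventually_ball_finite ballI h) simp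
    show "\<bar>(\<Sum>s=1..N. clipped_regression (X s w) (g (X s w))) - real N * policy_value P X Y g\<bar> \<le> M * sqrt (real N * L)"
    proof -
      define v where "v k = (\<integral>z. clipped_regression (fst z) (k (fst z)) \<partial>unit_distr)" for k
      have meas: "(\<lambda>z. clipped_regression (fst z) (k (fst z))) \<in> borel_measurable unit_distr"
        if "k \<in> covariate_space \<rightarrow>\<^sub>M count_space {1..J}" for k
        by (rule measurable_compose[OF U.fst_meas U.treatment_dependent_meas[OF that U.m_meas]])
      have lim: "(\<lambda>n. v (h n)) \<longlonglongrightarrow> v g"
        unfolding v_def
      proof (rule integral_dominated_convergence[where w = "\<lambda>_. M"])
        show "AE z in unit_distr. (\<lambda>n. clipped_regression (fst z) (h n (fst z))) \<longlonglongrightarrow> clipped_regression (fst z) (g (fst z))"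
        proof (rule AE_I2)
          fix z :: "(real ^ 'p) \<times> nat \<times> real"
          show "(\<lambda>n. clipped_regression (fst z) (h n (fst z))) \<longlonglongrightarrow> clipped_regression (fst z) (g (fst z))"
            by (rule tendsto_eventually) (use h[of "fst z"] in eventually_elim, simp)
        qed
        show "AE z in unit_distr. norm (clipped_regression (fst z) (h n (fst z))) \<le> M" for n
          using clipped_regression_range by (intro AE_I2) auto
      qed (use meas linear_policy_meas[OF g] Gm[OF hG] in auto)
      have "eventually (\<lambda>n. \<bar>(\<Sum>s=1..N. clipped_regression (X s w) (g (X s w))) - real N * v (h n)\<bar> \<le> t) sequentially"
        using agree
      proof eventually_elim
        case (elim n)
        have "(\<Sum>s=1..N. clipped_regression (fst (?\<omega> s)) (h n (fst (?\<omega> s))) - v (h n))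
            = (\<Sum>s=1..N. clipped_regression (X s w) (g (X s w)) - v (h n))"
          using elim by (intro sum.cong) auto
        also have "\<dots> = (\<Sum>s=1..N. clipped_regression (X s w) (g (X s w))) - real N * v (h n)"
          by (simp add: sum_subtractf)
        finally show ?case using sampling[OF \<omega>(1) hG[of n]] unfolding v_def by simp
      qed
      moreover have "(\<lambda>n. \<bar>(\<Sum>s=1..N. clipped_regression (X s w) (g (X s w))) - real N * v (h n)\<bar>)
          \<longlonglongrightarrow> \<bar>(\<Sum>s=1..N. clipped_regression (X s w) (g (X s w))) - real N * v g\<bar>"
        by (intro tendsto_intros lim)
      ultimately have "\<bar>(\<Sum>s=1..N. clipped_regression (X s w) (g (X s w))) - real N * v g\<bar> \<le> t"
        by (intro tendsto_upperbound[OF _ _ trivial_limit_sequentially])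
      then show ?thesis unfolding v_def policy_value_eq[OF g] t_def .
    qed
    fix k and \<epsilon> :: real assume k: "k \<le> N" and \<epsilon>: "\<epsilon> \<in> {1, -1}"
    obtain n where n: "\<forall>s\<in>{1..N}. h n (X s w) = g (X s w)"
      using eventually_happens'[OF sequentially_bot agree] by blast
    have \<omega>s: "?\<omega> s = observed s w" if "s \<in> {1..N}" for s using that by simp
    have "(\<lambda>s. 1 / e (fst (?\<omega> s)) (h n (fst (?\<omega> s)))) ` {1..N} = (\<lambda>s. 1 / e (X s w) (g (X s w))) ` {1..N}"
      using n by (intro image_cong) auto
    then have "\<tau>o \<in> insert 0 ((\<lambda>s. 1 / e (fst (?\<omega> s)) (h n (fst (?\<omega> s)))) ` {1..N})"
      using \<tau>o unfolding threshold_minimizer_def by simp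
    from noise[OF \<omega>(2) hG this k \<epsilon>]
    have "(\<Sum>s | s \<in> {1..N} \<and> 1 / e (fst (?\<omega> s)) (h n (fst (?\<omega> s))) \<le> \<tau>o.
          U.log_weight \<epsilon> (l k) (h n (fst (?\<omega> s))) (?\<omega> s)) \<le> L" .
    also have "(\<Sum>s | s \<in> {1..N} \<and> 1 / e (fst (?\<omega> s)) (h n (fst (?\<omega> s))) \<le> \<tau>o.
          U.log_weight \<epsilon> (l k) (h n (fst (?\<omega> s))) (?\<omega> s))
        = (\<Sum>s | s \<in> {1..N} \<and> 1 / e (X s w) (g (X s w)) \<le> \<tau>o. U.log_weight \<epsilon> (l k) (g (X s w)) (observed s w))"
      using n by (intro sum.cong) auto
    finally show "(\<Sum>s | s \<in> {1..N} \<and> 1 / e (X s w) (g (X s w)) \<le> \<tau>o.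
         \<epsilon> * (sqrt (L / (2 * (real N * 4 ^ k))) / M)
           * (of_bool (D s w = g (X s w)) / e (X s w) (g (X s w)) * (Y s (D s w) w - \<mu>h (X s w) (g (X s w)))
              - (clipped_regression (X s w) (g (X s w)) - \<mu>h (X s w) (g (X s w))))
         - (sqrt (L / (2 * (real N * 4 ^ k))) / M)\<^sup>2 * M\<^sup>2 * (of_bool (D s w = g (X s w)) / (e (X s w) (g (X s w)))\<^sup>2)
         - min ((sqrt (L / (2 * (real N * 4 ^ k))) / M)\<^sup>2 * M\<^sup>2 / e (X s w) (g (X s w)))
               (2 * (sqrt (L / (2 * (real N * 4 ^ k))) / M) * M)) \<le> L"
      unfolding U.log_weight_def observed_simps l_def .
  qed
  then show ?thesis using B by (intro bexI[of _ "B1 \<inter> B2 \<inter> B3"] conjI) blast+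
qed

end

section \<open>Suboptimality of the learned policy\<close>

theorem theorem1:
  fixes P :: "'w measure"
    and N J :: nat
    and \<X> :: "(real ^ 'p) set"
    and X :: "nat \<Rightarrow> 'w \<Rightarrow> real ^ 'p"
    and D :: "nat \<Rightarrow> 'w \<Rightarrow> nat"
    and Y :: "nat \<Rightarrow> nat \<Rightarrow> 'w \<Rightarrow> real"
    and e \<mu> \<mu>h :: "real ^ 'p \<Rightarrow> nat \<Rightarrow> real"
    and b :: "nat \<Rightarrow> real"
    and \<eta> M \<omega> \<delta> \<sigma> \<upsilon> :: real
    and \<tau>_ocdr \<tau>_hat \<tau>_tilde :: "'w \<Rightarrow> (real ^ 'p \<Rightarrow> nat) \<Rightarrow> real"
    and Bhat Btilde :: "'w \<Rightarrow> (real ^ 'p \<Rightarrow> nat) \<Rightarrow> real \<Rightarrow> real"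
    and \<Psi>_hat :: "'w \<Rightarrow> (real ^ 'p \<Rightarrow> nat) \<Rightarrow> real"
    and \<Psi> :: "(real ^ 'p \<Rightarrow> nat) \<Rightarrow> real"
    and g_hat g_dag :: "'w \<Rightarrow> real ^ 'p \<Rightarrow> nat"
    and g_star :: "real ^ 'p \<Rightarrow> nat"
    and S :: "'w \<Rightarrow> real set"
    and u :: "'w \<Rightarrow> real \<Rightarrow> real"
    and Z :: "real \<Rightarrow> 'w \<Rightarrow> real"
  assumes model: "observational_study P N J \<X> X D Y e \<mu> \<eta> M"
    and \<mu>h_measurable: "\<And>j. j \<in> {1..J} \<Longrightarrow> (\<lambda>\<xi>. \<mu>h \<xi> j) \<in> borel_measurable (restrict_space borel \<X>)"
    and \<mu>h_range: "\<And>\<xi> j. \<xi> \<in> \<X> \<Longrightarrow> j \<in> {1..J} \<Longrightarrow> \<mu>h \<xi> j \<in> {0..M}"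
    and no_integer: "AE w in P. \<forall>g \<in> LPC J b. no_integer_subsum N e (\<lambda>s. X s w) g"
    and Bhat: "\<And>w g \<tau>. Bhat w g \<tau> = B_hat M N e (\<lambda>s. X s w) (\<lambda>s. D s w) g \<tau>"
    and Btilde: "\<And>w g \<tau>. Btilde w g \<tau> = B_tilde M N e (\<lambda>s. X s w) g \<tau>"
    and \<tau>_hat: "\<And>w g. w \<in> space P \<Longrightarrow> g \<in> LPC J b \<Longrightarrow>
        threshold_minimizer \<eta> N e (\<lambda>s. X s w) g (Bhat w g) (\<tau>_hat w g)"
    and \<tau>_tilde: "\<And>w g. w \<in> space P \<Longrightarrow> g \<in> LPC J b \<Longrightarrow>
        threshold_minimizer \<eta> N e (\<lambda>s. X s w) g (Btilde w g) (\<tau>_tilde w g)"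
    and \<tau>_ocdr: "\<And>w g. w \<in> space P \<Longrightarrow> g \<in> LPC J b \<Longrightarrow>
        threshold_minimizer \<eta> N e (\<lambda>s. X s w) g
          (ocdr_objective N e (\<lambda>s. X s w) (\<lambda>s. D s w) g) (\<tau>_ocdr w g)"
    and \<Psi>_hat: "\<And>w g. \<Psi>_hat w g =
        clipped_dr_value N e \<mu>h (\<lambda>s. X s w) (\<lambda>s. D s w) (\<lambda>s. Y s (D s w) w) g (\<tau>_ocdr w g)"
    and \<Psi>: "\<And>g. \<Psi> g = policy_value P X Y g"
    and g_hat: "\<And>w. w \<in> space P \<Longrightarrow> is_arg_max (\<Psi>_hat w) (\<lambda>g. g \<in> LPC J b) (g_hat w)"
    and g_dag: "\<And>w. w \<in> space P \<Longrightarrow>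
        is_arg_max (\<lambda>g. \<bar>\<Psi>_hat w g - \<Psi> g\<bar>) (\<lambda>g. g \<in> LPC J b) (g_dag w)"
    and g_star: "is_arg_max \<Psi> (\<lambda>g. g \<in> LPC J b) g_star"
    and \<omega>_pos: "\<omega> > 0"
    and \<delta>_range: "0 < \<delta>" "\<delta> \<le> 1"
    and S: "\<And>w. S w = {\<tau> \<in> {0..1/\<eta>}.
        Btilde w (g_dag w) \<tau> \<le> Btilde w (g_dag w) (\<tau>_tilde w (g_dag w)) + \<omega>}"
    and u: "\<And>w \<tau>. w \<in> space P \<Longrightarrow> \<tau> \<in> {0..1/\<eta>} - S w \<Longrightarrow>
        u w \<tau> \<in> S w \<and> Btilde w (g_dag w) (u w \<tau>) \<le> Btilde w (g_dag w) \<tau> - \<omega>"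
    and Z: "\<And>\<tau> w. Z \<tau> w = (if \<tau> \<in> {0..1/\<eta>} - S w
        then Bhat w (g_dag w) (u w \<tau>) - Bhat w (g_dag w) \<tau> else 0)"
    and \<sigma>_pos: "\<sigma> > 0"
    and sub_gaussian: "\<And>\<tau>. \<tau> \<in> {0..1/\<eta>} \<Longrightarrow>
        cond_sub_gaussian_on P (sigma_covariates P N X) {w \<in> space P. \<tau> \<notin> S w} \<sigma> (Z \<tau>)"
    and sample_size: "real N \<ge> 2 * \<sigma>\<^sup>2 / \<omega> * ln (2 * real N / \<delta>)"
    and \<upsilon>: "\<upsilon> \<ge> 12 * M * sqrt (2 * real J * (real CARD('p) + 1) * ln (real N * (real J)\<^sup>2)
                                + 2 * ln (16 / \<delta>))"
  shows "\<exists>A \<in> sets P. measure P A \<ge> 1 - \<delta> \<and> (\<forall>w \<in> A.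
      \<Psi> g_star - \<Psi> (g_hat w)
      \<le> min (2 * \<upsilon> * Max {sqrt (Bhat w (g_dag w) (\<tau>_hat w (g_dag w))),
                            sqrt (Btilde w (g_dag w) (\<tau>_tilde w (g_dag w))) + sqrt \<omega>,
                            sqrt (Delta M N (\<tau>_hat w (g_dag w)))})
             M)"
proof -
  interpret O: observational_study P N J \<X> X D Y e \<mu> \<eta> M by (rule model)
  define L where "L = 2 * real J * (real CARD('p) + 1) * ln (real N * (real J)\<^sup>2) + 2 * ln (16 / \<delta>)"
  have LPC: "g \<in> linear_policies J" if "g \<in> LPC J b" for g
    using that by (auto simp: linear_policies_def)
  define R where "R w \<longleftrightarrow> (\<forall>g\<in>linear_policies J. \<forall>\<tau>o \<tau>h \<tau>t.
      threshold_minimizer \<eta> N e (\<lambda>s. X s w) g (ocdr_objective N e (\<lambda>s. X s w) (\<lambda>s. D s w) g) \<tau>o \<longrightarrow>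
      threshold_minimizer \<eta> N e (\<lambda>s. X s w) g (B_hat M N e (\<lambda>s. X s w) (\<lambda>s. D s w) g) \<tau>h \<longrightarrow>
      threshold_minimizer \<eta> N e (\<lambda>s. X s w) g (B_tilde M N e (\<lambda>s. X s w) g) \<tau>t \<longrightarrow>
      \<bar>clipped_dr_value N e \<mu>h (\<lambda>s. X s w) (\<lambda>s. D s w) (\<lambda>s. Y s (D s w) w) g \<tau>o - policy_value P X Y g\<bar>
      \<le> 12 * sqrt L * max (sqrt (B_hat M N e (\<lambda>s. X s w) (\<lambda>s. D s w) g \<tau>h))
                          (sqrt (B_tilde M N e (\<lambda>s. X s w) g \<tau>t)))" for w
  have "\<exists>A\<in>sets P. measure P A \<ge> 1 - \<delta> \<and> (\<forall>w\<in>A. R w)"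
    unfolding R_def L_def by (rule O.uniform_deviation) (fact \<mu>h_measurable \<mu>h_range \<delta>_range)+
  then obtain A where A: "A \<in> sets P" "measure P A \<ge> 1 - \<delta>" and dev: "\<And>w. w \<in> A \<Longrightarrow> R w"
    by blast
  have L0: "L \<ge> 0"
  proof -
    have "1 \<le> N * J\<^sup>2" using O.N_pos O.J_pos by (simp add: Suc_le_eq)
    then have "real 1 \<le> real (N * J\<^sup>2)" by (rule of_nat_mono)
    then have "1 \<le> real N * (real J)\<^sup>2" by simp
    moreover have "1 \<le> 16 / \<delta>" using \<delta>_range by simp
    ultimately show ?thesis
      unfolding L_def by (intro add_nonneg_nonneg mult_nonneg_nonneg ln_ge_zero) auto
  qed
  have \<upsilon>L: "\<upsilon> \<ge> 12 * sqrt L"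
  proof -
    have "12 * (1 * sqrt L) \<le> 12 * (M * sqrt L)"
      using O.M_ge_1 L0 by (intro mult_left_mono mult_right_mono) auto
    then show ?thesis using \<upsilon> unfolding L_def by simp
  qed
  have "\<Psi> g_star - \<Psi> (g_hat w)
      \<le> min (2 * \<upsilon> * Max {sqrt (Bhat w (g_dag w) (\<tau>_hat w (g_dag w))),
                            sqrt (Btilde w (g_dag w) (\<tau>_tilde w (g_dag w))) + sqrt \<omega>,
                            sqrt (Delta M N (\<tau>_hat w (g_dag w)))})
             M" if w: "w \<in> A" for w
  proof -
    have wP: "w \<in> space P" using sets.sets_into_space[OF A(1)] w by blast
    have star: "g_star \<in> LPC J b" using g_star by (simp add: is_arg_max_def)
    have hat: "g_hat w \<in> LPC J b" and hat_max: "\<Psi>_hat w g_star \<le> \<Psi>_hat w (g_hat w)"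
      using g_hat[OF wP] star by (auto simp: is_arg_max_def not_less)
    have dag: "g_dag w \<in> LPC J b"
      and dag_max: "\<And>g. g \<in> LPC J b \<Longrightarrow> \<bar>\<Psi>_hat w g - \<Psi> g\<bar> \<le> \<bar>\<Psi>_hat w (g_dag w) - \<Psi> (g_dag w)\<bar>"
      using g_dag[OF wP] by (auto simp: is_arg_max_def not_less)
    let ?x = "sqrt (Bhat w (g_dag w) (\<tau>_hat w (g_dag w)))"
    let ?y = "sqrt (Btilde w (g_dag w) (\<tau>_tilde w (g_dag w)))"
    let ?z = "sqrt (Delta M N (\<tau>_hat w (g_dag w)))"
    have Bh: "Bhat w (g_dag w) = B_hat M N e (\<lambda>s. X s w) (\<lambda>s. D s w) (g_dag w)"
      and Bt: "Btilde w (g_dag w) = B_tilde M N e (\<lambda>s. X s w) (g_dag w)"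
      by (rule ext, rule Bhat) (rule ext, rule Btilde)
    have x0: "?x \<ge> 0"
      unfolding Bh B_hat_def
      by (intro real_sqrt_ge_zero mult_nonneg_nonneg add_nonneg_nonneg sum_nonneg divide_nonneg_nonneg
          zero_le_power2) simp_all
    have "\<bar>\<Psi>_hat w (g_dag w) - \<Psi> (g_dag w)\<bar> \<le> 12 * sqrt L * max ?x ?y"
      unfolding \<Psi>_hat \<Psi> Bh Bt
      by (rule dev[OF w, unfolded R_def, rule_format, OF LPC[OF dag] \<tau>_ocdr[OF wP dag] \<tau>_hat[OF wP dag, unfolded Bh] \<tau>_tilde[OF wP dag, unfolded Bt]])
    also have "\<dots> \<le> \<upsilon> * max ?x ?y"
      by (rule mult_right_mono[OF \<upsilon>L max.coboundedI1[OF x0]])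
    also have "\<dots> \<le> \<upsilon> * Max {?x, ?y + sqrt \<omega>, ?z}"
    proof (rule mult_left_mono)
      have "?y \<le> ?y + sqrt \<omega>" using \<omega>_pos by simp
      also have "\<dots> \<le> Max {?x, ?y + sqrt \<omega>, ?z}" by (rule Max_ge) auto
      finally have "?y \<le> Max {?x, ?y + sqrt \<omega>, ?z}" .
      moreover have "?x \<le> Max {?x, ?y + sqrt \<omega>, ?z}" by (rule Max_ge) auto
      ultimately show "max ?x ?y \<le> Max {?x, ?y + sqrt \<omega>, ?z}" by (rule max.boundedI[rotated])
      have "0 \<le> sqrt L" using L0 by simp
      then show "0 \<le> \<upsilon>" using \<upsilon>L by linarith
    qed
    finally have D: "\<bar>\<Psi>_hat w (g_dag w) - \<Psi> (g_dag w)\<bar> \<le> \<upsilon> * Max {?x, ?y + sqrt \<omega>, ?z}" .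
    have "\<Psi> g_star - \<Psi> (g_hat w) \<le> 2 * (\<upsilon> * Max {?x, ?y + sqrt \<omega>, ?z})"
      using dag_max[OF star] dag_max[OF hat] hat_max D by linarith
    moreover have "\<Psi> g_star - \<Psi> (g_hat w) \<le> M"
      using O.policy_value_range[OF LPC[OF star]] O.policy_value_range[OF LPC[OF hat]] unfolding \<Psi> by simp
    ultimately show ?thesis by simp
  qed
  then show ?thesis using A by blast
qed

end
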